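(* Let $\mathcal{A}=(A,B,\beta,T)$ be a relative Rota-Baxter group and $\mathcal{K}=(K,L,\alpha,S)$ a trivial relative Rota-Baxter group, where $K$ and $L$ are abelian groups. Let $(\nu,\mu,\sigma,f)$ be the quadruple of actions that makes $\mathcal{K}$ into an $\mathcal{A}$-module. Then there is a bijection between $\operatorname{Ext}_{(\nu,\mu,\sigma,f)}(\mathcal{A},\mathcal{K})$ and $\operatorname{H}^2_{RRB}(\mathcal{A},\mathcal{K})$.
   Context: **Relative Rota-Baxter groups.** A relative Rota-Baxter group is a quadruple $(H,G,\phi,R)$ with $H,G$ groups, $\phi:G\to\operatorname{Aut}(H)$, $g\mapsto\phi_g$, a homomorphism, and $R:H\to G$ a map with $R(h_1)R(h_2)=R(h_1\phi_{R(h_1)}(h_2))$ for all $h_1,h_2\in H$. It is trivial if $\phi$ is the trivial homomorphism (then $R$ is a group homomorphism). For $(A,B,\beta,T)$ write $a_1\circ_T a_2=a_1\beta_{T(a_1)}(a_2)$; this is a group operation on $A$ and $T(a_1\circ_Ta_2)=T(a_1)T(a_2)$. A homomorphism $(\psi,\eta):(H,G,\phi,R)\to(H',G',\phi',R')$ is a pair of group homomorphisms $\psi:H\to H'$, $\eta:G\to G'$ with $\eta R=R'\psi$ and $\psi\phi_g=\phi'_{\eta(g)}\psi$ for all $g\in G$; it is an isomorphism (embedding, epimorphism) if both $\psi,\eta$ are bijective (injective, surjective). **Extensions.** An extension of $(A,B,\beta,T)$ by $(K,L,\alpha,S)$ is a relative Rota-Baxter group $(H,G,\phi,R)$ with an embedding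 $(i_1,i_2):(K,L,\alpha,S)\to(H,G,\phi,R)$ and an epimorphism $(\pi_1,\pi_2):(H,G,\phi,R)\to(A,B,\beta,T)$ such that $\operatorname{im}(i_1)=\ker(\pi_1)$ and $\operatorname{im}(i_2)=\ker(\pi_2)$; $i_1,i_2$ are regarded as inclusions. Two extensions $(H,G,\phi,R)$, $(H',G',\phi',R')$ of $\mathcal{A}$ by $\mathcal{K}$ are equivalent if there is an isomorphism $(\eta,\zeta)$ between them with $\eta i_1=i_1'$, $\zeta i_2=i_2'$, $\pi_1'\eta=\pi_1$, $\pi_2'\zeta=\pi_2$. **Associated action.** For $K,L$ abelian and $\alpha$ trivial, choose set-theoretic sections $s_H:A\to H$ of $\pi_1$ and $s_G:B\to G$ of $\pi_2$ with $s_H(1)=1$, $s_G(1)=1$. The associated action of the extension is $(\nu,\mu,\sigma,f)$ with $\nu_b(k)=\phi_{s_G(b)}(k)$, $\mu_a(k)=s_H(a)^{-1}ks_H(a)$, $\sigma_b(l)=s_G(b)^{-1}ls_G(b)$, $f(l,a)=s_H(a)^{-1}\phi_l(s_H(a))\in K$ for $a\in A,b\in B,k\in K,l\in L$. It does not depend on the sections, and equivalent extensions have the same associated action. $\operatorname{Ext}_{(\nu,\mu,\sigma,f)}(\mathcal{A},\mathcal{K})$ is the set of equivalence classes of extensions of $\mathcal{A}$ by $\mathcal{K}$ with associated action $(\nu,\mu,\sigma,f)$. **Modules.** A quadruple $(\nu,\mu,\sigma,f)$ makes the trivial relative Rota-Baxter group $\mathcal{K}=(K,L,\alpha,S)$ ($K,L$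 abelian) into an $\mathcal{A}$-module if: (1) $\nu:B\to\operatorname{Aut}(K)$ is a homomorphism and $\mu:A\to\operatorname{Aut}(K)$ an anti-homomorphism; (2) $\sigma:B\to\operatorname{Aut}(L)$ is an anti-homomorphism; (3) $f:L\times A\to K$ satisfies $f(l_1l_2,a)=f(l_1,a)f(l_2,a)$ and $f(l,a_1a_2)=\mu_{a_2}(f(l,a_1))f(l,a_2)$; (4) $S\big(\nu^{-1}_{T(a)}(\mu_a(k))\,\nu^{-1}_{T(a)}(f(S(k),a))\big)=\sigma_{T(a)}(S(k))$; (5) $\nu_b(\mu_a(k))=\mu_{\beta_b(a)}(\nu_b(k))$; for all $a,a_i\in A$, $b\in B$, $k\in K$, $l,l_i\in L$. **Second cohomology.** A tuple is degenerate if some entry is $1$. Let $C^n(A,K)$, $C^n(B,L)$, $C^n(A,L)$ be the groups of maps $A^n\to K$, $B^n\to L$, $A^n\to L$ vanishing on (sending to $1$) degenerate tuples, $C(A^m\times B^n,K)$ the group of maps $A^m\times B^n\to K$ vanishing on degenerate tuples, $C(A,L)=C^1(A,L)$. Put $C^1_{RRB}=C^1(A,K)\oplus C^1(B,L)$, $C^2_{RRB}=C^2(A,K)\oplus C^2(B,L)\oplus C(A\times B,K)\oplus C(A,L)$, and $C^3_{RRB}=C^3(A,K)\oplus C^3(B,L)\oplus C(A\times B^2,K)\oplus C(A^2\times B,K)\oplus C^2(A,L)$. For $\theta\in C^1(A,K)$, $\tau\in C^2(A,K)$: $\partial^1_\mu(\theta)(a_1,a_2)=\theta(a_2)\theta(a_1a_2)^{-1}\mu_{a_2}(\theta(a_1))$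 and $\partial^2_\mu(\tau)(a_1,a_2,a_3)=\tau(a_2,a_3)\tau(a_1a_2,a_3)^{-1}\tau(a_1,a_2a_3)\mu_{a_3}(\tau(a_1,a_2))^{-1}$; $\partial^1_\sigma,\partial^2_\sigma$ are defined by the same formulas with $(B,L,\sigma)$ in place of $(A,K,\mu)$. For $\chi\in C(A,L)$: $\delta^1_\sigma(\chi)(a_1,a_2)=\chi(a_2)\chi(a_1\circ_Ta_2)^{-1}\sigma_{T(a_2)}(\chi(a_1))$. Define $\partial^1_{RRB}:C^1_{RRB}\to C^2_{RRB}$ by $\partial^1_{RRB}(\theta_1,\theta_2)=(\partial^1_\mu(\theta_1),\partial^1_\sigma(\theta_2),\lambda_1,\lambda_2)$ with $\lambda_1(a,b)=\nu_b(f(\theta_2(b),a)\theta_1(a))\,\theta_1(\beta_b(a))^{-1}$ and $\lambda_2(a)=S(\nu^{-1}_{T(a)}(\theta_1(a)))\,\theta_2(T(a))^{-1}$. Define $\partial^2_{RRB}:C^2_{RRB}\to C^3_{RRB}$ by $\partial^2_{RRB}(\tau_1,\tau_2,\rho,\chi)=(\partial^2_\mu(\tau_1),\partial^2_\sigma(\tau_2),\gamma_1,\gamma_2,\gamma_3)$ with $\gamma_1(a,b_1,b_2)=\rho(a,b_1b_2)\,\nu_{b_1b_2}(f(\tau_2(b_1,b_2),a))\,\rho(\beta_{b_2}(a),b_1)^{-1}\,\nu_{b_1}(\rho(a,b_2))^{-1}$, $\gamma_2(a_1,a_2,b)=\rho(a_1a_2,b)\,\nu_b(\tau_1(a_1,a_2))\,\mu_{\beta_b(a_2)}(\rho(a_1,b))^{-1}\,\rho(a_2,b)^{-1}\,\tau_1(\beta_b(a_1),\beta_b(a_2))^{-1}$,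 $\gamma_3(a_1,a_2)=S\big(\nu^{-1}_{T(a_1\circ_Ta_2)}\big(\rho(a_2,T(a_1))\,\tau_1(a_1,\beta_{T(a_1)}(a_2))\,\nu_{T(a_1)}(f(\chi(a_1),a_2))\big)\big)\,\tau_2(T(a_1),T(a_2))^{-1}\,\delta^1_\sigma(\chi)(a_1,a_2)^{-1}$. The second cohomology group is defined as $\operatorname{H}^2_{RRB}(\mathcal{A},\mathcal{K})=\ker(\partial^2_{RRB})/\operatorname{im}(\partial^1_{RRB})$.
   Formalization: The inclusion of im(∂¹_RRB) in ker(∂²_RRB), needed for H²_RRB to be defined, is an added hypothesis: it does not follow from module conditions (1)–(5) (it fails for A=K=L=Z/3, B=Z/2, σ inversion, f multiplication, the rest trivial). *)

theory Defs
  imports "HOL-Algebra.Coset" "HOL-Algebra.Bij" "HOL-Library.Equipollence"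
begin

section \<open>Relative Rota-Baxter groups\<close>

type_synonym ('h, 'g) rrb = "'h monoid \<times> 'g monoid \<times> ('g \<Rightarrow> 'h \<Rightarrow> 'h) \<times> ('h \<Rightarrow> 'g)"

fun rrb_group :: "('h, 'g) rrb \<Rightarrow> bool" where
  "rrb_group (H, G, \<phi>, R) \<longleftrightarrow>
     group H \<and> group G \<and> \<phi> \<in> hom G (AutoGroup H) \<and> R \<in> carrier H \<rightarrow> carrier G \<and>
     (\<forall>h1 \<in> carrier H. \<forall>h2 \<in> carrier H.
        R h1 \<otimes>\<^bsub>G\<^esub> R h2 = R (h1 \<otimes>\<^bsub>H\<^esub> \<phi> (R h1) h2))"

fun trivial_rrb :: "('h, 'g) rrb \<Rightarrow> bool" where
  "trivial_rrb (H, G, \<phi>, R) \<longleftrightarrow>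
     rrb_group (H, G, \<phi>, R) \<and> (\<forall>g \<in> carrier G. \<phi> g = \<one>\<^bsub>AutoGroup H\<^esub>)"

fun rrb_circ :: "('a, 'b) rrb \<Rightarrow> 'a \<Rightarrow> 'a \<Rightarrow> 'a" where
  "rrb_circ (A, B, \<beta>, T) a1 a2 = a1 \<otimes>\<^bsub>A\<^esub> \<beta> (T a1) a2"

fun rrb_hom :: "('h, 'g) rrb \<Rightarrow> ('h2, 'g2) rrb \<Rightarrow> ('h \<Rightarrow> 'h2) \<Rightarrow> ('g \<Rightarrow> 'g2) \<Rightarrow> bool" where
  "rrb_hom (H, G, \<phi>, R) (H', G', \<phi>', R') \<psi> \<eta> \<longleftrightarrow>
     \<psi> \<in> hom H H' \<and> \<eta> \<in> hom G G' \<and>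
     (\<forall>h \<in> carrier H. \<eta> (R h) = R' (\<psi> h)) \<and>
     (\<forall>g \<in> carrier G. \<forall>h \<in> carrier H. \<psi> (\<phi> g h) = \<phi>' (\<eta> g) (\<psi> h))"

fun rrb_iso :: "('h, 'g) rrb \<Rightarrow> ('h2, 'g2) rrb \<Rightarrow> ('h \<Rightarrow> 'h2) \<Rightarrow> ('g \<Rightarrow> 'g2) \<Rightarrow> bool" where
  "rrb_iso (H, G, \<phi>, R) (H', G', \<phi>', R') \<psi> \<eta> \<longleftrightarrow>
     rrb_hom (H, G, \<phi>, R) (H', G', \<phi>', R') \<psi> \<eta> \<and>
     bij_betw \<psi> (carrier H) (carrier H') \<and> bij_betw \<eta> (carrier G) (carrier G')"

fun rrb_embedding :: "('h, 'g) rrb \<Rightarrow> ('h2, 'g2) rrb \<Rightarrow> ('h \<Rightarrow> 'h2) \<Rightarrow> ('g \<Rightarrow> 'g2) \<Rightarrow> bool" where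
  "rrb_embedding (H, G, \<phi>, R) (H', G', \<phi>', R') \<psi> \<eta> \<longleftrightarrow>
     rrb_hom (H, G, \<phi>, R) (H', G', \<phi>', R') \<psi> \<eta> \<and>
     inj_on \<psi> (carrier H) \<and> inj_on \<eta> (carrier G)"

fun rrb_epimorphism :: "('h, 'g) rrb \<Rightarrow> ('h2, 'g2) rrb \<Rightarrow> ('h \<Rightarrow> 'h2) \<Rightarrow> ('g \<Rightarrow> 'g2) \<Rightarrow> bool" where
  "rrb_epimorphism (H, G, \<phi>, R) (H', G', \<phi>', R') \<psi> \<eta> \<longleftrightarrow>
     rrb_hom (H, G, \<phi>, R) (H', G', \<phi>', R') \<psi> \<eta> \<and>
     \<psi> ` carrier H = carrier H' \<and> \<eta> ` carrier G = carrier G'"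


section \<open>Extensions\<close>

text \<open>An extension of \<open>(A, B, \<beta>, T)\<close> by \<open>(K, L, \<alpha>, S)\<close> is encoded as
  \<open>((H, G, \<phi>, R), i1, i2, \<pi>1, \<pi>2)\<close>.\<close>

type_synonym ('h, 'g, 'a, 'b, 'k, 'l) rrb_ext =
  "('h, 'g) rrb \<times> ('k \<Rightarrow> 'h) \<times> ('l \<Rightarrow> 'g) \<times> ('h \<Rightarrow> 'a) \<times> ('g \<Rightarrow> 'b)"

fun rrb_extension ::
  "('a, 'b) rrb \<Rightarrow> ('k, 'l) rrb \<Rightarrow> ('h, 'g, 'a, 'b, 'k, 'l) rrb_ext \<Rightarrow> bool" where
  "rrb_extension (A, B, \<beta>, T) (K, L, \<alpha>, S) ((H, G, \<phi>, R), i1, i2, \<pi>1, \<pi>2) \<longleftrightarrow>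
     rrb_group (H, G, \<phi>, R) \<and>
     rrb_embedding (K, L, \<alpha>, S) (H, G, \<phi>, R) i1 i2 \<and>
     rrb_epimorphism (H, G, \<phi>, R) (A, B, \<beta>, T) \<pi>1 \<pi>2 \<and>
     i1 ` carrier K = kernel H A \<pi>1 \<and>
     i2 ` carrier L = kernel G B \<pi>2"

fun ext_equivalent ::
  "('a, 'b) rrb \<Rightarrow> ('k, 'l) rrb \<Rightarrow> ('h, 'g, 'a, 'b, 'k, 'l) rrb_ext \<Rightarrow>
   ('h2, 'g2, 'a, 'b, 'k, 'l) rrb_ext \<Rightarrow> bool" where
  "ext_equivalent (A, B, \<beta>, T) (K, L, \<alpha>, S)
     ((H, G, \<phi>, R), i1, i2, \<pi>1, \<pi>2) ((H', G', \<phi>', R'), i1', i2', \<pi>1', \<pi>2') \<longleftrightarrow>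
     (\<exists>\<eta> \<zeta>. rrb_iso (H, G, \<phi>, R) (H', G', \<phi>', R') \<eta> \<zeta> \<and>
        (\<forall>k \<in> carrier K. \<eta> (i1 k) = i1' k) \<and>
        (\<forall>l \<in> carrier L. \<zeta> (i2 l) = i2' l) \<and>
        (\<forall>h \<in> carrier H. \<pi>1' (\<eta> h) = \<pi>1 h) \<and>
        (\<forall>g \<in> carrier G. \<pi>2' (\<zeta> g) = \<pi>2 g))"

text \<open>A quadruple of actions \<open>(\<nu>, \<mu>, \<sigma>, f)\<close> with
  \<open>\<nu> b k\<close>, \<open>\<mu> a k\<close>, \<open>\<sigma> b l\<close> and \<open>f l a\<close> curried.\<close>

type_synonym ('a, 'b, 'k, 'l) rrb_act =
  "('b \<Rightarrow> 'k \<Rightarrow> 'k) \<times> ('a \<Rightarrow> 'k \<Rightarrow> 'k) \<times> ('b \<Rightarrow> 'l \<Rightarrow> 'l) \<times> ('l \<Rightarrow> 'a \<Rightarrow> 'k)"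

definition normalized_section :: "'h monoid \<Rightarrow> 'a monoid \<Rightarrow> ('h \<Rightarrow> 'a) \<Rightarrow> ('a \<Rightarrow> 'h) \<Rightarrow> bool" where
  "normalized_section H A \<pi> s \<longleftrightarrow>
     s \<in> carrier A \<rightarrow> carrier H \<and> (\<forall>a \<in> carrier A. \<pi> (s a) = a) \<and> s \<one>\<^bsub>A\<^esub> = \<one>\<^bsub>H\<^esub>"

text \<open>The values of the associated action lie in \<open>K\<close> and \<open>L\<close>, which are identified with
  subgroups of \<open>H\<close> and \<open>G\<close> along \<open>i1\<close> and \<open>i2\<close>. Normalized sections always exist and the
  action does not depend on them, so any choice of sections may serve as witness.\<close>

fun has_associated_action ::
  "('a, 'b) rrb \<Rightarrow> ('k, 'l) rrb \<Rightarrow> ('h, 'g, 'a, 'b, 'k, 'l) rrb_ext \<Rightarrow>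
   ('a, 'b, 'k, 'l) rrb_act \<Rightarrow> bool" where
  "has_associated_action (A, B, \<beta>, T) (K, L, \<alpha>, S) ((H, G, \<phi>, R), i1, i2, \<pi>1, \<pi>2) (\<nu>, \<mu>, \<sigma>, f) \<longleftrightarrow>
     (\<exists>sH sG. normalized_section H A \<pi>1 sH \<and> normalized_section G B \<pi>2 sG \<and>
        (\<forall>b \<in> carrier B. \<forall>k \<in> carrier K. i1 (\<nu> b k) = \<phi> (sG b) (i1 k)) \<and>
        (\<forall>a \<in> carrier A. \<forall>k \<in> carrier K. i1 (\<mu> a k) = inv\<^bsub>H\<^esub> (sH a) \<otimes>\<^bsub>H\<^esub> i1 k \<otimes>\<^bsub>H\<^esub> sH a) \<and>
        (\<forall>b \<in> carrier B. \<forall>l \<in> carrier L. i2 (\<sigma> b l) = inv\<^bsub>G\<^esub> (sG b) \<otimes>\<^bsub>G\<^esub> i2 l \<otimes>\<^bsub>G\<^esub> sG b) \<and>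
        (\<forall>l \<in> carrier L. \<forall>a \<in> carrier A. i1 (f l a) = inv\<^bsub>H\<^esub> (sH a) \<otimes>\<^bsub>H\<^esub> \<phi> (i2 l) (sH a)))"

text \<open>Equivalence classes of extensions whose underlying groups live on the types \<open>'h\<close> and
  \<open>'g\<close>. Since \<open>H\<close> and \<open>G\<close> are in bijection with \<open>A \<times> K\<close> and \<open>B \<times> L\<close>, every extension has
  an equivalent copy there as soon as \<open>A \<times> K\<close> injects into \<open>'h\<close> and \<open>B \<times> L\<close> into \<open>'g\<close>;
  otherwise there is no extension on these types at all. Values of the components outside the
  carriers are irrelevant, being identified by the equivalence.\<close>

definition extensions_with_action ::
  "('a, 'b) rrb \<Rightarrow> ('k, 'l) rrb \<Rightarrow> ('a, 'b, 'k, 'l) rrb_act \<Rightarrow>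
   ('h, 'g, 'a, 'b, 'k, 'l) rrb_ext set" where
  "extensions_with_action \<A> \<K> \<Q> =
     {\<E>. rrb_extension \<A> \<K> \<E> \<and> has_associated_action \<A> \<K> \<E> \<Q>}"

definition Ext_RRB ::
  "('a, 'b) rrb \<Rightarrow> ('k, 'l) rrb \<Rightarrow> ('a, 'b, 'k, 'l) rrb_act \<Rightarrow>
   ('h, 'g, 'a, 'b, 'k, 'l) rrb_ext set set" where
  "Ext_RRB \<A> \<K> \<Q> =
     extensions_with_action \<A> \<K> \<Q> //
     {(\<E>, \<E>'). \<E> \<in> extensions_with_action \<A> \<K> \<Q> \<and> \<E>' \<in> extensions_with_action \<A> \<K> \<Q> \<and>
               ext_equivalent \<A> \<K> \<E> \<E>'}"


section \<open>Modules\<close>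

definition anti_hom :: "'x monoid \<Rightarrow> 'y monoid \<Rightarrow> ('x \<Rightarrow> 'y) set" where
  "anti_hom G M = {h. h \<in> carrier G \<rightarrow> carrier M \<and>
     (\<forall>x \<in> carrier G. \<forall>y \<in> carrier G. h (x \<otimes>\<^bsub>G\<^esub> y) = h y \<otimes>\<^bsub>M\<^esub> h x)}"

fun rrb_module :: "('a, 'b) rrb \<Rightarrow> ('k, 'l) rrb \<Rightarrow> ('a, 'b, 'k, 'l) rrb_act \<Rightarrow> bool" where
  "rrb_module (A, B, \<beta>, T) (K, L, \<alpha>, S) (\<nu>, \<mu>, \<sigma>, f) \<longleftrightarrow>
     \<nu> \<in> hom B (AutoGroup K) \<and>
     \<mu> \<in> anti_hom A (AutoGroup K) \<and>
     \<sigma> \<in> anti_hom B (AutoGroup L) \<and>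
     f \<in> carrier L \<rightarrow> carrier A \<rightarrow> carrier K \<and>
     (\<forall>l1 \<in> carrier L. \<forall>l2 \<in> carrier L. \<forall>a \<in> carrier A.
        f (l1 \<otimes>\<^bsub>L\<^esub> l2) a = f l1 a \<otimes>\<^bsub>K\<^esub> f l2 a) \<and>
     (\<forall>l \<in> carrier L. \<forall>a1 \<in> carrier A. \<forall>a2 \<in> carrier A.
        f l (a1 \<otimes>\<^bsub>A\<^esub> a2) = \<mu> a2 (f l a1) \<otimes>\<^bsub>K\<^esub> f l a2) \<and>
     (\<forall>a \<in> carrier A. \<forall>k \<in> carrier K.
        S ((inv\<^bsub>AutoGroup K\<^esub> \<nu> (T a)) (\<mu> a k) \<otimes>\<^bsub>K\<^esub> (inv\<^bsub>AutoGroup K\<^esub> \<nu> (T a)) (f (S k) a))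
          = \<sigma> (T a) (S k)) \<and>
     (\<forall>a \<in> carrier A. \<forall>b \<in> carrier B. \<forall>k \<in> carrier K.
        \<nu> b (\<mu> a k) = \<mu> (\<beta> b a) (\<nu> b k))"


section \<open>Normalized cochains\<close>

text \<open>The group of maps \<open>X \<rightarrow> M\<close> sending every element of \<open>D\<close> to \<open>1\<close>; \<open>D\<close> will be the set
  of degenerate tuples in \<open>X\<close>. Maps are extensional, so that equality is equality on \<open>X\<close>.\<close>

definition cochain_group :: "'x set \<Rightarrow> 'x set \<Rightarrow> 'm monoid \<Rightarrow> ('x \<Rightarrow> 'm) monoid" where
  "cochain_group X D M =
     \<lparr>carrier = {c \<in> X \<rightarrow>\<^sub>E carrier M. \<forall>x \<in> X \<inter> D. c x = \<one>\<^bsub>M\<^esub>},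
      mult = \<lambda>c d. \<lambda>x\<in>X. c x \<otimes>\<^bsub>M\<^esub> d x,
      one = \<lambda>x\<in>X. \<one>\<^bsub>M\<^esub>\<rparr>"

definition cochains1 :: "'x monoid \<Rightarrow> 'm monoid \<Rightarrow> ('x \<Rightarrow> 'm) monoid" where
  "cochains1 X M = cochain_group (carrier X) {\<one>\<^bsub>X\<^esub>} M"

definition cochains2 ::
  "'x monoid \<Rightarrow> 'y monoid \<Rightarrow> 'm monoid \<Rightarrow> ('x \<times> 'y \<Rightarrow> 'm) monoid" where
  "cochains2 X Y M =
     cochain_group (carrier X \<times> carrier Y) {(x, y). x = \<one>\<^bsub>X\<^esub> \<or> y = \<one>\<^bsub>Y\<^esub>} M"

definition cochains3 ::
  "'x monoid \<Rightarrow> 'y monoid \<Rightarrow> 'z monoid \<Rightarrow> 'm monoid \<Rightarrow> ('x \<times> 'y \<times> 'z \<Rightarrow> 'm) monoid" where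
  "cochains3 X Y Z M =
     cochain_group (carrier X \<times> carrier Y \<times> carrier Z)
       {(x, y, z). x = \<one>\<^bsub>X\<^esub> \<or> y = \<one>\<^bsub>Y\<^esub> \<or> z = \<one>\<^bsub>Z\<^esub>} M"

fun C1_RRB :: "('a, 'b) rrb \<Rightarrow> ('k, 'l) rrb \<Rightarrow> (('a \<Rightarrow> 'k) \<times> ('b \<Rightarrow> 'l)) monoid" where
  "C1_RRB (A, B, \<beta>, T) (K, L, \<alpha>, S) = cochains1 A K \<times>\<times> cochains1 B L"

fun C2_RRB :: "('a, 'b) rrb \<Rightarrow> ('k, 'l) rrb \<Rightarrow>
    (('a \<times> 'a \<Rightarrow> 'k) \<times> ('b \<times> 'b \<Rightarrow> 'l) \<times> ('a \<times> 'b \<Rightarrow> 'k) \<times> ('a \<Rightarrow> 'l)) monoid" where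
  "C2_RRB (A, B, \<beta>, T) (K, L, \<alpha>, S) =
     cochains2 A A K \<times>\<times> cochains2 B B L \<times>\<times> cochains2 A B K \<times>\<times> cochains1 A L"

fun C3_RRB :: "('a, 'b) rrb \<Rightarrow> ('k, 'l) rrb \<Rightarrow>
    (('a \<times> 'a \<times> 'a \<Rightarrow> 'k) \<times> ('b \<times> 'b \<times> 'b \<Rightarrow> 'l) \<times> ('a \<times> 'b \<times> 'b \<Rightarrow> 'k) \<times>
     ('a \<times> 'a \<times> 'b \<Rightarrow> 'k) \<times> ('a \<times> 'a \<Rightarrow> 'l)) monoid" where
  "C3_RRB (A, B, \<beta>, T) (K, L, \<alpha>, S) =
     cochains3 A A A K \<times>\<times> cochains3 B B B L \<times>\<times> cochains3 A B B K \<times>\<times> cochains3 A A B K \<times>\<times>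
     cochains2 A A L"


section \<open>Coboundary maps and second cohomology\<close>

definition partial1 ::
  "'x monoid \<Rightarrow> 'm monoid \<Rightarrow> ('x \<Rightarrow> 'm \<Rightarrow> 'm) \<Rightarrow> ('x \<Rightarrow> 'm) \<Rightarrow> ('x \<times> 'x \<Rightarrow> 'm)" where
  "partial1 X M \<mu> \<theta> = (\<lambda>(x1, x2) \<in> carrier X \<times> carrier X.
     \<theta> x2 \<otimes>\<^bsub>M\<^esub> inv\<^bsub>M\<^esub> \<theta> (x1 \<otimes>\<^bsub>X\<^esub> x2) \<otimes>\<^bsub>M\<^esub> \<mu> x2 (\<theta> x1))"

definition partial2 ::
  "'x monoid \<Rightarrow> 'm monoid \<Rightarrow> ('x \<Rightarrow> 'm \<Rightarrow> 'm) \<Rightarrow> ('x \<times> 'x \<Rightarrow> 'm) \<Rightarrow> ('x \<times> 'x \<times> 'x \<Rightarrow> 'm)" where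
  "partial2 X M \<mu> \<tau> = (\<lambda>(x1, x2, x3) \<in> carrier X \<times> carrier X \<times> carrier X.
     \<tau> (x2, x3) \<otimes>\<^bsub>M\<^esub> inv\<^bsub>M\<^esub> \<tau> (x1 \<otimes>\<^bsub>X\<^esub> x2, x3) \<otimes>\<^bsub>M\<^esub> \<tau> (x1, x2 \<otimes>\<^bsub>X\<^esub> x3)
       \<otimes>\<^bsub>M\<^esub> inv\<^bsub>M\<^esub> \<mu> x3 (\<tau> (x1, x2)))"

fun delta1 ::
  "('a, 'b) rrb \<Rightarrow> 'l monoid \<Rightarrow> ('b \<Rightarrow> 'l \<Rightarrow> 'l) \<Rightarrow> ('a \<Rightarrow> 'l) \<Rightarrow> ('a \<times> 'a \<Rightarrow> 'l)" where
  "delta1 (A, B, \<beta>, T) L \<sigma> \<chi> = (\<lambda>(a1, a2) \<in> carrier A \<times> carrier A.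
     \<chi> a2 \<otimes>\<^bsub>L\<^esub> inv\<^bsub>L\<^esub> \<chi> (rrb_circ (A, B, \<beta>, T) a1 a2) \<otimes>\<^bsub>L\<^esub> \<sigma> (T a2) (\<chi> a1))"

fun partial1_RRB ::
  "('a, 'b) rrb \<Rightarrow> ('k, 'l) rrb \<Rightarrow> ('a, 'b, 'k, 'l) rrb_act \<Rightarrow> ('a \<Rightarrow> 'k) \<times> ('b \<Rightarrow> 'l) \<Rightarrow>
   ('a \<times> 'a \<Rightarrow> 'k) \<times> ('b \<times> 'b \<Rightarrow> 'l) \<times> ('a \<times> 'b \<Rightarrow> 'k) \<times> ('a \<Rightarrow> 'l)" where
  "partial1_RRB (A, B, \<beta>, T) (K, L, \<alpha>, S) (\<nu>, \<mu>, \<sigma>, f) (\<theta>1, \<theta>2) =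
     (partial1 A K \<mu> \<theta>1,
      partial1 B L \<sigma> \<theta>2,
      (\<lambda>(a, b) \<in> carrier A \<times> carrier B.
         \<nu> b (f (\<theta>2 b) a \<otimes>\<^bsub>K\<^esub> \<theta>1 a) \<otimes>\<^bsub>K\<^esub> inv\<^bsub>K\<^esub> \<theta>1 (\<beta> b a)),
      (\<lambda>a \<in> carrier A.
         S ((inv\<^bsub>AutoGroup K\<^esub> \<nu> (T a)) (\<theta>1 a)) \<otimes>\<^bsub>L\<^esub> inv\<^bsub>L\<^esub> \<theta>2 (T a)))"

fun partial2_RRB ::
  "('a, 'b) rrb \<Rightarrow> ('k, 'l) rrb \<Rightarrow> ('a, 'b, 'k, 'l) rrb_act \<Rightarrow>
   ('a \<times> 'a \<Rightarrow> 'k) \<times> ('b \<times> 'b \<Rightarrow> 'l) \<times> ('a \<times> 'b \<Rightarrow> 'k) \<times> ('a \<Rightarrow> 'l) \<Rightarrow>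
   ('a \<times> 'a \<times> 'a \<Rightarrow> 'k) \<times> ('b \<times> 'b \<times> 'b \<Rightarrow> 'l) \<times> ('a \<times> 'b \<times> 'b \<Rightarrow> 'k) \<times>
     ('a \<times> 'a \<times> 'b \<Rightarrow> 'k) \<times> ('a \<times> 'a \<Rightarrow> 'l)" where
  "partial2_RRB (A, B, \<beta>, T) (K, L, \<alpha>, S) (\<nu>, \<mu>, \<sigma>, f) (\<tau>1, \<tau>2, \<rho>, \<chi>) =
     (partial2 A K \<mu> \<tau>1,
      partial2 B L \<sigma> \<tau>2,
      (\<lambda>(a, b1, b2) \<in> carrier A \<times> carrier B \<times> carrier B.
         \<rho> (a, b1 \<otimes>\<^bsub>B\<^esub> b2) \<otimes>\<^bsub>K\<^esub> \<nu> (b1 \<otimes>\<^bsub>B\<^esub> b2) (f (\<tau>2 (b1, b2)) a)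
           \<otimes>\<^bsub>K\<^esub> inv\<^bsub>K\<^esub> \<rho> (\<beta> b2 a, b1) \<otimes>\<^bsub>K\<^esub> inv\<^bsub>K\<^esub> \<nu> b1 (\<rho> (a, b2))),
      (\<lambda>(a1, a2, b) \<in> carrier A \<times> carrier A \<times> carrier B.
         \<rho> (a1 \<otimes>\<^bsub>A\<^esub> a2, b) \<otimes>\<^bsub>K\<^esub> \<nu> b (\<tau>1 (a1, a2)) \<otimes>\<^bsub>K\<^esub> inv\<^bsub>K\<^esub> \<mu> (\<beta> b a2) (\<rho> (a1, b))
           \<otimes>\<^bsub>K\<^esub> inv\<^bsub>K\<^esub> \<rho> (a2, b) \<otimes>\<^bsub>K\<^esub> inv\<^bsub>K\<^esub> \<tau>1 (\<beta> b a1, \<beta> b a2)),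
      (\<lambda>(a1, a2) \<in> carrier A \<times> carrier A.
         S ((inv\<^bsub>AutoGroup K\<^esub> \<nu> (T (rrb_circ (A, B, \<beta>, T) a1 a2)))
              (\<rho> (a2, T a1) \<otimes>\<^bsub>K\<^esub> \<tau>1 (a1, \<beta> (T a1) a2) \<otimes>\<^bsub>K\<^esub> \<nu> (T a1) (f (\<chi> a1) a2)))
           \<otimes>\<^bsub>L\<^esub> inv\<^bsub>L\<^esub> \<tau>2 (T a1, T a2)
           \<otimes>\<^bsub>L\<^esub> inv\<^bsub>L\<^esub> delta1 (A, B, \<beta>, T) L \<sigma> \<chi> (a1, a2)))"

definition Z2_RRB where
  "Z2_RRB \<A> \<K> \<Q> = kernel (C2_RRB \<A> \<K>) (C3_RRB \<A> \<K>) (partial2_RRB \<A> \<K> \<Q>)"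

definition B2_RRB where
  "B2_RRB \<A> \<K> \<Q> = partial1_RRB \<A> \<K> \<Q> ` carrier (C1_RRB \<A> \<K>)"

text \<open>Meaningful as a quotient only if \<open>B2_RRB \<A> \<K> \<Q> \<subseteq> Z2_RRB \<A> \<K> \<Q>\<close>. This inclusion does not
  follow from \<open>rrb_module\<close>: for a module it is equivalent to
  \<open>\<nu> b (f (\<sigma> b l) a) = f l (\<beta> b a)\<close>, an identity satisfied by the associated action of any
  extension.\<close>

definition H2_RRB where
  "H2_RRB \<A> \<K> \<Q> = (C2_RRB \<A> \<K>)\<lparr>carrier := Z2_RRB \<A> \<K> \<Q>\<rparr> Mod B2_RRB \<A> \<K> \<Q>"

end

theory Submission
  imports Defs
begin

text \<open>
  Sections \<open>s\<^sub>H\<close>, \<open>s\<^sub>G\<close> of an extension give coordinates \<open>(a, k) \<mapsto> s\<^sub>H a \<cdot> k\<close> on \<open>H\<close> and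
  \<open>(b, l) \<mapsto> s\<^sub>G b \<cdot> l\<close> on \<open>G\<close>. In them the products, the action and the Rota-Baxter map are
  determined by a normalized cochain \<open>(\<tau>\<^sub>1, \<tau>\<^sub>2, \<rho>, \<chi>)\<close>:
  \<open>(a\<^sub>1, k\<^sub>1)(a\<^sub>2, k\<^sub>2) = (a\<^sub>1 a\<^sub>2, \<tau>\<^sub>1(a\<^sub>1, a\<^sub>2) \<mu>\<^bsub>a\<^sub>2\<^esub>(k\<^sub>1) k\<^sub>2)\<close>, likewise with \<open>\<tau>\<^sub>2\<close> and \<open>\<sigma>\<close> on \<open>G\<close>,
  \<open>\<phi>\<^bsub>(b, l)\<^esub>(a, k) = (\<beta>\<^sub>b(a), \<rho>(a, b) \<nu>\<^sub>b(f(l, a) k))\<close> and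
  \<open>R(a, k) = (T(a), \<chi>(a) S(\<nu>\<^bsub>T(a)\<^esub>\<^sup>-\<^sup>1(k)))\<close>.
  Such formulas define a relative Rota-Baxter group iff the cochain is a 2-cocycle. The cochains
  presenting one fixed extension form a coset of the coboundaries, a change of coordinates being
  \<open>(a, k) \<mapsto> (a, \<theta>\<^sub>1(a) k)\<close>, \<open>(b, l) \<mapsto> (b, \<theta>\<^sub>2(b) l)\<close>; and two extensions are equivalent iff
  they are presented by the same cochains. So sending an extension to the set of cochains
  presenting it is the required bijection.
\<close>

section \<open>Actions by automorphisms\<close>

lemma AutoGroup_carrier_iff:
  "h \<in> carrier (AutoGroup H) \<longleftrightarrow>
     h \<in> hom H H \<and> h \<in> extensional (carrier H) \<and> bij_betw h (carrier H) (carrier H)"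
  by (auto simp: AutoGroup_def auto_def Bij_def)

lemma AutoGroup_mult_apply:
  assumes "g \<in> carrier (AutoGroup H)" "h \<in> carrier (AutoGroup H)" "x \<in> carrier H"
  shows "(g \<otimes>\<^bsub>AutoGroup H\<^esub> h) x = g (h x)"
  using assms by (simp add: AutoGroup_def auto_def BijGroup_def compose_def)

lemma AutoGroup_one_apply: "x \<in> carrier H \<Longrightarrow> \<one>\<^bsub>AutoGroup H\<^esub> x = x"
  by (simp add: AutoGroup_def BijGroup_def)

text \<open>The laws that do not involve the product of \<open>G\<close>, collected so that left
  actions (homomorphisms) and right actions (anti-homomorphisms) can share them.\<close>

locale automorphic_family = G: group G + H: group H for G (structure) and H (structure) +
  fixes \<phi>
  assumes in_Aut [simp]: "g \<in> carrier G \<Longrightarrow> \<phi> g \<in> carrier (AutoGroup H)"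
begin

sublocale Aut: group "AutoGroup H"
  by (rule H.AutoGroup)

lemma act_bij: "g \<in> carrier G \<Longrightarrow> bij_betw (\<phi> g) (carrier H) (carrier H)"
  using in_Aut by (simp add: AutoGroup_carrier_iff)

lemma act_closed [simp]: "g \<in> carrier G \<Longrightarrow> x \<in> carrier H \<Longrightarrow> \<phi> g x \<in> carrier H"
  using act_bij by (auto simp: bij_betw_def)

lemma act_group_hom: "g \<in> carrier G \<Longrightarrow> group_hom H H (\<phi> g)"
  using in_Aut[of g] by (simp add: AutoGroup_carrier_iff group_hom_def group_hom_axioms_def)

lemma act_mult [simp]:
  "g \<in> carrier G \<Longrightarrow> x \<in> carrier H \<Longrightarrow> y \<in> carrier H \<Longrightarrow> \<phi> g (x \<otimes>\<^bsub>H\<^esub> y) = \<phi> g x \<otimes>\<^bsub>H\<^esub> \<phi> g y"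
  using act_group_hom by (blast intro: group_hom.hom_mult)

lemma act_one [simp]: "g \<in> carrier G \<Longrightarrow> \<phi> g \<one>\<^bsub>H\<^esub> = \<one>\<^bsub>H\<^esub>"
  using act_group_hom by (blast intro: group_hom.hom_one)

lemma inv_in_Aut [simp]: "g \<in> carrier G \<Longrightarrow> inv\<^bsub>AutoGroup H\<^esub> \<phi> g \<in> carrier (AutoGroup H)"
  by simp

lemma invact_closed [simp]:
  "g \<in> carrier G \<Longrightarrow> x \<in> carrier H \<Longrightarrow> (inv\<^bsub>AutoGroup H\<^esub> \<phi> g) x \<in> carrier H"
  using inv_in_Aut[of g] by (auto simp: AutoGroup_carrier_iff bij_betw_def)

lemma act_invact [simp]:
  "g \<in> carrier G \<Longrightarrow> x \<in> carrier H \<Longrightarrow> \<phi> g ((inv\<^bsub>AutoGroup H\<^esub> \<phi> g) x) = x"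
  by (metis AutoGroup_mult_apply AutoGroup_one_apply Aut.r_inv in_Aut inv_in_Aut)

lemma invact_act [simp]:
  "g \<in> carrier G \<Longrightarrow> x \<in> carrier H \<Longrightarrow> (inv\<^bsub>AutoGroup H\<^esub> \<phi> g) (\<phi> g x) = x"
  by (metis AutoGroup_mult_apply AutoGroup_one_apply Aut.l_inv in_Aut inv_in_Aut)

lemma invact_mult [simp]:
  "g \<in> carrier G \<Longrightarrow> x \<in> carrier H \<Longrightarrow> y \<in> carrier H \<Longrightarrow>
    (inv\<^bsub>AutoGroup H\<^esub> \<phi> g) (x \<otimes>\<^bsub>H\<^esub> y) = (inv\<^bsub>AutoGroup H\<^esub> \<phi> g) x \<otimes>\<^bsub>H\<^esub> (inv\<^bsub>AutoGroup H\<^esub> \<phi> g) y"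
  using inv_in_Aut[of g] by (auto simp: AutoGroup_carrier_iff hom_def)

lemma invact_one [simp]: "g \<in> carrier G \<Longrightarrow> (inv\<^bsub>AutoGroup H\<^esub> \<phi> g) \<one>\<^bsub>H\<^esub> = \<one>\<^bsub>H\<^esub>"
  by (metis act_one invact_act H.one_closed)

lemma act_eq_iff:
  "g \<in> carrier G \<Longrightarrow> x \<in> carrier H \<Longrightarrow> y \<in> carrier H \<Longrightarrow> \<phi> g x = \<phi> g y \<longleftrightarrow> x = y"
  by (metis invact_act)

end

locale automorphic_action = G: group G + H: group H for G (structure) and H (structure) +
  fixes \<phi>
  assumes action_hom: "\<phi> \<in> hom G (AutoGroup H)"
begin

sublocale automorphic_family G H \<phi>
  using action_hom by unfold_locales (auto simp: hom_def)

lemma act_comp: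
  "g \<in> carrier G \<Longrightarrow> g' \<in> carrier G \<Longrightarrow> x \<in> carrier H \<Longrightarrow> \<phi> (g \<otimes>\<^bsub>G\<^esub> g') x = \<phi> g (\<phi> g' x)"
  using action_hom by (simp add: hom_mult AutoGroup_mult_apply)

lemma act_ident [simp]: "x \<in> carrier H \<Longrightarrow> \<phi> \<one>\<^bsub>G\<^esub> x = x"
  using hom_one[OF action_hom] by (simp add: Aut.is_group AutoGroup_one_apply)

text \<open>Inversion turns the left action into a right one: \<open>g\<close> is undone before
  \<open>g'\<close>.\<close>

lemma invact_comp:
  assumes "g \<in> carrier G" "g' \<in> carrier G" "x \<in> carrier H"
  shows "(inv\<^bsub>AutoGroup H\<^esub> \<phi> (g \<otimes>\<^bsub>G\<^esub> g')) x = (inv\<^bsub>AutoGroup H\<^esub> \<phi> g') ((inv\<^bsub>AutoGroup H\<^esub> \<phi> g) x)"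
proof -
  have "\<phi> (g \<otimes>\<^bsub>G\<^esub> g') ((inv\<^bsub>AutoGroup H\<^esub> \<phi> g') ((inv\<^bsub>AutoGroup H\<^esub> \<phi> g) x)) = x"
    using assms by (simp add: act_comp)
  then show ?thesis
    using assms by (metis invact_act invact_closed G.m_closed)
qed

end

text \<open>The form of \<open>\<mu>\<close> and \<open>\<sigma>\<close>, which in an extension are
  conjugations of the shape s^-1 x s and therefore reverse products.\<close>

locale automorphic_right_action = G: group G + H: group H for G (structure) and H (structure) +
  fixes \<phi>
  assumes action_anti_hom: "\<phi> \<in> anti_hom G (AutoGroup H)"
begin

sublocale automorphic_family G H \<phi>
  using action_anti_hom by unfold_locales (auto simp: anti_hom_def)

lemma act_comp:
  "g \<in> carrier G \<Longrightarrow> g' \<in> carrier G \<Longrightarrow> x \<in> carrier H \<Longrightarrow> \<phi> (g \<otimes>\<^bsub>G\<^esub> g') x = \<phi> g' (\<phi> g x)"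
  using action_anti_hom by (simp add: anti_hom_def AutoGroup_mult_apply)

lemma act_ident [simp]: "x \<in> carrier H \<Longrightarrow> \<phi> \<one>\<^bsub>G\<^esub> x = x"
proof -
  assume x: "x \<in> carrier H"
  \<comment> \<open>\<open>hom_one\<close> is about homomorphisms and does not cover this case;
    instead, the unit acts by an idempotent map, which is the identity by injectivity.\<close>
  have "\<phi> \<one>\<^bsub>G\<^esub> (\<phi> \<one>\<^bsub>G\<^esub> x) = \<phi> \<one>\<^bsub>G\<^esub> x"
    using act_comp[of "\<one>\<^bsub>G\<^esub>" "\<one>\<^bsub>G\<^esub>" x] x by simp
  then show ?thesis
    using x act_bij[of "\<one>\<^bsub>G\<^esub>"] by (auto simp: bij_betw_def inj_on_def)
qed

end

text \<open>The last assumption makes \<open>H2_RRB\<close> meaningful. It enters the argument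
  twice: through the identity \<open>\<nu>_f_\<sigma>\<close>, which makes \<open>\<phi>\<close>
  compatible with products in \<open>G\<close>, and for knowing that coboundaries are normalized
  cochains.\<close>

locale rrb_module_data =
  fixes A :: "'a monoid" and B :: "'b monoid" and \<beta> :: "'b \<Rightarrow> 'a \<Rightarrow> 'a" and T :: "'a \<Rightarrow> 'b"
    and K :: "'k monoid" and L :: "'l monoid" and \<alpha> :: "'l \<Rightarrow> 'k \<Rightarrow> 'k" and S :: "'k \<Rightarrow> 'l"
    and \<nu> :: "'b \<Rightarrow> 'k \<Rightarrow> 'k" and \<mu> :: "'a \<Rightarrow> 'k \<Rightarrow> 'k" and \<sigma> :: "'b \<Rightarrow> 'l \<Rightarrow> 'l"
    and f :: "'l \<Rightarrow> 'a \<Rightarrow> 'k"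
  assumes rrb: "rrb_group (A, B, \<beta>, T)"
    and triv: "trivial_rrb (K, L, \<alpha>, S)" and comm_K: "comm_group K" and comm_L: "comm_group L"
    and module: "rrb_module (A, B, \<beta>, T) (K, L, \<alpha>, S) (\<nu>, \<mu>, \<sigma>, f)"
    and B2_subset_Z2: "B2_RRB (A, B, \<beta>, T) (K, L, \<alpha>, S) (\<nu>, \<mu>, \<sigma>, f)
                         \<subseteq> Z2_RRB (A, B, \<beta>, T) (K, L, \<alpha>, S) (\<nu>, \<mu>, \<sigma>, f)"
begin

section \<open>Elementary laws of the base and of the module\<close>

sublocale K: comm_group K by (rule comm_K)
sublocale L: comm_group L by (rule comm_L)
sublocale beta: automorphic_action B A \<beta>
  using rrb by (simp add: automorphic_action_def automorphic_action_axioms_def)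
sublocale nu: automorphic_action B K \<nu>
  using module by (simp add: automorphic_action_def automorphic_action_axioms_def K.is_group beta.G.is_group)
sublocale mu: automorphic_right_action A K \<mu>
  using module by (simp add: automorphic_right_action_def automorphic_right_action_axioms_def
      K.is_group beta.H.is_group)
sublocale sigma: automorphic_right_action B L \<sigma>
  using module by (simp add: automorphic_right_action_def automorphic_right_action_axioms_def
      L.is_group beta.G.is_group)

abbreviation \<nu>inv where "\<nu>inv b \<equiv> inv\<^bsub>AutoGroup K\<^esub> \<nu> b"

lemma T_closed [simp]: "a \<in> carrier A \<Longrightarrow> T a \<in> carrier B"
  using rrb by auto

lemma T_circ:
  "a1 \<in> carrier A \<Longrightarrow> a2 \<in> carrier A \<Longrightarrow> T (a1 \<otimes>\<^bsub>A\<^esub> \<beta> (T a1) a2) = T a1 \<otimes>\<^bsub>B\<^esub> T a2"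
  using rrb by auto

lemma T_one [simp]: "T \<one>\<^bsub>A\<^esub> = \<one>\<^bsub>B\<^esub>"
  using T_circ[of "\<one>\<^bsub>A\<^esub>" "\<one>\<^bsub>A\<^esub>"] by (simp add: beta.G.r_cancel_one')

lemma S_closed [simp]: "k \<in> carrier K \<Longrightarrow> S k \<in> carrier L"
  using triv by auto

lemma \<alpha>_ident [simp]: "l \<in> carrier L \<Longrightarrow> k \<in> carrier K \<Longrightarrow> \<alpha> l k = k"
  using triv by (simp add: AutoGroup_one_apply)

text \<open>With \<open>\<alpha>\<close> trivial, the Rota-Baxter identity for \<open>S\<close> is
  multiplicativity.\<close>

lemma S_mult [simp]:
  "k1 \<in> carrier K \<Longrightarrow> k2 \<in> carrier K \<Longrightarrow> S (k1 \<otimes>\<^bsub>K\<^esub> k2) = S k1 \<otimes>\<^bsub>L\<^esub> S k2"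
  using triv by (simp add: AutoGroup_one_apply Pi_iff)

lemma S_one [simp]: "S \<one>\<^bsub>K\<^esub> = \<one>\<^bsub>L\<^esub>"
  using S_mult[of "\<one>\<^bsub>K\<^esub>" "\<one>\<^bsub>K\<^esub>"] by simp

lemma f_closed [simp]: "l \<in> carrier L \<Longrightarrow> a \<in> carrier A \<Longrightarrow> f l a \<in> carrier K"
  using module by (auto simp: Pi_iff)

lemma f_mult_left [simp]:
  "l1 \<in> carrier L \<Longrightarrow> l2 \<in> carrier L \<Longrightarrow> a \<in> carrier A \<Longrightarrow>
    f (l1 \<otimes>\<^bsub>L\<^esub> l2) a = f l1 a \<otimes>\<^bsub>K\<^esub> f l2 a"
  using module by simp

lemma f_mult_right:
  "l \<in> carrier L \<Longrightarrow> a1 \<in> carrier A \<Longrightarrow> a2 \<in> carrier A \<Longrightarrow>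
    f l (a1 \<otimes>\<^bsub>A\<^esub> a2) = \<mu> a2 (f l a1) \<otimes>\<^bsub>K\<^esub> f l a2"
  using module by simp

lemma f_one_left [simp]: "a \<in> carrier A \<Longrightarrow> f \<one>\<^bsub>L\<^esub> a = \<one>\<^bsub>K\<^esub>"
  using f_mult_left[of "\<one>\<^bsub>L\<^esub>" "\<one>\<^bsub>L\<^esub>" a] by simp

lemma f_one_right [simp]: "l \<in> carrier L \<Longrightarrow> f l \<one>\<^bsub>A\<^esub> = \<one>\<^bsub>K\<^esub>"
  using f_mult_right[of l "\<one>\<^bsub>A\<^esub>" "\<one>\<^bsub>A\<^esub>"] by simp

lemma f_inv_left [simp]:
  "l \<in> carrier L \<Longrightarrow> a \<in> carrier A \<Longrightarrow> f (inv\<^bsub>L\<^esub> l) a = inv\<^bsub>K\<^esub> f l a"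
  by (metis f_closed f_mult_left f_one_left L.inv_closed L.l_inv K.inv_equality)

lemma S_compat:
  "a \<in> carrier A \<Longrightarrow> k \<in> carrier K \<Longrightarrow>
    S (\<nu>inv (T a) (\<mu> a k)) \<otimes>\<^bsub>L\<^esub> S (\<nu>inv (T a) (f (S k) a)) = \<sigma> (T a) (S k)"
  using module by simp

lemma \<nu>_\<mu>:
  "a \<in> carrier A \<Longrightarrow> b \<in> carrier B \<Longrightarrow> k \<in> carrier K \<Longrightarrow> \<nu> b (\<mu> a k) = \<mu> (\<beta> b a) (\<nu> b k)"
  using module by simp

end

section \<open>Normalized 2-cocycles\<close>

text \<open>The guards on the unit are there because \<open>X\<close> is an arbitrary record at this
  point; they disappear once \<open>X\<close> is a group.\<close>

lemma cochains1_carrier_iff: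
  "c \<in> carrier (cochains1 X M) \<longleftrightarrow>
     c \<in> extensional (carrier X) \<and> (\<forall>x\<in>carrier X. c x \<in> carrier M) \<and>
     (\<one>\<^bsub>X\<^esub> \<in> carrier X \<longrightarrow> c \<one>\<^bsub>X\<^esub> = \<one>\<^bsub>M\<^esub>)"
  by (auto simp: cochains1_def cochain_group_def PiE_def Pi_iff)

lemma cochains2_carrier_iff:
  "c \<in> carrier (cochains2 X Y M) \<longleftrightarrow>
     c \<in> extensional (carrier X \<times> carrier Y) \<and>
     (\<forall>x\<in>carrier X. \<forall>y\<in>carrier Y. c (x, y) \<in> carrier M) \<and>
     (\<forall>x\<in>carrier X. \<one>\<^bsub>Y\<^esub> \<in> carrier Y \<longrightarrow> c (x, \<one>\<^bsub>Y\<^esub>) = \<one>\<^bsub>M\<^esub>) \<and>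
     (\<forall>y\<in>carrier Y. \<one>\<^bsub>X\<^esub> \<in> carrier X \<longrightarrow> c (\<one>\<^bsub>X\<^esub>, y) = \<one>\<^bsub>M\<^esub>)"
  by (auto simp: cochains2_def cochain_group_def PiE_def Pi_iff)

lemma restrict_eq_restrict_iff: "restrict F X = restrict G X \<longleftrightarrow> (\<forall>x\<in>X. F x = G x)"
  by (auto simp: fun_eq_iff restrict_def)

section \<open>Inverse-free forms of equations in an abelian group\<close>

context comm_group
begin

lemma mult_inv_eq_one_iff:
  "p \<in> carrier G \<Longrightarrow> q \<in> carrier G \<Longrightarrow> p \<otimes> inv q = \<one> \<longleftrightarrow> p = q"
  by (metis inv_closed inv_inv inv_equality l_inv r_inv)

text \<open>The shape of the third component of \<open>partial2_RRB\<close>.\<close>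

lemma mult2_inv2_eq_one_iff:
  assumes "p \<in> carrier G" "q \<in> carrier G" "r \<in> carrier G" "s \<in> carrier G"
  shows "p \<otimes> q \<otimes> inv r \<otimes> inv s = \<one> \<longleftrightarrow> p \<otimes> q = r \<otimes> s"
proof -
  have "p \<otimes> q \<otimes> inv r \<otimes> inv s = (p \<otimes> q) \<otimes> inv (r \<otimes> s)"
    using assms by (simp add: inv_mult m_assoc)
  then show ?thesis
    using assms by (simp add: mult_inv_eq_one_iff)
qed

text \<open>The shape of \<open>partial2\<close>, that is, of the first two components.\<close>

lemma mult_inv_mult_inv_eq_one_iff:
  assumes "p \<in> carrier G" "q \<in> carrier G" "r \<in> carrier G" "s \<in> carrier G"
  shows "p \<otimes> inv r \<otimes> q \<otimes> inv s = \<one> \<longleftrightarrow> p \<otimes> q = r \<otimes> s"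
proof -
  have "p \<otimes> inv r \<otimes> q \<otimes> inv s = p \<otimes> q \<otimes> inv r \<otimes> inv s"
    using assms by (simp add: m_ac)
  then show ?thesis
    using assms by (simp add: mult2_inv2_eq_one_iff)
qed

text \<open>The shape of the fourth component.\<close>

lemma mult2_inv3_eq_one_iff:
  assumes "p \<in> carrier G" "q \<in> carrier G" "r \<in> carrier G" "s \<in> carrier G" "t \<in> carrier G"
  shows "p \<otimes> q \<otimes> inv r \<otimes> inv s \<otimes> inv t = \<one> \<longleftrightarrow> p \<otimes> q = r \<otimes> s \<otimes> t"
proof -
  have "p \<otimes> q \<otimes> inv r \<otimes> inv s \<otimes> inv t = (p \<otimes> q) \<otimes> inv (r \<otimes> s \<otimes> t)"
    using assms by (simp add: inv_mult m_assoc)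
  then show ?thesis
    using assms by (simp add: mult_inv_eq_one_iff)
qed

text \<open>The shape of the fifth component: \<open>x \<otimes> inv y \<otimes> z\<close> is a
  value of \<open>delta1\<close>, whose middle factor therefore ends up uninverted on the
  left.\<close>

lemma mult_inv_inv_eq_one_iff:
  assumes "p \<in> carrier G" "q \<in> carrier G" "x \<in> carrier G" "y \<in> carrier G" "z \<in> carrier G"
  shows "p \<otimes> inv q \<otimes> inv (x \<otimes> inv y \<otimes> z) = \<one> \<longleftrightarrow> p \<otimes> y = q \<otimes> x \<otimes> z"
proof -
  have "p \<otimes> inv q \<otimes> inv (x \<otimes> inv y \<otimes> z) = (p \<otimes> y) \<otimes> inv (q \<otimes> x \<otimes> z)"
    using assms by (simp add: inv_mult m_ac)
  then show ?thesis
    using assms by (simp add: mult_inv_eq_one_iff)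
qed

text \<open>Removes the inverted middle factor of \<open>partial1\<close> when the same value is
  multiplied back.\<close>

lemma mult_cancel_middle:
  assumes "x \<in> carrier G" "y \<in> carrier G" "z \<in> carrier G"
  shows "x \<otimes> (y \<otimes> inv x \<otimes> z) = y \<otimes> z"
proof -
  have "x \<otimes> (y \<otimes> inv x \<otimes> z) = (x \<otimes> inv x) \<otimes> (y \<otimes> z)"
    using assms by (simp only: m_ac m_closed inv_closed)
  then show ?thesis
    using assms by simp
qed

end

section \<open>The cocycle condition in inverse-free form\<close>

context rrb_module_data
begin

lemma C2_carrier_iff:
  "(\<tau>1, \<tau>2, \<rho>, \<chi>) \<in> carrier (C2_RRB (A, B, \<beta>, T) (K, L, \<alpha>, S)) \<longleftrightarrow>
     \<tau>1 \<in> carrier (cochains2 A A K) \<and> \<tau>2 \<in> carrier (cochains2 B B L) \<and>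
     \<rho> \<in> carrier (cochains2 A B K) \<and> \<chi> \<in> carrier (cochains1 A L)"
  by (simp add: DirProd_def)

lemma C1_carrier_iff:
  "(\<theta>1, \<theta>2) \<in> carrier (C1_RRB (A, B, \<beta>, T) (K, L, \<alpha>, S)) \<longleftrightarrow>
     \<theta>1 \<in> carrier (cochains1 A K) \<and> \<theta>2 \<in> carrier (cochains1 B L)"
  by (simp add: DirProd_def)

text \<open>The equations \<open>\<partial>\<^sup>2 = 1\<close> with all inverses moved to the other side.\<close>

definition cocycle_identities where
  "cocycle_identities \<tau>1 \<tau>2 \<rho> \<chi> \<longleftrightarrow>
     (\<forall>a1\<in>carrier A. \<forall>a2\<in>carrier A. \<forall>a3\<in>carrier A.
        \<tau>1 (a2, a3) \<otimes>\<^bsub>K\<^esub> \<tau>1 (a1, a2 \<otimes>\<^bsub>A\<^esub> a3) = \<tau>1 (a1 \<otimes>\<^bsub>A\<^esub> a2, a3) \<otimes>\<^bsub>K\<^esub> \<mu> a3 (\<tau>1 (a1, a2))) \<and>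
     (\<forall>b1\<in>carrier B. \<forall>b2\<in>carrier B. \<forall>b3\<in>carrier B.
        \<tau>2 (b2, b3) \<otimes>\<^bsub>L\<^esub> \<tau>2 (b1, b2 \<otimes>\<^bsub>B\<^esub> b3) = \<tau>2 (b1 \<otimes>\<^bsub>B\<^esub> b2, b3) \<otimes>\<^bsub>L\<^esub> \<sigma> b3 (\<tau>2 (b1, b2))) \<and>
     (\<forall>a\<in>carrier A. \<forall>b1\<in>carrier B. \<forall>b2\<in>carrier B.
        \<rho> (a, b1 \<otimes>\<^bsub>B\<^esub> b2) \<otimes>\<^bsub>K\<^esub> \<nu> (b1 \<otimes>\<^bsub>B\<^esub> b2) (f (\<tau>2 (b1, b2)) a)
          = \<rho> (\<beta> b2 a, b1) \<otimes>\<^bsub>K\<^esub> \<nu> b1 (\<rho> (a, b2))) \<and>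
     (\<forall>a1\<in>carrier A. \<forall>a2\<in>carrier A. \<forall>b\<in>carrier B.
        \<rho> (a1 \<otimes>\<^bsub>A\<^esub> a2, b) \<otimes>\<^bsub>K\<^esub> \<nu> b (\<tau>1 (a1, a2))
          = \<mu> (\<beta> b a2) (\<rho> (a1, b)) \<otimes>\<^bsub>K\<^esub> \<rho> (a2, b) \<otimes>\<^bsub>K\<^esub> \<tau>1 (\<beta> b a1, \<beta> b a2)) \<and>
     (\<forall>a1\<in>carrier A. \<forall>a2\<in>carrier A.
        S (\<nu>inv (T a1 \<otimes>\<^bsub>B\<^esub> T a2)
              (\<rho> (a2, T a1) \<otimes>\<^bsub>K\<^esub> \<tau>1 (a1, \<beta> (T a1) a2) \<otimes>\<^bsub>K\<^esub> \<nu> (T a1) (f (\<chi> a1) a2)))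
            \<otimes>\<^bsub>L\<^esub> \<chi> (a1 \<otimes>\<^bsub>A\<^esub> \<beta> (T a1) a2)
          = \<tau>2 (T a1, T a2) \<otimes>\<^bsub>L\<^esub> \<chi> a2 \<otimes>\<^bsub>L\<^esub> \<sigma> (T a2) (\<chi> a1))"

lemma Z2_iff:
  "(\<tau>1, \<tau>2, \<rho>, \<chi>) \<in> Z2_RRB (A, B, \<beta>, T) (K, L, \<alpha>, S) (\<nu>, \<mu>, \<sigma>, f) \<longleftrightarrow>
     (\<tau>1, \<tau>2, \<rho>, \<chi>) \<in> carrier (C2_RRB (A, B, \<beta>, T) (K, L, \<alpha>, S)) \<and>
     cocycle_identities \<tau>1 \<tau>2 \<rho> \<chi>"
proof -
  have "partial2_RRB (A, B, \<beta>, T) (K, L, \<alpha>, S) (\<nu>, \<mu>, \<sigma>, f) (\<tau>1, \<tau>2, \<rho>, \<chi>)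
          = \<one>\<^bsub>C3_RRB (A, B, \<beta>, T) (K, L, \<alpha>, S)\<^esub> \<longleftrightarrow> cocycle_identities \<tau>1 \<tau>2 \<rho> \<chi>"
    if "(\<tau>1, \<tau>2, \<rho>, \<chi>) \<in> carrier (C2_RRB (A, B, \<beta>, T) (K, L, \<alpha>, S))"
  proof -
    have [simp]:
      "\<And>a a'. a \<in> carrier A \<Longrightarrow> a' \<in> carrier A \<Longrightarrow> \<tau>1 (a, a') \<in> carrier K"
      "\<And>b b'. b \<in> carrier B \<Longrightarrow> b' \<in> carrier B \<Longrightarrow> \<tau>2 (b, b') \<in> carrier L"
      "\<And>a b. a \<in> carrier A \<Longrightarrow> b \<in> carrier B \<Longrightarrow> \<rho> (a, b) \<in> carrier K"
      "\<And>a. a \<in> carrier A \<Longrightarrow> \<chi> a \<in> carrier L"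
      using that
      unfolding C2_carrier_iff cochains1_carrier_iff cochains2_carrier_iff by auto
    show ?thesis
      \<comment> \<open>The simplifier reduces equality with the unit to pointwise equations, which
        the rules then convert according to their shape. \<open>S_mult\<close> and
        \<open>nu.invact_mult\<close> are switched off so that the value of \<open>S\<close> in the
        fifth component stays a single factor.\<close>
      by (simp add: DirProd_def cochains3_def cochains2_def
          cochain_group_def partial2_def restrict_eq_restrict_iff T_circ
          del: S_mult nu.invact_mult)
        (unfold cocycle_identities_def, intro conj_cong ball_cong refl,
         (rule K.mult_inv_mult_inv_eq_one_iff L.mult_inv_mult_inv_eq_one_iff
            K.mult2_inv3_eq_one_iff K.mult2_inv2_eq_one_iff L.mult_inv_inv_eq_one_iff;
          simp del: S_mult nu.invact_mult)+)
  qed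
  then show ?thesis
    unfolding Z2_RRB_def kernel_def by blast
qed

text \<open>The third cocycle identity at \<open>(a, b, b)\<close>, for the coboundary of the cochain that is trivial on
  \<open>A\<close> and constantly \<open>l\<close> on \<open>B - {1}\<close>.\<close>

lemma \<nu>_f_\<sigma>:
  assumes l: "l \<in> carrier L" and a: "a \<in> carrier A" and b: "b \<in> carrier B"
  shows "\<nu> b (f (\<sigma> b l) a) = f l (\<beta> b a)"
\<comment> \<open>Normalization forces the value 1 at the unit of \<open>B\<close>, so the auxiliary
  cochain says nothing about \<open>l\<close> there; the unit, however, acts trivially
  throughout.\<close>
proof (cases "b = \<one>\<^bsub>B\<^esub>")
  case True
  then show ?thesis using l a by simp
next
  case False
  define \<theta>1 where "\<theta>1 = (\<lambda>a\<in>carrier A. \<one>\<^bsub>K\<^esub>)"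
  define \<theta>2 where "\<theta>2 = (\<lambda>b\<in>carrier B. if b = \<one>\<^bsub>B\<^esub> then \<one>\<^bsub>L\<^esub> else l)"
  have "(\<theta>1, \<theta>2) \<in> carrier (C1_RRB (A, B, \<beta>, T) (K, L, \<alpha>, S))"
    using l by (simp add: C1_carrier_iff cochains1_carrier_iff \<theta>1_def \<theta>2_def del: C1_RRB.simps)
  then have "partial1_RRB (A, B, \<beta>, T) (K, L, \<alpha>, S) (\<nu>, \<mu>, \<sigma>, f) (\<theta>1, \<theta>2)
      \<in> Z2_RRB (A, B, \<beta>, T) (K, L, \<alpha>, S) (\<nu>, \<mu>, \<sigma>, f)"
    using B2_subset_Z2 unfolding B2_RRB_def by blast
  then have "cocycle_identities (partial1 A K \<mu> \<theta>1) (partial1 B L \<sigma> \<theta>2)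
       (\<lambda>(a, b) \<in> carrier A \<times> carrier B.
         \<nu> b (f (\<theta>2 b) a \<otimes>\<^bsub>K\<^esub> \<theta>1 a) \<otimes>\<^bsub>K\<^esub> inv\<^bsub>K\<^esub> \<theta>1 (\<beta> b a))
       (\<lambda>a \<in> carrier A. S (\<nu>inv (T a) (\<theta>1 a)) \<otimes>\<^bsub>L\<^esub> inv\<^bsub>L\<^esub> \<theta>2 (T a))"
    unfolding partial1_RRB.simps Z2_iff by blast
  then have "\<nu> (b \<otimes>\<^bsub>B\<^esub> b) (f (\<theta>2 (b \<otimes>\<^bsub>B\<^esub> b)) a) \<otimes>\<^bsub>K\<^esub>
      \<nu> (b \<otimes>\<^bsub>B\<^esub> b) (f (\<theta>2 b \<otimes>\<^bsub>L\<^esub> inv\<^bsub>L\<^esub> \<theta>2 (b \<otimes>\<^bsub>B\<^esub> b) \<otimes>\<^bsub>L\<^esub> \<sigma> b (\<theta>2 b)) a)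
    = \<nu> b (f (\<theta>2 b) (\<beta> b a)) \<otimes>\<^bsub>K\<^esub> \<nu> b (\<nu> b (f (\<theta>2 b) a))" (is "?x = ?y")
  proof -
    have "(\<lambda>(a, b) \<in> carrier A \<times> carrier B.
         \<nu> b (f (\<theta>2 b) a \<otimes>\<^bsub>K\<^esub> \<theta>1 a) \<otimes>\<^bsub>K\<^esub> inv\<^bsub>K\<^esub> \<theta>1 (\<beta> b a)) (a, b \<otimes>\<^bsub>B\<^esub> b) \<otimes>\<^bsub>K\<^esub>
        \<nu> (b \<otimes>\<^bsub>B\<^esub> b) (f (partial1 B L \<sigma> \<theta>2 (b, b)) a)
      = (\<lambda>(a, b) \<in> carrier A \<times> carrier B.
         \<nu> b (f (\<theta>2 b) a \<otimes>\<^bsub>K\<^esub> \<theta>1 a) \<otimes>\<^bsub>K\<^esub> inv\<^bsub>K\<^esub> \<theta>1 (\<beta> b a)) (\<beta> b a, b) \<otimes>\<^bsub>K\<^esub>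
        \<nu> b ((\<lambda>(a, b) \<in> carrier A \<times> carrier B.
         \<nu> b (f (\<theta>2 b) a \<otimes>\<^bsub>K\<^esub> \<theta>1 a) \<otimes>\<^bsub>K\<^esub> inv\<^bsub>K\<^esub> \<theta>1 (\<beta> b a)) (a, b))"
      using \<open>cocycle_identities _ _ _ _\<close> a b unfolding cocycle_identities_def by blast
    then show ?thesis
      using a b l by (simp add: \<theta>1_def \<theta>2_def partial1_def)
  qed
  \<comment> \<open>The value of \<open>\<theta>2\<close> at the square of \<open>b\<close> depends
    on whether that square is the unit, but it occurs once directly and once inverted, so it cancels
    in both cases.\<close>
  moreover have "?x = \<nu> b (\<nu> b (f l a)) \<otimes>\<^bsub>K\<^esub> \<nu> b (\<nu> b (f (\<sigma> b l) a))"
  proof -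
    have "?x = \<nu> (b \<otimes>\<^bsub>B\<^esub> b) (f (\<theta>2 (b \<otimes>\<^bsub>B\<^esub> b)) a \<otimes>\<^bsub>K\<^esub>
        f (\<theta>2 b \<otimes>\<^bsub>L\<^esub> inv\<^bsub>L\<^esub> \<theta>2 (b \<otimes>\<^bsub>B\<^esub> b) \<otimes>\<^bsub>L\<^esub> \<sigma> b (\<theta>2 b)) a)"
      using a b l by (simp add: \<theta>2_def)
    also have "f (\<theta>2 (b \<otimes>\<^bsub>B\<^esub> b)) a \<otimes>\<^bsub>K\<^esub> f (\<theta>2 b \<otimes>\<^bsub>L\<^esub> inv\<^bsub>L\<^esub> \<theta>2 (b \<otimes>\<^bsub>B\<^esub> b) \<otimes>\<^bsub>L\<^esub> \<sigma> b (\<theta>2 b)) a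
      = f (\<theta>2 b) a \<otimes>\<^bsub>K\<^esub> f (\<sigma> b (\<theta>2 b)) a"
      using a b l by (simp add: \<theta>2_def K.mult_cancel_middle)
    finally show ?thesis
      using a b l False by (simp add: nu.act_comp \<theta>2_def)
  qed
  ultimately have "\<nu> b (\<nu> b (f (\<sigma> b l) a)) = \<nu> b (f l (\<beta> b a))"
    using a b l False by (simp add: \<theta>2_def K.m_comm)
  then show ?thesis
    using a b l by (simp add: nu.act_eq_iff)
qed

lemma \<nu>inv_one [simp]: "k \<in> carrier K \<Longrightarrow> \<nu>inv \<one>\<^bsub>B\<^esub> k = k"
  by (metis nu.invact_act nu.act_ident beta.G.one_closed)

end

section \<open>Extensions presented by cochains\<close>

text \<open>The coordinates \<open>u\<close> and \<open>v\<close> are arbitrary bijections, so that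
  one locale covers both a given extension with chosen sections and a model built from a cochain.
  That the data form a relative Rota-Baxter group is left open, since this is to be equivalent to
  the cocycle identities; hence the units, and the extensionality of \<open>\<phi> g\<close> that
  \<open>AutoGroup\<close> requires, are stated separately.\<close>

locale cocycle_presentation = rrb_module_data A B \<beta> T K L \<alpha> S \<nu> \<mu> \<sigma> f
  for A :: "'a monoid" and B :: "'b monoid" and \<beta> T and K :: "'k monoid" and L :: "'l monoid"
    and \<alpha> S \<nu> \<mu> \<sigma> f +
  fixes H :: "'h monoid" and G :: "'g monoid" and \<phi> :: "'g \<Rightarrow> 'h \<Rightarrow> 'h" and R :: "'h \<Rightarrow> 'g"
    and i1 :: "'k \<Rightarrow> 'h" and i2 :: "'l \<Rightarrow> 'g" and \<pi>1 :: "'h \<Rightarrow> 'a" and \<pi>2 :: "'g \<Rightarrow> 'b"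
    and \<tau>1 :: "'a \<times> 'a \<Rightarrow> 'k" and \<tau>2 :: "'b \<times> 'b \<Rightarrow> 'l" and \<rho> :: "'a \<times> 'b \<Rightarrow> 'k" and \<chi> :: "'a \<Rightarrow> 'l"
    and u :: "'a \<Rightarrow> 'k \<Rightarrow> 'h" and v :: "'b \<Rightarrow> 'l \<Rightarrow> 'g"
  assumes cochain: "(\<tau>1, \<tau>2, \<rho>, \<chi>) \<in> carrier (C2_RRB (A, B, \<beta>, T) (K, L, \<alpha>, S))"
    and u_bij: "bij_betw (\<lambda>(a, k). u a k) (carrier A \<times> carrier K) (carrier H)"
    and v_bij: "bij_betw (\<lambda>(b, l). v b l) (carrier B \<times> carrier L) (carrier G)"
    and one_H: "\<one>\<^bsub>H\<^esub> = u \<one>\<^bsub>A\<^esub> \<one>\<^bsub>K\<^esub>"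
    and one_G: "\<one>\<^bsub>G\<^esub> = v \<one>\<^bsub>B\<^esub> \<one>\<^bsub>L\<^esub>"
    and u_mult: "\<lbrakk>a1 \<in> carrier A; a2 \<in> carrier A; k1 \<in> carrier K; k2 \<in> carrier K\<rbrakk> \<Longrightarrow>
          u a1 k1 \<otimes>\<^bsub>H\<^esub> u a2 k2 = u (a1 \<otimes>\<^bsub>A\<^esub> a2) (\<tau>1 (a1, a2) \<otimes>\<^bsub>K\<^esub> \<mu> a2 k1 \<otimes>\<^bsub>K\<^esub> k2)"
    and v_mult: "\<lbrakk>b1 \<in> carrier B; b2 \<in> carrier B; l1 \<in> carrier L; l2 \<in> carrier L\<rbrakk> \<Longrightarrow>
          v b1 l1 \<otimes>\<^bsub>G\<^esub> v b2 l2 = v (b1 \<otimes>\<^bsub>B\<^esub> b2) (\<tau>2 (b1, b2) \<otimes>\<^bsub>L\<^esub> \<sigma> b2 l1 \<otimes>\<^bsub>L\<^esub> l2)"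
    and \<phi>_extensional: "g \<in> carrier G \<Longrightarrow> \<phi> g \<in> extensional (carrier H)"
    and \<phi>_eq: "\<lbrakk>a \<in> carrier A; k \<in> carrier K; b \<in> carrier B; l \<in> carrier L\<rbrakk> \<Longrightarrow>
          \<phi> (v b l) (u a k) = u (\<beta> b a) (\<rho> (a, b) \<otimes>\<^bsub>K\<^esub> \<nu> b (f l a \<otimes>\<^bsub>K\<^esub> k))"
    and R_eq: "\<lbrakk>a \<in> carrier A; k \<in> carrier K\<rbrakk> \<Longrightarrow>
          R (u a k) = v (T a) (\<chi> a \<otimes>\<^bsub>L\<^esub> S (\<nu>inv (T a) k))"
    and i1_eq: "k \<in> carrier K \<Longrightarrow> i1 k = u \<one>\<^bsub>A\<^esub> k"
    and i2_eq: "l \<in> carrier L \<Longrightarrow> i2 l = v \<one>\<^bsub>B\<^esub> l"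
    and \<pi>1_eq: "\<lbrakk>a \<in> carrier A; k \<in> carrier K\<rbrakk> \<Longrightarrow> \<pi>1 (u a k) = a"
    and \<pi>2_eq: "\<lbrakk>b \<in> carrier B; l \<in> carrier L\<rbrakk> \<Longrightarrow> \<pi>2 (v b l) = b"
begin

lemma u_closed [simp]: "a \<in> carrier A \<Longrightarrow> k \<in> carrier K \<Longrightarrow> u a k \<in> carrier H"
  using u_bij by (auto simp: bij_betw_def)

lemma v_closed [simp]: "b \<in> carrier B \<Longrightarrow> l \<in> carrier L \<Longrightarrow> v b l \<in> carrier G"
  using v_bij by (auto simp: bij_betw_def)

lemma u_eq_iff:
  "\<lbrakk>a \<in> carrier A; k \<in> carrier K; a' \<in> carrier A; k' \<in> carrier K\<rbrakk> \<Longrightarrow>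
    u a k = u a' k' \<longleftrightarrow> a = a' \<and> k = k'"
  using u_bij by (auto simp: bij_betw_def dest!: inj_onD[where x = "(a, k)" and y = "(a', k')"])

lemma v_eq_iff:
  "\<lbrakk>b \<in> carrier B; l \<in> carrier L; b' \<in> carrier B; l' \<in> carrier L\<rbrakk> \<Longrightarrow>
    v b l = v b' l' \<longleftrightarrow> b = b' \<and> l = l'"
  using v_bij by (auto simp: bij_betw_def dest!: inj_onD[where x = "(b, l)" and y = "(b', l')"])

lemma u_cases:
  assumes "h \<in> carrier H"
  obtains a k where "a \<in> carrier A" "k \<in> carrier K" "h = u a k"
proof -
  have "h \<in> (\<lambda>(a, k). u a k) ` (carrier A \<times> carrier K)"
    using assms u_bij by (simp add: bij_betw_def)
  then show ?thesis
    using that by auto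
qed

lemma v_cases:
  assumes "g \<in> carrier G"
  obtains b l where "b \<in> carrier B" "l \<in> carrier L" "g = v b l"
proof -
  have "g \<in> (\<lambda>(b, l). v b l) ` (carrier B \<times> carrier L)"
    using assms v_bij by (simp add: bij_betw_def)
  then show ?thesis
    using that by auto
qed

lemma cochain_simps [simp]:
  "\<And>a a'. a \<in> carrier A \<Longrightarrow> a' \<in> carrier A \<Longrightarrow> \<tau>1 (a, a') \<in> carrier K"
  "\<And>a. a \<in> carrier A \<Longrightarrow> \<tau>1 (a, \<one>\<^bsub>A\<^esub>) = \<one>\<^bsub>K\<^esub>"
  "\<And>a. a \<in> carrier A \<Longrightarrow> \<tau>1 (\<one>\<^bsub>A\<^esub>, a) = \<one>\<^bsub>K\<^esub>"
  "\<And>b b'. b \<in> carrier B \<Longrightarrow> b' \<in> carrier B \<Longrightarrow> \<tau>2 (b, b') \<in> carrier L"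
  "\<And>b. b \<in> carrier B \<Longrightarrow> \<tau>2 (b, \<one>\<^bsub>B\<^esub>) = \<one>\<^bsub>L\<^esub>"
  "\<And>b. b \<in> carrier B \<Longrightarrow> \<tau>2 (\<one>\<^bsub>B\<^esub>, b) = \<one>\<^bsub>L\<^esub>"
  "\<And>a b. a \<in> carrier A \<Longrightarrow> b \<in> carrier B \<Longrightarrow> \<rho> (a, b) \<in> carrier K"
  "\<And>a. a \<in> carrier A \<Longrightarrow> \<rho> (a, \<one>\<^bsub>B\<^esub>) = \<one>\<^bsub>K\<^esub>"
  "\<And>b. b \<in> carrier B \<Longrightarrow> \<rho> (\<one>\<^bsub>A\<^esub>, b) = \<one>\<^bsub>K\<^esub>"
  "\<And>a. a \<in> carrier A \<Longrightarrow> \<chi> a \<in> carrier L"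
  "\<chi> \<one>\<^bsub>A\<^esub> = \<one>\<^bsub>L\<^esub>"
  using cochain unfolding C2_carrier_iff cochains1_carrier_iff cochains2_carrier_iff by auto

text \<open>At points with trivial fibre coordinate only cochain values survive. There associativity
  in \<open>H\<close> and in \<open>G\<close>, composition of \<open>\<phi>\<close>,
  multiplicativity of \<open>\<phi> g\<close> and the Rota-Baxter identity give the five identities
  in turn.\<close>

lemma cocycle_identities_if_rrb_group:
  assumes "rrb_group (H, G, \<phi>, R)"
  shows "cocycle_identities \<tau>1 \<tau>2 \<rho> \<chi>"
proof -
  interpret act: automorphic_action G H \<phi>
    using assms by (simp add: automorphic_action_def automorphic_action_axioms_def)
  have 1: "\<tau>1 (a2, a3) \<otimes>\<^bsub>K\<^esub> \<tau>1 (a1, a2 \<otimes>\<^bsub>A\<^esub> a3) = \<tau>1 (a1 \<otimes>\<^bsub>A\<^esub> a2, a3) \<otimes>\<^bsub>K\<^esub> \<mu> a3 (\<tau>1 (a1, a2))"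
    if "a1 \<in> carrier A" "a2 \<in> carrier A" "a3 \<in> carrier A" for a1 a2 a3
    using act.H.m_assoc[of "u a1 \<one>\<^bsub>K\<^esub>" "u a2 \<one>\<^bsub>K\<^esub>" "u a3 \<one>\<^bsub>K\<^esub>"] that
    by (simp add: u_mult u_eq_iff K.m_comm)
  have 2: "\<tau>2 (b2, b3) \<otimes>\<^bsub>L\<^esub> \<tau>2 (b1, b2 \<otimes>\<^bsub>B\<^esub> b3) = \<tau>2 (b1 \<otimes>\<^bsub>B\<^esub> b2, b3) \<otimes>\<^bsub>L\<^esub> \<sigma> b3 (\<tau>2 (b1, b2))"
    if "b1 \<in> carrier B" "b2 \<in> carrier B" "b3 \<in> carrier B" for b1 b2 b3
    using act.G.m_assoc[of "v b1 \<one>\<^bsub>L\<^esub>" "v b2 \<one>\<^bsub>L\<^esub>" "v b3 \<one>\<^bsub>L\<^esub>"] that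
    by (simp add: v_mult v_eq_iff L.m_comm)
  have 3: "\<rho> (a, b1 \<otimes>\<^bsub>B\<^esub> b2) \<otimes>\<^bsub>K\<^esub> \<nu> (b1 \<otimes>\<^bsub>B\<^esub> b2) (f (\<tau>2 (b1, b2)) a)
             = \<rho> (\<beta> b2 a, b1) \<otimes>\<^bsub>K\<^esub> \<nu> b1 (\<rho> (a, b2))"
    if "a \<in> carrier A" "b1 \<in> carrier B" "b2 \<in> carrier B" for a b1 b2
    using act.act_comp[of "v b1 \<one>\<^bsub>L\<^esub>" "v b2 \<one>\<^bsub>L\<^esub>" "u a \<one>\<^bsub>K\<^esub>"] that
    by (simp add: v_mult \<phi>_eq u_eq_iff)
  have 4: "\<rho> (a1 \<otimes>\<^bsub>A\<^esub> a2, b) \<otimes>\<^bsub>K\<^esub> \<nu> b (\<tau>1 (a1, a2))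
             = \<mu> (\<beta> b a2) (\<rho> (a1, b)) \<otimes>\<^bsub>K\<^esub> \<rho> (a2, b) \<otimes>\<^bsub>K\<^esub> \<tau>1 (\<beta> b a1, \<beta> b a2)"
    if "a1 \<in> carrier A" "a2 \<in> carrier A" "b \<in> carrier B" for a1 a2 b
    using act.act_mult[of "v b \<one>\<^bsub>L\<^esub>" "u a1 \<one>\<^bsub>K\<^esub>" "u a2 \<one>\<^bsub>K\<^esub>"] that
    by (simp add: u_mult \<phi>_eq u_eq_iff K.m_ac del: act.act_mult)
  have 5: "S (\<nu>inv (T a1 \<otimes>\<^bsub>B\<^esub> T a2)
              (\<rho> (a2, T a1) \<otimes>\<^bsub>K\<^esub> \<tau>1 (a1, \<beta> (T a1) a2) \<otimes>\<^bsub>K\<^esub> \<nu> (T a1) (f (\<chi> a1) a2)))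
            \<otimes>\<^bsub>L\<^esub> \<chi> (a1 \<otimes>\<^bsub>A\<^esub> \<beta> (T a1) a2)
          = \<tau>2 (T a1, T a2) \<otimes>\<^bsub>L\<^esub> \<chi> a2 \<otimes>\<^bsub>L\<^esub> \<sigma> (T a2) (\<chi> a1)"
    if a: "a1 \<in> carrier A" "a2 \<in> carrier A" for a1 a2
  proof -
    have "R (u a1 \<one>\<^bsub>K\<^esub>) \<otimes>\<^bsub>G\<^esub> R (u a2 \<one>\<^bsub>K\<^esub>) = R (u a1 \<one>\<^bsub>K\<^esub> \<otimes>\<^bsub>H\<^esub> \<phi> (R (u a1 \<one>\<^bsub>K\<^esub>)) (u a2 \<one>\<^bsub>K\<^esub>))"
      using assms a by simp
    then show ?thesis
      using a by (simp add: R_eq \<phi>_eq u_mult v_mult v_eq_iff T_circ K.m_ac L.m_ac)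
  qed
  show ?thesis
    unfolding cocycle_identities_def by (intro conjI ballI 1 2 3 4 5)
qed

text \<open>The same computation in general coordinates. In associativity, the two laws of
  \<open>\<phi>\<close> and the Rota-Baxter identity, the cochain values are matched by one of the
  five identities and the fibre coordinates by the module laws; the units come from
  normalization.\<close>

lemma rrb_group_if_cocycle_identities:
  assumes "cocycle_identities \<tau>1 \<tau>2 \<rho> \<chi>"
  shows "rrb_group (H, G, \<phi>, R)"
proof -
  have H: "group H"
  proof (rule groupI)
    fix x y assume "x \<in> carrier H" "y \<in> carrier H"
    then show "x \<otimes>\<^bsub>H\<^esub> y \<in> carrier H"
      by (auto elim!: u_cases simp: u_mult)
  next
    show "\<one>\<^bsub>H\<^esub> \<in> carrier H" by (simp add: one_H)
  next
    fix x y z assume "x \<in> carrier H" "y \<in> carrier H" "z \<in> carrier H"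
    then obtain a1 k1 a2 k2 a3 k3 where
      ak: "a1 \<in> carrier A" "k1 \<in> carrier K" "a2 \<in> carrier A" "k2 \<in> carrier K"
          "a3 \<in> carrier A" "k3 \<in> carrier K"
      and xyz: "x = u a1 k1" "y = u a2 k2" "z = u a3 k3"
      by (auto elim!: u_cases)
    have "\<tau>1 (a1 \<otimes>\<^bsub>A\<^esub> a2, a3) \<otimes>\<^bsub>K\<^esub> \<mu> a3 (\<tau>1 (a1, a2) \<otimes>\<^bsub>K\<^esub> \<mu> a2 k1 \<otimes>\<^bsub>K\<^esub> k2) \<otimes>\<^bsub>K\<^esub> k3
      = (\<tau>1 (a1 \<otimes>\<^bsub>A\<^esub> a2, a3) \<otimes>\<^bsub>K\<^esub> \<mu> a3 (\<tau>1 (a1, a2))) \<otimes>\<^bsub>K\<^esub> (\<mu> a3 (\<mu> a2 k1) \<otimes>\<^bsub>K\<^esub> \<mu> a3 k2 \<otimes>\<^bsub>K\<^esub> k3)"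
      using ak by (simp add: K.m_assoc)
    also have "\<tau>1 (a1 \<otimes>\<^bsub>A\<^esub> a2, a3) \<otimes>\<^bsub>K\<^esub> \<mu> a3 (\<tau>1 (a1, a2)) = \<tau>1 (a2, a3) \<otimes>\<^bsub>K\<^esub> \<tau>1 (a1, a2 \<otimes>\<^bsub>A\<^esub> a3)"
      using assms ak unfolding cocycle_identities_def by simp
    also have "\<dots> \<otimes>\<^bsub>K\<^esub> (\<mu> a3 (\<mu> a2 k1) \<otimes>\<^bsub>K\<^esub> \<mu> a3 k2 \<otimes>\<^bsub>K\<^esub> k3)
      = \<tau>1 (a1, a2 \<otimes>\<^bsub>A\<^esub> a3) \<otimes>\<^bsub>K\<^esub> \<mu> (a2 \<otimes>\<^bsub>A\<^esub> a3) k1 \<otimes>\<^bsub>K\<^esub> (\<tau>1 (a2, a3) \<otimes>\<^bsub>K\<^esub> \<mu> a3 k2 \<otimes>\<^bsub>K\<^esub> k3)"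
      using ak by (simp add: mu.act_comp K.m_ac)
    finally show "x \<otimes>\<^bsub>H\<^esub> y \<otimes>\<^bsub>H\<^esub> z = x \<otimes>\<^bsub>H\<^esub> (y \<otimes>\<^bsub>H\<^esub> z)"
      using ak by (simp add: xyz u_mult beta.H.m_assoc)
  next
    fix x assume "x \<in> carrier H"
    then show "\<one>\<^bsub>H\<^esub> \<otimes>\<^bsub>H\<^esub> x = x"
      by (auto elim!: u_cases simp: one_H u_mult)
  next
    fix x assume "x \<in> carrier H"
    then obtain a k where ak: "a \<in> carrier A" "k \<in> carrier K" "x = u a k"
      by (rule u_cases)
    \<comment> \<open>The fibre coordinate of a left inverse must make
      \<open>\<tau>1 (inv a, a) \<otimes> \<mu> a k' \<otimes> k\<close> trivial; this can be solved
      for \<open>k'\<close> because \<open>\<mu> a\<close> is onto.\<close>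
    then obtain k' where "k' \<in> carrier K" "\<mu> a k' = inv\<^bsub>K\<^esub> (\<tau>1 (inv\<^bsub>A\<^esub> a, a) \<otimes>\<^bsub>K\<^esub> k)"
      using mu.act_bij[of a] unfolding bij_betw_def
      by (metis K.inv_closed K.m_closed beta.H.inv_closed cochain_simps(1) imageE)
    then have "u (inv\<^bsub>A\<^esub> a) k' \<otimes>\<^bsub>H\<^esub> x = \<one>\<^bsub>H\<^esub>"
      using ak by (simp add: u_mult one_H K.mult_cancel_middle K.m_ac K.inv_mult)
    then show "\<exists>y\<in>carrier H. y \<otimes>\<^bsub>H\<^esub> x = \<one>\<^bsub>H\<^esub>"
      using \<open>k' \<in> carrier K\<close> ak by (meson beta.H.inv_closed u_closed)
  qed
  have G: "group G"
  proof (rule groupI)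
    fix x y assume "x \<in> carrier G" "y \<in> carrier G"
    then show "x \<otimes>\<^bsub>G\<^esub> y \<in> carrier G"
      by (auto elim!: v_cases simp: v_mult)
  next
    show "\<one>\<^bsub>G\<^esub> \<in> carrier G" by (simp add: one_G)
  next
    fix x y z assume "x \<in> carrier G" "y \<in> carrier G" "z \<in> carrier G"
    then obtain b1 l1 b2 l2 b3 l3 where
      bl: "b1 \<in> carrier B" "l1 \<in> carrier L" "b2 \<in> carrier B" "l2 \<in> carrier L"
          "b3 \<in> carrier B" "l3 \<in> carrier L"
      and xyz: "x = v b1 l1" "y = v b2 l2" "z = v b3 l3"
      by (auto elim!: v_cases)
    have "\<tau>2 (b1 \<otimes>\<^bsub>B\<^esub> b2, b3) \<otimes>\<^bsub>L\<^esub> \<sigma> b3 (\<tau>2 (b1, b2) \<otimes>\<^bsub>L\<^esub> \<sigma> b2 l1 \<otimes>\<^bsub>L\<^esub> l2) \<otimes>\<^bsub>L\<^esub> l3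
      = (\<tau>2 (b1 \<otimes>\<^bsub>B\<^esub> b2, b3) \<otimes>\<^bsub>L\<^esub> \<sigma> b3 (\<tau>2 (b1, b2))) \<otimes>\<^bsub>L\<^esub> (\<sigma> b3 (\<sigma> b2 l1) \<otimes>\<^bsub>L\<^esub> \<sigma> b3 l2 \<otimes>\<^bsub>L\<^esub> l3)"
      using bl by (simp add: L.m_assoc)
    also have "\<tau>2 (b1 \<otimes>\<^bsub>B\<^esub> b2, b3) \<otimes>\<^bsub>L\<^esub> \<sigma> b3 (\<tau>2 (b1, b2)) = \<tau>2 (b2, b3) \<otimes>\<^bsub>L\<^esub> \<tau>2 (b1, b2 \<otimes>\<^bsub>B\<^esub> b3)"
      using assms bl unfolding cocycle_identities_def by simp
    also have "\<dots> \<otimes>\<^bsub>L\<^esub> (\<sigma> b3 (\<sigma> b2 l1) \<otimes>\<^bsub>L\<^esub> \<sigma> b3 l2 \<otimes>\<^bsub>L\<^esub> l3)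
      = \<tau>2 (b1, b2 \<otimes>\<^bsub>B\<^esub> b3) \<otimes>\<^bsub>L\<^esub> \<sigma> (b2 \<otimes>\<^bsub>B\<^esub> b3) l1 \<otimes>\<^bsub>L\<^esub> (\<tau>2 (b2, b3) \<otimes>\<^bsub>L\<^esub> \<sigma> b3 l2 \<otimes>\<^bsub>L\<^esub> l3)"
      using bl by (simp add: sigma.act_comp L.m_ac)
    finally show "x \<otimes>\<^bsub>G\<^esub> y \<otimes>\<^bsub>G\<^esub> z = x \<otimes>\<^bsub>G\<^esub> (y \<otimes>\<^bsub>G\<^esub> z)"
      using bl by (simp add: xyz v_mult beta.G.m_assoc)
  next
    fix x assume "x \<in> carrier G"
    then show "\<one>\<^bsub>G\<^esub> \<otimes>\<^bsub>G\<^esub> x = x"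
      by (auto elim!: v_cases simp: one_G v_mult)
  next
    fix x assume "x \<in> carrier G"
    then obtain b l where bl: "b \<in> carrier B" "l \<in> carrier L" "x = v b l"
      by (rule v_cases)
    then obtain l' where "l' \<in> carrier L" "\<sigma> b l' = inv\<^bsub>L\<^esub> (\<tau>2 (inv\<^bsub>B\<^esub> b, b) \<otimes>\<^bsub>L\<^esub> l)"
      using sigma.act_bij[of b] unfolding bij_betw_def
      by (metis L.inv_closed L.m_closed beta.G.inv_closed cochain_simps(4) imageE)
    then have "v (inv\<^bsub>B\<^esub> b) l' \<otimes>\<^bsub>G\<^esub> x = \<one>\<^bsub>G\<^esub>"
      using bl by (simp add: v_mult one_G L.mult_cancel_middle L.m_ac L.inv_mult)
    then show "\<exists>y\<in>carrier G. y \<otimes>\<^bsub>G\<^esub> x = \<one>\<^bsub>G\<^esub>"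
      using \<open>l' \<in> carrier L\<close> bl by (meson beta.G.inv_closed v_closed)
  qed
  have \<phi>_mult: "\<phi> g (x \<otimes>\<^bsub>H\<^esub> y) = \<phi> g x \<otimes>\<^bsub>H\<^esub> \<phi> g y"
    if gxy: "g \<in> carrier G" "x \<in> carrier H" "y \<in> carrier H" for g x y
  proof -
    from gxy obtain b l a1 k1 a2 k2 where
      ak: "a1 \<in> carrier A" "k1 \<in> carrier K" "a2 \<in> carrier A" "k2 \<in> carrier K"
          "b \<in> carrier B" "l \<in> carrier L"
      and eqs: "x = u a1 k1" "y = u a2 k2" "g = v b l"
      by (auto elim!: u_cases v_cases)
    have "\<rho> (a1 \<otimes>\<^bsub>A\<^esub> a2, b) \<otimes>\<^bsub>K\<^esub> \<nu> b (f l (a1 \<otimes>\<^bsub>A\<^esub> a2) \<otimes>\<^bsub>K\<^esub> (\<tau>1 (a1, a2) \<otimes>\<^bsub>K\<^esub> \<mu> a2 k1 \<otimes>\<^bsub>K\<^esub> k2))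
      = (\<rho> (a1 \<otimes>\<^bsub>A\<^esub> a2, b) \<otimes>\<^bsub>K\<^esub> \<nu> b (\<tau>1 (a1, a2))) \<otimes>\<^bsub>K\<^esub>
          \<nu> b (\<mu> a2 (f l a1) \<otimes>\<^bsub>K\<^esub> f l a2 \<otimes>\<^bsub>K\<^esub> \<mu> a2 k1 \<otimes>\<^bsub>K\<^esub> k2)"
      using ak by (simp add: f_mult_right K.m_ac)
    also have "\<rho> (a1 \<otimes>\<^bsub>A\<^esub> a2, b) \<otimes>\<^bsub>K\<^esub> \<nu> b (\<tau>1 (a1, a2))
        = \<mu> (\<beta> b a2) (\<rho> (a1, b)) \<otimes>\<^bsub>K\<^esub> \<rho> (a2, b) \<otimes>\<^bsub>K\<^esub> \<tau>1 (\<beta> b a1, \<beta> b a2)"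
      using assms ak unfolding cocycle_identities_def by simp
    \<comment> \<open>\<open>\<nu>_\<mu>\<close> carries \<open>\<nu> b\<close> across
      \<open>\<mu> a2\<close>, producing the twisted index \<open>\<beta> b a2\<close>.\<close>
    also have "\<dots> \<otimes>\<^bsub>K\<^esub> \<nu> b (\<mu> a2 (f l a1) \<otimes>\<^bsub>K\<^esub> f l a2 \<otimes>\<^bsub>K\<^esub> \<mu> a2 k1 \<otimes>\<^bsub>K\<^esub> k2)
      = \<tau>1 (\<beta> b a1, \<beta> b a2) \<otimes>\<^bsub>K\<^esub> \<mu> (\<beta> b a2) (\<rho> (a1, b) \<otimes>\<^bsub>K\<^esub> \<nu> b (f l a1 \<otimes>\<^bsub>K\<^esub> k1)) \<otimes>\<^bsub>K\<^esub>
          (\<rho> (a2, b) \<otimes>\<^bsub>K\<^esub> \<nu> b (f l a2 \<otimes>\<^bsub>K\<^esub> k2))"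
      using ak by (simp add: \<nu>_\<mu> K.m_ac)
    finally show ?thesis
      using ak by (simp add: eqs u_mult \<phi>_eq)
  qed
  have \<phi>_comp: "\<phi> (g \<otimes>\<^bsub>G\<^esub> g') x = \<phi> g (\<phi> g' x)"
    if gx: "g \<in> carrier G" "g' \<in> carrier G" "x \<in> carrier H" for g g' x
  proof -
    from gx obtain b1 l1 b2 l2 a k where
      ak: "a \<in> carrier A" "k \<in> carrier K" "b1 \<in> carrier B" "l1 \<in> carrier L"
          "b2 \<in> carrier B" "l2 \<in> carrier L"
      and eqs: "x = u a k" "g = v b1 l1" "g' = v b2 l2"
      by (auto elim!: u_cases v_cases)
    have "\<rho> (a, b1 \<otimes>\<^bsub>B\<^esub> b2) \<otimes>\<^bsub>K\<^esub> \<nu> (b1 \<otimes>\<^bsub>B\<^esub> b2) (f (\<tau>2 (b1, b2) \<otimes>\<^bsub>L\<^esub> \<sigma> b2 l1 \<otimes>\<^bsub>L\<^esub> l2) a \<otimes>\<^bsub>K\<^esub> k)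
      = (\<rho> (a, b1 \<otimes>\<^bsub>B\<^esub> b2) \<otimes>\<^bsub>K\<^esub> \<nu> (b1 \<otimes>\<^bsub>B\<^esub> b2) (f (\<tau>2 (b1, b2)) a)) \<otimes>\<^bsub>K\<^esub>
          \<nu> (b1 \<otimes>\<^bsub>B\<^esub> b2) (f (\<sigma> b2 l1) a \<otimes>\<^bsub>K\<^esub> f l2 a \<otimes>\<^bsub>K\<^esub> k)"
      using ak by (simp add: K.m_assoc)
    also have "\<rho> (a, b1 \<otimes>\<^bsub>B\<^esub> b2) \<otimes>\<^bsub>K\<^esub> \<nu> (b1 \<otimes>\<^bsub>B\<^esub> b2) (f (\<tau>2 (b1, b2)) a)
        = \<rho> (\<beta> b2 a, b1) \<otimes>\<^bsub>K\<^esub> \<nu> b1 (\<rho> (a, b2))"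
      using assms ak unfolding cocycle_identities_def by simp
    \<comment> \<open>\<open>\<nu>_f_\<sigma>\<close>, which rests on coboundaries being cocycles,
      replaces \<open>\<nu> b2 (f (\<sigma> b2 l1) a)\<close> by \<open>f l1 (\<beta> b2 a)\<close>.
      This accounts for moving \<open>l1\<close> past \<open>b2\<close>.\<close>
    also have "\<dots> \<otimes>\<^bsub>K\<^esub> \<nu> (b1 \<otimes>\<^bsub>B\<^esub> b2) (f (\<sigma> b2 l1) a \<otimes>\<^bsub>K\<^esub> f l2 a \<otimes>\<^bsub>K\<^esub> k)
      = \<rho> (\<beta> b2 a, b1) \<otimes>\<^bsub>K\<^esub> \<nu> b1 (f l1 (\<beta> b2 a) \<otimes>\<^bsub>K\<^esub> (\<rho> (a, b2) \<otimes>\<^bsub>K\<^esub> \<nu> b2 (f l2 a \<otimes>\<^bsub>K\<^esub> k)))"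
      using ak by (simp add: nu.act_comp \<nu>_f_\<sigma> K.m_ac)
    finally show ?thesis
      using ak by (simp add: eqs v_mult \<phi>_eq beta.act_comp)
  qed
  have \<phi>_closed: "\<phi> g x \<in> carrier H" if "g \<in> carrier G" "x \<in> carrier H" for g x
    using that by (auto elim!: u_cases v_cases simp: \<phi>_eq)
  have \<phi>_ident: "\<phi> \<one>\<^bsub>G\<^esub> x = x" if "x \<in> carrier H" for x
    using that by (auto elim!: u_cases simp: one_G \<phi>_eq)
  have \<phi>_Aut: "\<phi> g \<in> carrier (AutoGroup H)" if g: "g \<in> carrier G" for g
    unfolding AutoGroup_carrier_iff
  proof (intro conjI \<phi>_extensional g bij_betwI)
    show "\<phi> g \<in> hom H H"
      using g by (simp add: hom_def \<phi>_mult \<phi>_closed)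
    show "\<phi> g \<in> carrier H \<rightarrow> carrier H" "\<phi> (inv\<^bsub>G\<^esub> g) \<in> carrier H \<rightarrow> carrier H"
      using g by (simp_all add: \<phi>_closed group.inv_closed[OF G])
    show "\<phi> (inv\<^bsub>G\<^esub> g) (\<phi> g x) = x" if "x \<in> carrier H" for x
      using g that by (simp flip: \<phi>_comp add: group.inv_closed[OF G] group.l_inv[OF G] \<phi>_ident)
    show "\<phi> g (\<phi> (inv\<^bsub>G\<^esub> g) x) = x" if "x \<in> carrier H" for x
      using g that by (simp flip: \<phi>_comp add: group.inv_closed[OF G] group.r_inv[OF G] \<phi>_ident)
  qed
  have "\<phi> (g \<otimes>\<^bsub>G\<^esub> g') = \<phi> g \<otimes>\<^bsub>AutoGroup H\<^esub> \<phi> g'" if g: "g \<in> carrier G" "g' \<in> carrier G" for g g'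
  proof (rule extensionalityI[of _ "carrier H"])
    have "g \<otimes>\<^bsub>G\<^esub> g' \<in> carrier G"
      using g G by (simp add: group.is_monoid monoid.m_closed)
    then show "\<phi> (g \<otimes>\<^bsub>G\<^esub> g') \<in> extensional (carrier H)"
      by (rule \<phi>_extensional)
    show "\<phi> g \<otimes>\<^bsub>AutoGroup H\<^esub> \<phi> g' \<in> extensional (carrier H)"
      using group.AutoGroup[OF H] g \<phi>_Aut AutoGroup_carrier_iff
      by (metis group.is_monoid monoid.m_closed)
    show "\<phi> (g \<otimes>\<^bsub>G\<^esub> g') x = (\<phi> g \<otimes>\<^bsub>AutoGroup H\<^esub> \<phi> g') x" if "x \<in> carrier H" for x
      using g that by (simp add: AutoGroup_mult_apply \<phi>_Aut \<phi>_comp)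
  qed
  then have \<phi>_hom: "\<phi> \<in> hom G (AutoGroup H)"
    by (simp add: hom_def \<phi>_Aut)
  have "R x \<otimes>\<^bsub>G\<^esub> R y = R (x \<otimes>\<^bsub>H\<^esub> \<phi> (R x) y)" if xy: "x \<in> carrier H" "y \<in> carrier H" for x y
  proof -
    from xy obtain a1 k1 a2 k2 where
      ak: "a1 \<in> carrier A" "k1 \<in> carrier K" "a2 \<in> carrier A" "k2 \<in> carrier K"
      and eqs: "x = u a1 k1" "y = u a2 k2"
      by (auto elim!: u_cases)
    \<comment> \<open>With \<open>k1 = \<nu> (T a1) k\<close>, the value \<open>R (u a1 k1)\<close>
      has fibre coordinate \<open>\<chi> a1 \<otimes> S k\<close>, and \<open>\<nu> (T a1)\<close>
      can be pulled out of all terms that contain a fibre coordinate.\<close>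
    define k where "k = \<nu>inv (T a1) k1"
    have k: "k \<in> carrier K" "k1 = \<nu> (T a1) k"
      using ak by (simp_all add: k_def)
    let ?a = "a1 \<otimes>\<^bsub>A\<^esub> \<beta> (T a1) a2"
    let ?c = "\<rho> (a2, T a1) \<otimes>\<^bsub>K\<^esub> \<tau>1 (a1, \<beta> (T a1) a2) \<otimes>\<^bsub>K\<^esub> \<nu> (T a1) (f (\<chi> a1) a2)"
    have "\<chi> ?a \<otimes>\<^bsub>L\<^esub> S (\<nu>inv (T a1 \<otimes>\<^bsub>B\<^esub> T a2)
            (\<tau>1 (a1, \<beta> (T a1) a2) \<otimes>\<^bsub>K\<^esub> \<mu> (\<beta> (T a1) a2) k1 \<otimes>\<^bsub>K\<^esub>
              (\<rho> (a2, T a1) \<otimes>\<^bsub>K\<^esub> \<nu> (T a1) (f (\<chi> a1 \<otimes>\<^bsub>L\<^esub> S k) a2 \<otimes>\<^bsub>K\<^esub> k2))))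
      = \<chi> ?a \<otimes>\<^bsub>L\<^esub> S (\<nu>inv (T a1 \<otimes>\<^bsub>B\<^esub> T a2) (?c \<otimes>\<^bsub>K\<^esub> \<nu> (T a1) (\<mu> a2 k \<otimes>\<^bsub>K\<^esub> f (S k) a2 \<otimes>\<^bsub>K\<^esub> k2)))"
      using ak k by (simp add: \<nu>_\<mu> K.m_ac)
    also have "\<dots> = (S (\<nu>inv (T a1 \<otimes>\<^bsub>B\<^esub> T a2) ?c) \<otimes>\<^bsub>L\<^esub> \<chi> ?a) \<otimes>\<^bsub>L\<^esub>
        (S (\<nu>inv (T a2) (\<mu> a2 k)) \<otimes>\<^bsub>L\<^esub> S (\<nu>inv (T a2) (f (S k) a2))) \<otimes>\<^bsub>L\<^esub> S (\<nu>inv (T a2) k2)"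
    proof -
      have "S (\<nu>inv (T a1 \<otimes>\<^bsub>B\<^esub> T a2) (?c \<otimes>\<^bsub>K\<^esub> \<nu> (T a1) (\<mu> a2 k \<otimes>\<^bsub>K\<^esub> f (S k) a2 \<otimes>\<^bsub>K\<^esub> k2)))
        = S (\<nu>inv (T a1 \<otimes>\<^bsub>B\<^esub> T a2) ?c) \<otimes>\<^bsub>L\<^esub>
            S (\<nu>inv (T a1 \<otimes>\<^bsub>B\<^esub> T a2) (\<nu> (T a1) (\<mu> a2 k \<otimes>\<^bsub>K\<^esub> f (S k) a2 \<otimes>\<^bsub>K\<^esub> k2)))"
        using ak k by (simp add: L.m_assoc)
      also have "\<nu>inv (T a1 \<otimes>\<^bsub>B\<^esub> T a2) (\<nu> (T a1) (\<mu> a2 k \<otimes>\<^bsub>K\<^esub> f (S k) a2 \<otimes>\<^bsub>K\<^esub> k2))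
        = \<nu>inv (T a2) (\<mu> a2 k \<otimes>\<^bsub>K\<^esub> f (S k) a2 \<otimes>\<^bsub>K\<^esub> k2)"
        using ak k by (simp only: nu.invact_comp nu.invact_act T_closed nu.act_closed mu.act_closed
            f_closed S_closed K.m_closed)
      finally show ?thesis
        using ak k by (simp del: nu.act_mult add: L.m_ac)
    qed
    also have "S (\<nu>inv (T a1 \<otimes>\<^bsub>B\<^esub> T a2) ?c) \<otimes>\<^bsub>L\<^esub> \<chi> ?a = \<tau>2 (T a1, T a2) \<otimes>\<^bsub>L\<^esub> \<chi> a2 \<otimes>\<^bsub>L\<^esub> \<sigma> (T a2) (\<chi> a1)"
      using assms ak unfolding cocycle_identities_def by blast
    \<comment> \<open>The module condition on \<open>S\<close>: conjugating \<open>k\<close> by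
      \<open>a2\<close> and letting \<open>S k\<close> act on \<open>a2\<close> together amount to
      \<open>\<sigma>\<close> applied to \<open>S k\<close>.\<close>
    also have "S (\<nu>inv (T a2) (\<mu> a2 k)) \<otimes>\<^bsub>L\<^esub> S (\<nu>inv (T a2) (f (S k) a2)) = \<sigma> (T a2) (S k)"
      using ak k by (simp add: S_compat)
    also have "\<tau>2 (T a1, T a2) \<otimes>\<^bsub>L\<^esub> \<chi> a2 \<otimes>\<^bsub>L\<^esub> \<sigma> (T a2) (\<chi> a1) \<otimes>\<^bsub>L\<^esub> \<sigma> (T a2) (S k) \<otimes>\<^bsub>L\<^esub> S (\<nu>inv (T a2) k2)
      = \<tau>2 (T a1, T a2) \<otimes>\<^bsub>L\<^esub> \<sigma> (T a2) (\<chi> a1 \<otimes>\<^bsub>L\<^esub> S k) \<otimes>\<^bsub>L\<^esub> (\<chi> a2 \<otimes>\<^bsub>L\<^esub> S (\<nu>inv (T a2) k2))"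
      using ak k by (simp add: L.m_ac)
    \<comment> \<open>The distributive rules stay off so that both coordinates appear exactly as the
      two ends of the calculation above.\<close>
    finally show ?thesis
      using ak k by (simp add: eqs R_eq \<phi>_eq u_mult v_mult T_circ flip: k_def
          del: nu.act_mult nu.invact_mult S_mult mu.act_mult sigma.act_mult f_mult_left)
  qed
  moreover have "R \<in> carrier H \<rightarrow> carrier G"
    by (auto elim!: u_cases simp: R_eq)
  ultimately show ?thesis
    using H G \<phi>_hom by simp
qed

text \<open>The points with trivial fibre coordinate form normalized sections, and the formulas of
  the associated action, multiplied through by the section values, are instances of the coordinate
  formulas.\<close>

lemma in_extensions_with_action:
  assumes rrb_H: "rrb_group (H, G, \<phi>, R)"
  shows "((H, G, \<phi>, R), i1, i2, \<pi>1, \<pi>2)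
           \<in> extensions_with_action (A, B, \<beta>, T) (K, L, \<alpha>, S) (\<nu>, \<mu>, \<sigma>, f)"
proof -
  have H: "group H" and G: "group G"
    using rrb_H by auto
  have \<pi>1_hom: "\<pi>1 \<in> hom H A"
    by (auto simp: hom_def u_mult \<pi>1_eq elim!: u_cases)
  have \<pi>2_hom: "\<pi>2 \<in> hom G B"
    by (auto simp: hom_def v_mult \<pi>2_eq elim!: v_cases)
  have emb: "rrb_embedding (K, L, \<alpha>, S) (H, G, \<phi>, R) i1 i2"
    by (auto simp: hom_def inj_on_def i1_eq i2_eq u_mult v_mult u_eq_iff v_eq_iff R_eq \<phi>_eq)
  have epi1: "\<pi>1 ` carrier H = carrier A"
  proof
    show "carrier A \<subseteq> \<pi>1 ` carrier H"
      by (metis K.one_closed \<pi>1_eq image_eqI subsetI u_closed)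
  qed (use \<pi>1_hom in \<open>auto simp: hom_def\<close>)
  have epi2: "\<pi>2 ` carrier G = carrier B"
  proof
    show "carrier B \<subseteq> \<pi>2 ` carrier G"
      by (metis L.one_closed \<pi>2_eq image_eqI subsetI v_closed)
  qed (use \<pi>2_hom in \<open>auto simp: hom_def\<close>)
  have epi: "rrb_epimorphism (H, G, \<phi>, R) (A, B, \<beta>, T) \<pi>1 \<pi>2"
    using \<pi>1_hom \<pi>2_hom epi1 epi2
    by (auto simp: R_eq \<phi>_eq \<pi>1_eq \<pi>2_eq elim!: u_cases v_cases)
  have ker1: "i1 ` carrier K = kernel H A \<pi>1"
    by (auto simp: kernel_def i1_eq \<pi>1_eq elim!: u_cases)
  have ker2: "i2 ` carrier L = kernel G B \<pi>2"
    by (auto simp: kernel_def i2_eq \<pi>2_eq elim!: v_cases)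
  \<comment> \<open>There is no coordinate formula for inverses, so the inverse of the section value
    is moved to the other side.\<close>
  have move_left: "x = inv\<^bsub>M\<^esub> s \<otimes>\<^bsub>M\<^esub> y"
    if "group M" "s \<in> carrier M" "x \<in> carrier M" "y \<in> carrier M" "s \<otimes>\<^bsub>M\<^esub> x = y"
    for M :: "('m, 'n) monoid_scheme" and x s y
    using that by (metis group.inv_solve_left)
  have "has_associated_action (A, B, \<beta>, T) (K, L, \<alpha>, S) ((H, G, \<phi>, R), i1, i2, \<pi>1, \<pi>2) (\<nu>, \<mu>, \<sigma>, f)"
    unfolding has_associated_action.simps
  proof (intro exI conjI ballI)
    show "normalized_section H A \<pi>1 (\<lambda>a. u a \<one>\<^bsub>K\<^esub>)" "normalized_section G B \<pi>2 (\<lambda>b. v b \<one>\<^bsub>L\<^esub>)"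
      by (simp_all add: normalized_section_def \<pi>1_eq \<pi>2_eq one_H one_G)
    show "i1 (\<nu> b k) = \<phi> (v b \<one>\<^bsub>L\<^esub>) (i1 k)" if "b \<in> carrier B" "k \<in> carrier K" for b k
      using that by (simp add: i1_eq \<phi>_eq)
    show "i1 (\<mu> a k) = inv\<^bsub>H\<^esub> u a \<one>\<^bsub>K\<^esub> \<otimes>\<^bsub>H\<^esub> i1 k \<otimes>\<^bsub>H\<^esub> u a \<one>\<^bsub>K\<^esub>"
      if "a \<in> carrier A" "k \<in> carrier K" for a k
      using that move_left[OF H, of "u a \<one>\<^bsub>K\<^esub>" "i1 (\<mu> a k)" "i1 k \<otimes>\<^bsub>H\<^esub> u a \<one>\<^bsub>K\<^esub>"]
      by (simp add: i1_eq u_mult H group.inv_closed monoid.m_assoc group.is_monoid)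
    show "i2 (\<sigma> b l) = inv\<^bsub>G\<^esub> v b \<one>\<^bsub>L\<^esub> \<otimes>\<^bsub>G\<^esub> i2 l \<otimes>\<^bsub>G\<^esub> v b \<one>\<^bsub>L\<^esub>"
      if "b \<in> carrier B" "l \<in> carrier L" for b l
      using that move_left[OF G, of "v b \<one>\<^bsub>L\<^esub>" "i2 (\<sigma> b l)" "i2 l \<otimes>\<^bsub>G\<^esub> v b \<one>\<^bsub>L\<^esub>"]
      by (simp add: i2_eq v_mult G group.inv_closed monoid.m_assoc group.is_monoid)
    show "i1 (f l a) = inv\<^bsub>H\<^esub> u a \<one>\<^bsub>K\<^esub> \<otimes>\<^bsub>H\<^esub> \<phi> (i2 l) (u a \<one>\<^bsub>K\<^esub>)"
      if "l \<in> carrier L" "a \<in> carrier A" for l a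
      by (rule move_left[OF H]) (use that in \<open>simp_all add: i1_eq i2_eq u_mult \<phi>_eq\<close>)
  qed
  then show ?thesis
    using rrb_H emb epi ker1 ker2 unfolding extensions_with_action_def by simp
qed

text \<open>Matching points with equal coordinates respects all structure, because every structure
  map is expressed through the cochain and the fixed data alone.\<close>

lemma equivalent_if_same_cocycle:
  assumes "cocycle_presentation A B \<beta> T K L \<alpha> S \<nu> \<mu> \<sigma> f H' G' \<phi>' R' i1' i2' \<pi>1' \<pi>2' \<tau>1 \<tau>2 \<rho> \<chi> u' v'"
  shows "ext_equivalent (A, B, \<beta>, T) (K, L, \<alpha>, S)
           ((H, G, \<phi>, R), i1, i2, \<pi>1, \<pi>2) ((H', G', \<phi>', R'), i1', i2', \<pi>1', \<pi>2')"
proof -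
  interpret E': cocycle_presentation A B \<beta> T K L \<alpha> S \<nu> \<mu> \<sigma> f H' G' \<phi>' R' i1' i2' \<pi>1' \<pi>2' \<tau>1 \<tau>2 \<rho> \<chi> u' v'
    by (rule assms)
  \<comment> \<open>Read off the coordinates in the first extension and rebuild the point with the
    same coordinates in the second.\<close>
  define \<eta> where "\<eta> = (\<lambda>(a, k). u' a k) \<circ> inv_into (carrier A \<times> carrier K) (\<lambda>(a, k). u a k)"
  define \<zeta> where "\<zeta> = (\<lambda>(b, l). v' b l) \<circ> inv_into (carrier B \<times> carrier L) (\<lambda>(b, l). v b l)"
  have \<eta>_u: "\<eta> (u a k) = u' a k" if "a \<in> carrier A" "k \<in> carrier K" for a k
    using bij_betw_inv_into_left[OF u_bij, of "(a, k)"] that by (simp add: \<eta>_def)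
  have \<zeta>_v: "\<zeta> (v b l) = v' b l" if "b \<in> carrier B" "l \<in> carrier L" for b l
    using bij_betw_inv_into_left[OF v_bij, of "(b, l)"] that by (simp add: \<zeta>_def)
  have bij: "bij_betw \<eta> (carrier H) (carrier H')" "bij_betw \<zeta> (carrier G) (carrier G')"
    unfolding \<eta>_def \<zeta>_def
    by (rule bij_betw_trans bij_betw_inv_into u_bij v_bij E'.u_bij E'.v_bij)+
  have "\<eta> \<in> hom H H'" "\<zeta> \<in> hom G G'"
    by (auto simp: hom_def \<eta>_u \<zeta>_v u_mult v_mult E'.u_mult E'.v_mult elim!: u_cases v_cases)
  then have "rrb_iso (H, G, \<phi>, R) (H', G', \<phi>', R') \<eta> \<zeta>"
    using bij by (auto simp: \<eta>_u \<zeta>_v R_eq E'.R_eq \<phi>_eq E'.\<phi>_eq elim!: u_cases v_cases)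
  moreover have "\<forall>k \<in> carrier K. \<eta> (i1 k) = i1' k" "\<forall>l \<in> carrier L. \<zeta> (i2 l) = i2' l"
    by (simp_all add: i1_eq i2_eq E'.i1_eq E'.i2_eq \<eta>_u \<zeta>_v)
  moreover have "\<forall>h \<in> carrier H. \<pi>1' (\<eta> h) = \<pi>1 h" "\<forall>g \<in> carrier G. \<pi>2' (\<zeta> g) = \<pi>2 g"
    by (auto simp: \<eta>_u \<zeta>_v \<pi>1_eq \<pi>2_eq E'.\<pi>1_eq E'.\<pi>2_eq elim!: u_cases v_cases)
  ultimately show ?thesis
    by auto
qed

text \<open>Composing the coordinates with an equivalence changes none of the formulas. The
  \<open>rrb_group\<close> premises supply that units are preserved and that each
  \<open>\<phi>' g\<close> is extensional.\<close>

lemma presentation_transport: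
  assumes rrb_H: "rrb_group (H, G, \<phi>, R)" and rrb_H': "rrb_group (H', G', \<phi>', R')"
    and iso: "rrb_iso (H, G, \<phi>, R) (H', G', \<phi>', R') \<eta> \<zeta>"
    and i: "\<And>k. k \<in> carrier K \<Longrightarrow> \<eta> (i1 k) = i1' k" "\<And>l. l \<in> carrier L \<Longrightarrow> \<zeta> (i2 l) = i2' l"
    and \<pi>: "\<And>h. h \<in> carrier H \<Longrightarrow> \<pi>1' (\<eta> h) = \<pi>1 h" "\<And>g. g \<in> carrier G \<Longrightarrow> \<pi>2' (\<zeta> g) = \<pi>2 g"
  shows "cocycle_presentation A B \<beta> T K L \<alpha> S \<nu> \<mu> \<sigma> f H' G' \<phi>' R' i1' i2' \<pi>1' \<pi>2' \<tau>1 \<tau>2 \<rho> \<chi>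
           (\<lambda>a k. \<eta> (u a k)) (\<lambda>b l. \<zeta> (v b l))"
proof -
  have \<eta>: "\<eta> \<in> hom H H'" and \<zeta>: "\<zeta> \<in> hom G G'"
    and bij: "bij_betw \<eta> (carrier H) (carrier H')" "bij_betw \<zeta> (carrier G) (carrier G')"
    and \<eta>R: "\<And>h. h \<in> carrier H \<Longrightarrow> R' (\<eta> h) = \<zeta> (R h)"
    and \<eta>\<phi>: "\<And>g h. \<lbrakk>g \<in> carrier G; h \<in> carrier H\<rbrakk> \<Longrightarrow> \<phi>' (\<zeta> g) (\<eta> h) = \<eta> (\<phi> g h)"
    using iso by auto
  have "group H" "group G" "group H'" "group G'" and \<phi>'_hom: "\<phi>' \<in> hom G' (AutoGroup H')"
    using rrb_H rrb_H' by auto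
  then have one: "\<eta> \<one>\<^bsub>H\<^esub> = \<one>\<^bsub>H'\<^esub>" "\<zeta> \<one>\<^bsub>G\<^esub> = \<one>\<^bsub>G'\<^esub>"
    using \<eta> \<zeta> by (simp_all add: hom_one)
  show ?thesis
  proof (intro cocycle_presentation.intro rrb_module_data_axioms cocycle_presentation_axioms.intro
      cochain)
    show "bij_betw (\<lambda>(a, k). \<eta> (u a k)) (carrier A \<times> carrier K) (carrier H')"
      using bij_betw_trans[OF u_bij bij(1)] by (simp add: comp_def case_prod_unfold)
    show "bij_betw (\<lambda>(b, l). \<zeta> (v b l)) (carrier B \<times> carrier L) (carrier G')"
      using bij_betw_trans[OF v_bij bij(2)] by (simp add: comp_def case_prod_unfold)
    show "\<phi>' g \<in> extensional (carrier H')" if "g \<in> carrier G'" for g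
      using \<phi>'_hom that by (auto simp: hom_def AutoGroup_carrier_iff)
  \<comment> \<open>The first pass writes both sides as images under \<open>\<eta>\<close> and
    \<open>\<zeta>\<close>; the second applies the coordinate formulas of \<open>H\<close> and
    \<open>G\<close> inside.\<close>
  qed (use \<eta> \<zeta> in \<open>simp_all add: one flip: one_H one_G hom_mult i, simp_all add: u_mult v_mult
         \<eta>R R_eq \<eta>\<phi> \<phi>_eq i1_eq i2_eq \<pi> \<pi>1_eq \<pi>2_eq\<close>)
qed

end

section \<open>Change of coordinates and coboundaries\<close>

lemma cochain_group_mult_closed:
  assumes "monoid M" "c \<in> carrier (cochain_group X D M)" "d \<in> carrier (cochain_group X D M)"
  shows "c \<otimes>\<^bsub>cochain_group X D M\<^esub> d \<in> carrier (cochain_group X D M)"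
proof -
  interpret M: monoid M by (rule assms(1))
  show ?thesis
    using assms(2,3) by (auto simp: cochain_group_def PiE_def Pi_iff)
qed

context rrb_module_data
begin

text \<open>Inverse-free form of the second cochain being the first times the coboundary of
  \<open>(\<theta>1, \<theta>2)\<close>. These equations also describe how the cochain changes when
  the sections are translated by \<open>\<theta>1\<close> and \<open>\<theta>2\<close>.\<close>

definition cohomologous_by where
  "cohomologous_by \<theta>1 \<theta>2 = (\<lambda>(\<tau>1, \<tau>2, \<rho>, \<chi>) (\<tau>1', \<tau>2', \<rho>', \<chi>').
     (\<forall>a1\<in>carrier A. \<forall>a2\<in>carrier A.
        \<tau>1' (a1, a2) \<otimes>\<^bsub>K\<^esub> \<theta>1 (a1 \<otimes>\<^bsub>A\<^esub> a2) = \<tau>1 (a1, a2) \<otimes>\<^bsub>K\<^esub> \<mu> a2 (\<theta>1 a1) \<otimes>\<^bsub>K\<^esub> \<theta>1 a2) \<and>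
     (\<forall>b1\<in>carrier B. \<forall>b2\<in>carrier B.
        \<tau>2' (b1, b2) \<otimes>\<^bsub>L\<^esub> \<theta>2 (b1 \<otimes>\<^bsub>B\<^esub> b2) = \<tau>2 (b1, b2) \<otimes>\<^bsub>L\<^esub> \<sigma> b2 (\<theta>2 b1) \<otimes>\<^bsub>L\<^esub> \<theta>2 b2) \<and>
     (\<forall>a\<in>carrier A. \<forall>b\<in>carrier B.
        \<rho>' (a, b) \<otimes>\<^bsub>K\<^esub> \<theta>1 (\<beta> b a) = \<rho> (a, b) \<otimes>\<^bsub>K\<^esub> \<nu> b (f (\<theta>2 b) a \<otimes>\<^bsub>K\<^esub> \<theta>1 a)) \<and>
     (\<forall>a\<in>carrier A.
        \<chi>' a \<otimes>\<^bsub>L\<^esub> \<theta>2 (T a) = \<chi> a \<otimes>\<^bsub>L\<^esub> S (\<nu>inv (T a) (\<theta>1 a))))"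

text \<open>In each component the coboundary has exactly one inverted factor, a value of
  \<open>\<theta>1\<close> or \<open>\<theta>2\<close>, and this factor is moved to the other
  side.\<close>

lemma coboundary_mult_eq_iff:
  assumes z: "z \<in> carrier (C2_RRB (A, B, \<beta>, T) (K, L, \<alpha>, S))"
    and z': "z' \<in> carrier (C2_RRB (A, B, \<beta>, T) (K, L, \<alpha>, S))"
    and \<theta>: "(\<theta>1, \<theta>2) \<in> carrier (C1_RRB (A, B, \<beta>, T) (K, L, \<alpha>, S))"
  shows "z' = partial1_RRB (A, B, \<beta>, T) (K, L, \<alpha>, S) (\<nu>, \<mu>, \<sigma>, f) (\<theta>1, \<theta>2)
               \<otimes>\<^bsub>C2_RRB (A, B, \<beta>, T) (K, L, \<alpha>, S)\<^esub> z \<longleftrightarrow> cohomologous_by \<theta>1 \<theta>2 z z'"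
proof -
  obtain \<tau>1 \<tau>2 \<rho> \<chi> \<tau>1' \<tau>2' \<rho>' \<chi>' where zs: "z = (\<tau>1, \<tau>2, \<rho>, \<chi>)" "z' = (\<tau>1', \<tau>2', \<rho>', \<chi>')"
    by (metis prod_cases4)
  note [simp] =
    z[unfolded zs C2_carrier_iff cochains1_carrier_iff cochains2_carrier_iff, simplified]
    z'[unfolded zs C2_carrier_iff cochains1_carrier_iff cochains2_carrier_iff, simplified]
    \<theta>[unfolded C1_carrier_iff cochains1_carrier_iff, simplified]
  have ext_eq: "c = restrict g X \<longleftrightarrow> (\<forall>x\<in>X. c x = g x)" if "c \<in> extensional X" for c g X
    using that by (auto simp: fun_eq_iff restrict_def extensional_def)
  \<comment> \<open>The swaps bring the inverted factor to the end, where \<open>K_iff\<close> and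
    \<open>L_iff\<close> can move it across.\<close>
  have K_swap: "p \<otimes>\<^bsub>K\<^esub> inv\<^bsub>K\<^esub> q \<otimes>\<^bsub>K\<^esub> r \<otimes>\<^bsub>K\<^esub> t = t \<otimes>\<^bsub>K\<^esub> r \<otimes>\<^bsub>K\<^esub> p \<otimes>\<^bsub>K\<^esub> inv\<^bsub>K\<^esub> q"
    if "p \<in> carrier K" "q \<in> carrier K" "r \<in> carrier K" "t \<in> carrier K" for p q r t
    using that by (simp add: K.m_ac)
  have K_swap': "p \<otimes>\<^bsub>K\<^esub> inv\<^bsub>K\<^esub> q \<otimes>\<^bsub>K\<^esub> t = t \<otimes>\<^bsub>K\<^esub> p \<otimes>\<^bsub>K\<^esub> inv\<^bsub>K\<^esub> q"
    if "p \<in> carrier K" "q \<in> carrier K" "t \<in> carrier K" for p q t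
    using that by (simp add: K.m_ac)
  have L_swap: "p \<otimes>\<^bsub>L\<^esub> inv\<^bsub>L\<^esub> q \<otimes>\<^bsub>L\<^esub> r \<otimes>\<^bsub>L\<^esub> t = t \<otimes>\<^bsub>L\<^esub> r \<otimes>\<^bsub>L\<^esub> p \<otimes>\<^bsub>L\<^esub> inv\<^bsub>L\<^esub> q"
    if "p \<in> carrier L" "q \<in> carrier L" "r \<in> carrier L" "t \<in> carrier L" for p q r t
    using that by (simp add: L.m_ac)
  have L_swap': "p \<otimes>\<^bsub>L\<^esub> inv\<^bsub>L\<^esub> q \<otimes>\<^bsub>L\<^esub> t = t \<otimes>\<^bsub>L\<^esub> p \<otimes>\<^bsub>L\<^esub> inv\<^bsub>L\<^esub> q"
    if "p \<in> carrier L" "q \<in> carrier L" "t \<in> carrier L" for p q t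
    using that by (simp add: L.m_ac)
  have K_iff: "x = p \<otimes>\<^bsub>K\<^esub> inv\<^bsub>K\<^esub> q \<longleftrightarrow> x \<otimes>\<^bsub>K\<^esub> q = p"
    if "p \<in> carrier K" "q \<in> carrier K" "x \<in> carrier K" for p q x
    using that by (metis K.inv_solve_right)
  have L_iff: "x = p \<otimes>\<^bsub>L\<^esub> inv\<^bsub>L\<^esub> q \<longleftrightarrow> x \<otimes>\<^bsub>L\<^esub> q = p"
    if "p \<in> carrier L" "q \<in> carrier L" "x \<in> carrier L" for p q x
    using that by (metis L.inv_solve_right)
  have "\<tau>1' = (\<lambda>x\<in>carrier A \<times> carrier A. partial1 A K \<mu> \<theta>1 x \<otimes>\<^bsub>K\<^esub> \<tau>1 x) \<longleftrightarrow>
      (\<forall>a1\<in>carrier A. \<forall>a2\<in>carrier A.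
        \<tau>1' (a1, a2) \<otimes>\<^bsub>K\<^esub> \<theta>1 (a1 \<otimes>\<^bsub>A\<^esub> a2) = \<tau>1 (a1, a2) \<otimes>\<^bsub>K\<^esub> \<mu> a2 (\<theta>1 a1) \<otimes>\<^bsub>K\<^esub> \<theta>1 a2)"
    by (simp add: ext_eq partial1_def K_swap K_iff)
  moreover have "\<tau>2' = (\<lambda>x\<in>carrier B \<times> carrier B. partial1 B L \<sigma> \<theta>2 x \<otimes>\<^bsub>L\<^esub> \<tau>2 x) \<longleftrightarrow>
      (\<forall>b1\<in>carrier B. \<forall>b2\<in>carrier B.
        \<tau>2' (b1, b2) \<otimes>\<^bsub>L\<^esub> \<theta>2 (b1 \<otimes>\<^bsub>B\<^esub> b2) = \<tau>2 (b1, b2) \<otimes>\<^bsub>L\<^esub> \<sigma> b2 (\<theta>2 b1) \<otimes>\<^bsub>L\<^esub> \<theta>2 b2)"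
    by (simp add: ext_eq partial1_def L_swap L_iff)
  moreover have "\<rho>' = (\<lambda>x\<in>carrier A \<times> carrier B.
        (\<lambda>(a, b) \<in> carrier A \<times> carrier B.
         \<nu> b (f (\<theta>2 b) a \<otimes>\<^bsub>K\<^esub> \<theta>1 a) \<otimes>\<^bsub>K\<^esub> inv\<^bsub>K\<^esub> \<theta>1 (\<beta> b a)) x \<otimes>\<^bsub>K\<^esub> \<rho> x) \<longleftrightarrow>
      (\<forall>a\<in>carrier A. \<forall>b\<in>carrier B.
        \<rho>' (a, b) \<otimes>\<^bsub>K\<^esub> \<theta>1 (\<beta> b a) = \<rho> (a, b) \<otimes>\<^bsub>K\<^esub> \<nu> b (f (\<theta>2 b) a \<otimes>\<^bsub>K\<^esub> \<theta>1 a))"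
    by (simp add: ext_eq K_swap' K_iff del: nu.act_mult)
  moreover have "\<chi>' = (\<lambda>x\<in>carrier A. (\<lambda>a \<in> carrier A.
         S (\<nu>inv (T a) (\<theta>1 a)) \<otimes>\<^bsub>L\<^esub> inv\<^bsub>L\<^esub> \<theta>2 (T a)) x \<otimes>\<^bsub>L\<^esub> \<chi> x) \<longleftrightarrow>
      (\<forall>a\<in>carrier A. \<chi>' a \<otimes>\<^bsub>L\<^esub> \<theta>2 (T a) = \<chi> a \<otimes>\<^bsub>L\<^esub> S (\<nu>inv (T a) (\<theta>1 a)))"
    by (simp add: ext_eq L_swap' L_iff)
  ultimately show ?thesis
    unfolding zs cohomologous_by_def
    by (simp add: DirProd_def cochains1_def cochains2_def cochain_group_def)
qed

text \<open>That \<open>b\<close> is a cochain, normalization included, is read off from the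
  inclusion of coboundaries in cocycles.\<close>

lemma coboundary_mult_closed:
  assumes z: "z \<in> carrier (C2_RRB (A, B, \<beta>, T) (K, L, \<alpha>, S))"
    and b: "b \<in> B2_RRB (A, B, \<beta>, T) (K, L, \<alpha>, S) (\<nu>, \<mu>, \<sigma>, f)"
  shows "b \<otimes>\<^bsub>C2_RRB (A, B, \<beta>, T) (K, L, \<alpha>, S)\<^esub> z \<in> carrier (C2_RRB (A, B, \<beta>, T) (K, L, \<alpha>, S))"
proof -
  obtain \<tau>1 \<tau>2 \<rho> \<chi> \<tau>1' \<tau>2' \<rho>' \<chi>' where zs: "z = (\<tau>1, \<tau>2, \<rho>, \<chi>)" "b = (\<tau>1', \<tau>2', \<rho>', \<chi>')"
    by (metis prod_cases4)
  have b': "b \<in> carrier (C2_RRB (A, B, \<beta>, T) (K, L, \<alpha>, S))"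
    using B2_subset_Z2 b unfolding Z2_RRB_def kernel_def by blast
  show ?thesis
    using z b'[unfolded zs] unfolding zs
    by (simp add: DirProd_def cochains1_def cochains2_def
        cochain_group_mult_closed K.is_monoid L.is_monoid)
qed

end

section \<open>Coordinates on a fixed extension up to coboundaries\<close>

context cocycle_presentation
begin

text \<open>The equations of \<open>cohomologous_by\<close> say exactly that the old formulas turn
  into the new ones when \<open>\<theta>1\<close> and \<open>\<theta>2\<close> are absorbed into the
  fibre coordinates.\<close>

lemma presentation_shift:
  assumes z': "(\<tau>1', \<tau>2', \<rho>', \<chi>') \<in> carrier (C2_RRB (A, B, \<beta>, T) (K, L, \<alpha>, S))"
    and \<theta>: "(\<theta>1, \<theta>2) \<in> carrier (C1_RRB (A, B, \<beta>, T) (K, L, \<alpha>, S))"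
    and coh: "cohomologous_by \<theta>1 \<theta>2 (\<tau>1, \<tau>2, \<rho>, \<chi>) (\<tau>1', \<tau>2', \<rho>', \<chi>')"
  shows "cocycle_presentation A B \<beta> T K L \<alpha> S \<nu> \<mu> \<sigma> f H G \<phi> R i1 i2 \<pi>1 \<pi>2 \<tau>1' \<tau>2' \<rho>' \<chi>'
           (\<lambda>a k. u a (\<theta>1 a \<otimes>\<^bsub>K\<^esub> k)) (\<lambda>b l. v b (\<theta>2 b \<otimes>\<^bsub>L\<^esub> l))"
proof -
  note [simp] =
    z'[unfolded C2_carrier_iff cochains1_carrier_iff cochains2_carrier_iff, simplified]
    \<theta>[unfolded C1_carrier_iff cochains1_carrier_iff, simplified]
  \<comment> \<open>The translation value is put in front, where it meets the new cochain value in
    the shifted coordinate.\<close>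
  have coh': "\<And>a1 a2. a1 \<in> carrier A \<Longrightarrow> a2 \<in> carrier A \<Longrightarrow>
      \<theta>1 (a1 \<otimes>\<^bsub>A\<^esub> a2) \<otimes>\<^bsub>K\<^esub> \<tau>1' (a1, a2) = \<tau>1 (a1, a2) \<otimes>\<^bsub>K\<^esub> (\<mu> a2 (\<theta>1 a1) \<otimes>\<^bsub>K\<^esub> \<theta>1 a2)"
    "\<And>b1 b2. b1 \<in> carrier B \<Longrightarrow> b2 \<in> carrier B \<Longrightarrow>
      \<theta>2 (b1 \<otimes>\<^bsub>B\<^esub> b2) \<otimes>\<^bsub>L\<^esub> \<tau>2' (b1, b2) = \<tau>2 (b1, b2) \<otimes>\<^bsub>L\<^esub> (\<sigma> b2 (\<theta>2 b1) \<otimes>\<^bsub>L\<^esub> \<theta>2 b2)"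
    "\<And>a b. a \<in> carrier A \<Longrightarrow> b \<in> carrier B \<Longrightarrow>
      \<theta>1 (\<beta> b a) \<otimes>\<^bsub>K\<^esub> \<rho>' (a, b) = \<rho> (a, b) \<otimes>\<^bsub>K\<^esub> \<nu> b (f (\<theta>2 b) a \<otimes>\<^bsub>K\<^esub> \<theta>1 a)"
    "\<And>a. a \<in> carrier A \<Longrightarrow> \<theta>2 (T a) \<otimes>\<^bsub>L\<^esub> \<chi>' a = \<chi> a \<otimes>\<^bsub>L\<^esub> S (\<nu>inv (T a) (\<theta>1 a))"
    using coh by (simp_all add: cohomologous_by_def K.m_ac L.m_ac)
  have shift_K: "bij_betw (\<lambda>(a, k). (a, \<theta>1 a \<otimes>\<^bsub>K\<^esub> k)) (carrier A \<times> carrier K) (carrier A \<times> carrier K)"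
    by (rule bij_betwI[where g = "\<lambda>(a, k). (a, inv\<^bsub>K\<^esub> \<theta>1 a \<otimes>\<^bsub>K\<^esub> k)"])
      (auto simp flip: K.m_assoc)
  have shift_L: "bij_betw (\<lambda>(b, l). (b, \<theta>2 b \<otimes>\<^bsub>L\<^esub> l)) (carrier B \<times> carrier L) (carrier B \<times> carrier L)"
    by (rule bij_betwI[where g = "\<lambda>(b, l). (b, inv\<^bsub>L\<^esub> \<theta>2 b \<otimes>\<^bsub>L\<^esub> l)"])
      (auto simp flip: L.m_assoc)
  show ?thesis
  proof (intro cocycle_presentation.intro rrb_module_data_axioms cocycle_presentation_axioms.intro z')
    show "bij_betw (\<lambda>(a, k). u a (\<theta>1 a \<otimes>\<^bsub>K\<^esub> k)) (carrier A \<times> carrier K) (carrier H)"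
      using bij_betw_trans[OF shift_K u_bij] by (simp add: comp_def case_prod_unfold)
    show "bij_betw (\<lambda>(b, l). v b (\<theta>2 b \<otimes>\<^bsub>L\<^esub> l)) (carrier B \<times> carrier L) (carrier G)"
      using bij_betw_trans[OF shift_L v_bij] by (simp add: comp_def case_prod_unfold)
    show "u a1 (\<theta>1 a1 \<otimes>\<^bsub>K\<^esub> k1) \<otimes>\<^bsub>H\<^esub> u a2 (\<theta>1 a2 \<otimes>\<^bsub>K\<^esub> k2) =
        u (a1 \<otimes>\<^bsub>A\<^esub> a2) (\<theta>1 (a1 \<otimes>\<^bsub>A\<^esub> a2) \<otimes>\<^bsub>K\<^esub> (\<tau>1' (a1, a2) \<otimes>\<^bsub>K\<^esub> \<mu> a2 k1 \<otimes>\<^bsub>K\<^esub> k2))"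
      if a: "a1 \<in> carrier A" "a2 \<in> carrier A" "k1 \<in> carrier K" "k2 \<in> carrier K" for a1 a2 k1 k2
    proof -
      have "\<theta>1 (a1 \<otimes>\<^bsub>A\<^esub> a2) \<otimes>\<^bsub>K\<^esub> (\<tau>1' (a1, a2) \<otimes>\<^bsub>K\<^esub> \<mu> a2 k1 \<otimes>\<^bsub>K\<^esub> k2) =
          (\<theta>1 (a1 \<otimes>\<^bsub>A\<^esub> a2) \<otimes>\<^bsub>K\<^esub> \<tau>1' (a1, a2)) \<otimes>\<^bsub>K\<^esub> (\<mu> a2 k1 \<otimes>\<^bsub>K\<^esub> k2)"
        using a by (simp add: K.m_assoc)
      also have "\<dots> = \<tau>1 (a1, a2) \<otimes>\<^bsub>K\<^esub> \<mu> a2 (\<theta>1 a1 \<otimes>\<^bsub>K\<^esub> k1) \<otimes>\<^bsub>K\<^esub> (\<theta>1 a2 \<otimes>\<^bsub>K\<^esub> k2)"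
        using a by (simp only: coh') (simp add: K.m_ac)
      finally show ?thesis
        using a by (simp add: u_mult)
    qed
    show "v b1 (\<theta>2 b1 \<otimes>\<^bsub>L\<^esub> l1) \<otimes>\<^bsub>G\<^esub> v b2 (\<theta>2 b2 \<otimes>\<^bsub>L\<^esub> l2) =
        v (b1 \<otimes>\<^bsub>B\<^esub> b2) (\<theta>2 (b1 \<otimes>\<^bsub>B\<^esub> b2) \<otimes>\<^bsub>L\<^esub> (\<tau>2' (b1, b2) \<otimes>\<^bsub>L\<^esub> \<sigma> b2 l1 \<otimes>\<^bsub>L\<^esub> l2))"
      if b: "b1 \<in> carrier B" "b2 \<in> carrier B" "l1 \<in> carrier L" "l2 \<in> carrier L" for b1 b2 l1 l2
    proof -
      have "\<theta>2 (b1 \<otimes>\<^bsub>B\<^esub> b2) \<otimes>\<^bsub>L\<^esub> (\<tau>2' (b1, b2) \<otimes>\<^bsub>L\<^esub> \<sigma> b2 l1 \<otimes>\<^bsub>L\<^esub> l2) =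
          (\<theta>2 (b1 \<otimes>\<^bsub>B\<^esub> b2) \<otimes>\<^bsub>L\<^esub> \<tau>2' (b1, b2)) \<otimes>\<^bsub>L\<^esub> (\<sigma> b2 l1 \<otimes>\<^bsub>L\<^esub> l2)"
        using b by (simp add: L.m_assoc)
      also have "\<dots> = \<tau>2 (b1, b2) \<otimes>\<^bsub>L\<^esub> \<sigma> b2 (\<theta>2 b1 \<otimes>\<^bsub>L\<^esub> l1) \<otimes>\<^bsub>L\<^esub> (\<theta>2 b2 \<otimes>\<^bsub>L\<^esub> l2)"
        using b by (simp only: coh') (simp add: L.m_ac)
      finally show ?thesis
        using b by (simp add: v_mult)
    qed
    show "\<phi> (v b (\<theta>2 b \<otimes>\<^bsub>L\<^esub> l)) (u a (\<theta>1 a \<otimes>\<^bsub>K\<^esub> k)) =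
        u (\<beta> b a) (\<theta>1 (\<beta> b a) \<otimes>\<^bsub>K\<^esub> (\<rho>' (a, b) \<otimes>\<^bsub>K\<^esub> \<nu> b (f l a \<otimes>\<^bsub>K\<^esub> k)))"
      if a: "a \<in> carrier A" "k \<in> carrier K" "b \<in> carrier B" "l \<in> carrier L" for a b k l
    proof -
      have "\<theta>1 (\<beta> b a) \<otimes>\<^bsub>K\<^esub> (\<rho>' (a, b) \<otimes>\<^bsub>K\<^esub> \<nu> b (f l a \<otimes>\<^bsub>K\<^esub> k)) =
          (\<theta>1 (\<beta> b a) \<otimes>\<^bsub>K\<^esub> \<rho>' (a, b)) \<otimes>\<^bsub>K\<^esub> \<nu> b (f l a \<otimes>\<^bsub>K\<^esub> k)"
        using a by (simp add: K.m_assoc)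
      also have "\<dots> = \<rho> (a, b) \<otimes>\<^bsub>K\<^esub> \<nu> b (f (\<theta>2 b \<otimes>\<^bsub>L\<^esub> l) a \<otimes>\<^bsub>K\<^esub> (\<theta>1 a \<otimes>\<^bsub>K\<^esub> k))"
        using a by (simp only: coh') (simp add: K.m_ac)
      finally show ?thesis
        using a by (simp add: \<phi>_eq)
    qed
    show "R (u a (\<theta>1 a \<otimes>\<^bsub>K\<^esub> k)) = v (T a) (\<theta>2 (T a) \<otimes>\<^bsub>L\<^esub> (\<chi>' a \<otimes>\<^bsub>L\<^esub> S (\<nu>inv (T a) k)))"
      if a: "a \<in> carrier A" "k \<in> carrier K" for a k
    proof -
      have "\<theta>2 (T a) \<otimes>\<^bsub>L\<^esub> (\<chi>' a \<otimes>\<^bsub>L\<^esub> S (\<nu>inv (T a) k)) =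
          (\<theta>2 (T a) \<otimes>\<^bsub>L\<^esub> \<chi>' a) \<otimes>\<^bsub>L\<^esub> S (\<nu>inv (T a) k)"
        using a by (simp add: L.m_assoc)
      also have "\<dots> = \<chi> a \<otimes>\<^bsub>L\<^esub> S (\<nu>inv (T a) (\<theta>1 a \<otimes>\<^bsub>K\<^esub> k))"
        using a by (simp only: coh') (simp add: L.m_ac)
      finally show ?thesis
        using a by (simp add: R_eq)
    qed
  qed (simp_all add: one_H one_G i1_eq i2_eq \<pi>1_eq \<pi>2_eq \<phi>_extensional)
qed

text \<open>Points of the two presentations with trivial fibre coordinate lie over the same base
  point, so they differ by a fibre element; these differences form \<open>\<theta>1\<close> and
  \<open>\<theta>2\<close>. Comparing the structure formulas at such points gives the
  equations.\<close>

lemma cocycles_of_presentations_cohomologous: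
  assumes "cocycle_presentation A B \<beta> T K L \<alpha> S \<nu> \<mu> \<sigma> f H G \<phi> R i1 i2 \<pi>1 \<pi>2 \<tau>1' \<tau>2' \<rho>' \<chi>' u' v'"
  obtains \<theta>1 \<theta>2 where "(\<theta>1, \<theta>2) \<in> carrier (C1_RRB (A, B, \<beta>, T) (K, L, \<alpha>, S))"
    "cohomologous_by \<theta>1 \<theta>2 (\<tau>1, \<tau>2, \<rho>, \<chi>) (\<tau>1', \<tau>2', \<rho>', \<chi>')"
proof -
  interpret E': cocycle_presentation A B \<beta> T K L \<alpha> S \<nu> \<mu> \<sigma> f H G \<phi> R i1 i2 \<pi>1 \<pi>2 \<tau>1' \<tau>2' \<rho>' \<chi>' u' v'
    by (rule assms)
  have "\<exists>k\<in>carrier K. u' a \<one>\<^bsub>K\<^esub> = u a k" if "a \<in> carrier A" for a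
    using that E'.\<pi>1_eq[OF that K.one_closed] \<pi>1_eq u_cases[OF E'.u_closed[OF that K.one_closed]]
    by metis
  then obtain t1 where t1: "\<And>a. a \<in> carrier A \<Longrightarrow> t1 a \<in> carrier K \<and> u' a \<one>\<^bsub>K\<^esub> = u a (t1 a)"
    by metis
  have "\<exists>l\<in>carrier L. v' b \<one>\<^bsub>L\<^esub> = v b l" if "b \<in> carrier B" for b
    using that E'.\<pi>2_eq[OF that L.one_closed] \<pi>2_eq v_cases[OF E'.v_closed[OF that L.one_closed]]
    by metis
  then obtain t2 where t2: "\<And>b. b \<in> carrier B \<Longrightarrow> t2 b \<in> carrier L \<and> v' b \<one>\<^bsub>L\<^esub> = v b (t2 b)"
    by metis
  \<comment> \<open>Restriction makes the differences extensional, as cochains have to be.\<close>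
  define \<theta>1 where "\<theta>1 = restrict t1 (carrier A)"
  define \<theta>2 where "\<theta>2 = restrict t2 (carrier B)"
  have \<theta>1: "\<theta>1 a \<in> carrier K" "u' a \<one>\<^bsub>K\<^esub> = u a (\<theta>1 a)" if "a \<in> carrier A" for a
    using t1[OF that] that by (simp_all add: \<theta>1_def)
  have \<theta>2: "\<theta>2 b \<in> carrier L" "v' b \<one>\<^bsub>L\<^esub> = v b (\<theta>2 b)" if "b \<in> carrier B" for b
    using t2[OF that] that by (simp_all add: \<theta>2_def)
  \<comment> \<open>Both presentations assign the unit of \<open>H\<close> to the trivial
    coordinates.\<close>
  have \<theta>1_one: "\<theta>1 \<one>\<^bsub>A\<^esub> = \<one>\<^bsub>K\<^esub>"
    using \<theta>1[of "\<one>\<^bsub>A\<^esub>"] by (simp add: u_eq_iff flip: E'.one_H one_H) (metis u_eq_iff one_H K.one_closed beta.H.one_closed)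
  have \<theta>2_one: "\<theta>2 \<one>\<^bsub>B\<^esub> = \<one>\<^bsub>L\<^esub>"
    using \<theta>2[of "\<one>\<^bsub>B\<^esub>"] by (simp add: v_eq_iff flip: E'.one_G one_G) (metis v_eq_iff one_G L.one_closed beta.G.one_closed)
  \<comment> \<open>Right multiplication by \<open>i1 k\<close>, which both presentations share,
    extends the comparison from trivial to arbitrary fibre coordinates.\<close>
  have u': "u' a k = u a (\<theta>1 a \<otimes>\<^bsub>K\<^esub> k)" if "a \<in> carrier A" "k \<in> carrier K" for a k
  proof -
    have "u' a k = u' a \<one>\<^bsub>K\<^esub> \<otimes>\<^bsub>H\<^esub> i1 k"
      using that by (simp add: E'.i1_eq E'.u_mult)
    also have "\<dots> = u a (\<theta>1 a \<otimes>\<^bsub>K\<^esub> k)"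
      using that by (simp add: \<theta>1 i1_eq u_mult)
    finally show ?thesis .
  qed
  have v': "v' b l = v b (\<theta>2 b \<otimes>\<^bsub>L\<^esub> l)" if "b \<in> carrier B" "l \<in> carrier L" for b l
  proof -
    have "v' b l = v' b \<one>\<^bsub>L\<^esub> \<otimes>\<^bsub>G\<^esub> i2 l"
      using that by (simp add: E'.i2_eq E'.v_mult)
    also have "\<dots> = v b (\<theta>2 b \<otimes>\<^bsub>L\<^esub> l)"
      using that by (simp add: \<theta>2 i2_eq v_mult)
    finally show ?thesis .
  qed
  have "(\<theta>1, \<theta>2) \<in> carrier (C1_RRB (A, B, \<beta>, T) (K, L, \<alpha>, S))"
    unfolding C1_carrier_iff cochains1_carrier_iff
    by (simp add: \<theta>1 \<theta>2 \<theta>1_one \<theta>2_one) (simp add: \<theta>1_def \<theta>2_def)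
  moreover have "cohomologous_by \<theta>1 \<theta>2 (\<tau>1, \<tau>2, \<rho>, \<chi>) (\<tau>1', \<tau>2', \<rho>', \<chi>')"
    unfolding cohomologous_by_def prod.case
  proof (intro conjI ballI)
    fix a1 a2 assume a: "a1 \<in> carrier A" "a2 \<in> carrier A"
    then show "\<tau>1' (a1, a2) \<otimes>\<^bsub>K\<^esub> \<theta>1 (a1 \<otimes>\<^bsub>A\<^esub> a2) = \<tau>1 (a1, a2) \<otimes>\<^bsub>K\<^esub> \<mu> a2 (\<theta>1 a1) \<otimes>\<^bsub>K\<^esub> \<theta>1 a2"
      using E'.u_mult[of a1 a2 "\<one>\<^bsub>K\<^esub>" "\<one>\<^bsub>K\<^esub>"]
      by (simp add: u' \<theta>1 u_mult u_eq_iff K.m_comm)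
  next
    fix b1 b2 assume b: "b1 \<in> carrier B" "b2 \<in> carrier B"
    then show "\<tau>2' (b1, b2) \<otimes>\<^bsub>L\<^esub> \<theta>2 (b1 \<otimes>\<^bsub>B\<^esub> b2) = \<tau>2 (b1, b2) \<otimes>\<^bsub>L\<^esub> \<sigma> b2 (\<theta>2 b1) \<otimes>\<^bsub>L\<^esub> \<theta>2 b2"
      using E'.v_mult[of b1 b2 "\<one>\<^bsub>L\<^esub>" "\<one>\<^bsub>L\<^esub>"]
      by (simp add: v' \<theta>2 v_mult v_eq_iff L.m_comm)
  next
    fix a b assume ab: "a \<in> carrier A" "b \<in> carrier B"
    then show "\<rho>' (a, b) \<otimes>\<^bsub>K\<^esub> \<theta>1 (\<beta> b a) = \<rho> (a, b) \<otimes>\<^bsub>K\<^esub> \<nu> b (f (\<theta>2 b) a \<otimes>\<^bsub>K\<^esub> \<theta>1 a)"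
      using E'.\<phi>_eq[of a "\<one>\<^bsub>K\<^esub>" b "\<one>\<^bsub>L\<^esub>"]
      by (simp add: u' v' \<theta>1 \<theta>2 \<phi>_eq u_eq_iff K.m_comm)
  next
    fix a assume "a \<in> carrier A"
    then show "\<chi>' a \<otimes>\<^bsub>L\<^esub> \<theta>2 (T a) = \<chi> a \<otimes>\<^bsub>L\<^esub> S (\<nu>inv (T a) (\<theta>1 a))"
      using E'.R_eq[of a "\<one>\<^bsub>K\<^esub>"]
      by (simp add: u' v' \<theta>1 \<theta>2 R_eq v_eq_iff L.m_comm)
  qed
  ultimately show ?thesis
    by (rule that)
qed

end

section \<open>Realization of cochains on prescribed types\<close>

context rrb_module_data
begin

text \<open>The structure on pairs is carried along \<open>U\<close> and \<open>V\<close>, because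
  \<open>Ext_RRB\<close> sees only extensions living on the types \<open>'h\<close> and
  \<open>'g\<close>. A cochain suffices, as the locale demands the formulas and not the group
  axioms.\<close>

lemma presentation_exists:
  fixes U :: "'a \<times> 'k \<Rightarrow> 'h" and V :: "'b \<times> 'l \<Rightarrow> 'g"
  assumes z: "(\<tau>1, \<tau>2, \<rho>, \<chi>) \<in> carrier (C2_RRB (A, B, \<beta>, T) (K, L, \<alpha>, S))"
    and U: "inj_on U (carrier A \<times> carrier K)" and V: "inj_on V (carrier B \<times> carrier L)"
  shows "\<exists>H G \<phi> R i1 i2 \<pi>1 \<pi>2.
    cocycle_presentation A B \<beta> T K L \<alpha> S \<nu> \<mu> \<sigma> f H G \<phi> R i1 i2 \<pi>1 \<pi>2 \<tau>1 \<tau>2 \<rho> \<chi>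
      (\<lambda>a k. U (a, k)) (\<lambda>b l. V (b, l))"
proof -
  define U' where "U' = inv_into (carrier A \<times> carrier K) U"
  define V' where "V' = inv_into (carrier B \<times> carrier L) V"
  have U': "U' (U (a, k)) = (a, k)" if "a \<in> carrier A" "k \<in> carrier K" for a k
    using that U by (simp add: U'_def)
  have V': "V' (V (b, l)) = (b, l)" if "b \<in> carrier B" "l \<in> carrier L" for b l
    using that V by (simp add: V'_def)
  define H where "H = \<lparr>carrier = U ` (carrier A \<times> carrier K),
    mult = \<lambda>x y. case (U' x, U' y) of ((a1, k1), (a2, k2)) \<Rightarrow>
      U (a1 \<otimes>\<^bsub>A\<^esub> a2, \<tau>1 (a1, a2) \<otimes>\<^bsub>K\<^esub> \<mu> a2 k1 \<otimes>\<^bsub>K\<^esub> k2),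
    one = U (\<one>\<^bsub>A\<^esub>, \<one>\<^bsub>K\<^esub>)\<rparr>"
  define G where "G = \<lparr>carrier = V ` (carrier B \<times> carrier L),
    mult = \<lambda>x y. case (V' x, V' y) of ((b1, l1), (b2, l2)) \<Rightarrow>
      V (b1 \<otimes>\<^bsub>B\<^esub> b2, \<tau>2 (b1, b2) \<otimes>\<^bsub>L\<^esub> \<sigma> b2 l1 \<otimes>\<^bsub>L\<^esub> l2),
    one = V (\<one>\<^bsub>B\<^esub>, \<one>\<^bsub>L\<^esub>)\<rparr>"
  \<comment> \<open>Each \<open>\<phi> g\<close> is restricted to the carrier, since automorphisms
    are extensional maps.\<close>
  define \<phi> where "\<phi> = (\<lambda>g. \<lambda>x\<in>carrier H. case (V' g, U' x) of ((b, l), (a, k)) \<Rightarrow>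
      U (\<beta> b a, \<rho> (a, b) \<otimes>\<^bsub>K\<^esub> \<nu> b (f l a \<otimes>\<^bsub>K\<^esub> k)))"
  define R where "R = (\<lambda>x. case U' x of (a, k) \<Rightarrow> V (T a, \<chi> a \<otimes>\<^bsub>L\<^esub> S (\<nu>inv (T a) k)))"
  have "cocycle_presentation A B \<beta> T K L \<alpha> S \<nu> \<mu> \<sigma> f H G \<phi> R
      (\<lambda>k. U (\<one>\<^bsub>A\<^esub>, k)) (\<lambda>l. V (\<one>\<^bsub>B\<^esub>, l)) (fst \<circ> U') (fst \<circ> V') \<tau>1 \<tau>2 \<rho> \<chi>
      (\<lambda>a k. U (a, k)) (\<lambda>b l. V (b, l))"
    by (intro cocycle_presentation.intro rrb_module_data_axioms cocycle_presentation_axioms.intro z)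
      (use U V in \<open>simp_all add: bij_betw_def H_def G_def \<phi>_def R_def U' V'\<close>)
  then show ?thesis
    by blast
qed

end

section \<open>Coordinates on a given extension\<close>

text \<open>The part of an extension that concerns a single group, with \<open>\<mu>\<close> the
  conjugation by a section; it is used once for \<open>H\<close> over \<open>A\<close> and once for
  \<open>G\<close> over \<open>B\<close>.\<close>

locale normalized_group_extension = K: group K + H: group H + A: group A
  for K :: "'k monoid" and H :: "'h monoid" and A :: "'a monoid" +
  fixes i :: "'k \<Rightarrow> 'h" and \<pi> :: "'h \<Rightarrow> 'a" and s :: "'a \<Rightarrow> 'h" and \<mu> :: "'a \<Rightarrow> 'k \<Rightarrow> 'k"
  assumes i_hom: "i \<in> hom K H" and i_inj: "inj_on i (carrier K)"
    and \<pi>_hom: "\<pi> \<in> hom H A"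
    and exact: "i ` carrier K = kernel H A \<pi>"
    and s_section: "normalized_section H A \<pi> s"
    and \<mu>_closed: "\<lbrakk>a \<in> carrier A; k \<in> carrier K\<rbrakk> \<Longrightarrow> \<mu> a k \<in> carrier K"
    and i_\<mu>: "\<lbrakk>a \<in> carrier A; k \<in> carrier K\<rbrakk> \<Longrightarrow>
                i (\<mu> a k) = inv\<^bsub>H\<^esub> (s a) \<otimes>\<^bsub>H\<^esub> i k \<otimes>\<^bsub>H\<^esub> s a"
begin

lemma i_closed [simp]: "k \<in> carrier K \<Longrightarrow> i k \<in> carrier H"
  using i_hom by (auto simp: hom_def)

lemma i_mult: "k \<in> carrier K \<Longrightarrow> k' \<in> carrier K \<Longrightarrow> i (k \<otimes>\<^bsub>K\<^esub> k') = i k \<otimes>\<^bsub>H\<^esub> i k'"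
  using i_hom by (simp add: hom_def)

lemma i_one: "i \<one>\<^bsub>K\<^esub> = \<one>\<^bsub>H\<^esub>"
  using hom_one[OF i_hom K.is_group H.is_group] .

lemma \<pi>_closed [simp]: "h \<in> carrier H \<Longrightarrow> \<pi> h \<in> carrier A"
  using \<pi>_hom by (auto simp: hom_def)

lemma \<pi>_mult [simp]: "h \<in> carrier H \<Longrightarrow> h' \<in> carrier H \<Longrightarrow> \<pi> (h \<otimes>\<^bsub>H\<^esub> h') = \<pi> h \<otimes>\<^bsub>A\<^esub> \<pi> h'"
  using \<pi>_hom by (simp add: hom_def)

lemma \<pi>_inv [simp]: "h \<in> carrier H \<Longrightarrow> \<pi> (inv\<^bsub>H\<^esub> h) = inv\<^bsub>A\<^esub> \<pi> h"
  using \<pi>_hom by (simp add: group_hom.hom_inv group_hom_def group_hom_axioms_def H.is_group A.is_group)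

lemma \<pi>_i [simp]: "k \<in> carrier K \<Longrightarrow> \<pi> (i k) = \<one>\<^bsub>A\<^esub>"
  using exact by (auto simp: kernel_def)

lemma s_closed [simp]: "a \<in> carrier A \<Longrightarrow> s a \<in> carrier H"
  using s_section by (auto simp: normalized_section_def)

lemma \<pi>_s [simp]: "a \<in> carrier A \<Longrightarrow> \<pi> (s a) = a"
  using s_section by (auto simp: normalized_section_def)

lemma s_one [simp]: "s \<one>\<^bsub>A\<^esub> = \<one>\<^bsub>H\<^esub>"
  using s_section by (auto simp: normalized_section_def)

text \<open>The fibre coordinate of \<open>h\<close>: dividing \<open>h\<close> by the section value
  over \<open>\<pi> h\<close> gives an element of the kernel, hence of the image of
  \<open>i\<close>.\<close>

definition kpart :: "'h \<Rightarrow> 'k" where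
  "kpart h = inv_into (carrier K) i (inv\<^bsub>H\<^esub> (s (\<pi> h)) \<otimes>\<^bsub>H\<^esub> h)"

lemma kpart_spec:
  assumes "h \<in> carrier H"
  shows "kpart h \<in> carrier K" "s (\<pi> h) \<otimes>\<^bsub>H\<^esub> i (kpart h) = h"
proof -
  have *: "inv\<^bsub>H\<^esub> (s (\<pi> h)) \<otimes>\<^bsub>H\<^esub> h \<in> i ` carrier K"
    unfolding exact kernel_def using assms by simp
  then show "kpart h \<in> carrier K"
    unfolding kpart_def by (rule inv_into_into)
  have "i (kpart h) = inv\<^bsub>H\<^esub> (s (\<pi> h)) \<otimes>\<^bsub>H\<^esub> h"
    unfolding kpart_def by (rule f_inv_into_f[OF *])
  then show "s (\<pi> h) \<otimes>\<^bsub>H\<^esub> i (kpart h) = h"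
    using assms by (simp flip: H.m_assoc)
qed

lemma kpart_mult [simp]:
  "a \<in> carrier A \<Longrightarrow> k \<in> carrier K \<Longrightarrow> kpart (s a \<otimes>\<^bsub>H\<^esub> i k) = k"
  using i_inj by (simp add: kpart_def flip: H.m_assoc)

lemma kpart_s [simp]: "a \<in> carrier A \<Longrightarrow> kpart (s a) = \<one>\<^bsub>K\<^esub>"
  using kpart_mult[of a "\<one>\<^bsub>K\<^esub>"] by (simp add: i_one)

lemma coordinates_bij: "bij_betw (\<lambda>(a, k). s a \<otimes>\<^bsub>H\<^esub> i k) (carrier A \<times> carrier K) (carrier H)"
  by (rule bij_betwI[where g = "\<lambda>h. (\<pi> h, kpart h)"]) (auto simp: kpart_spec)

lemma conjugate: "a \<in> carrier A \<Longrightarrow> k \<in> carrier K \<Longrightarrow> i k \<otimes>\<^bsub>H\<^esub> s a = s a \<otimes>\<^bsub>H\<^esub> i (\<mu> a k)"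
  by (simp add: i_\<mu> flip: H.m_assoc)

text \<open>Passing \<open>i k1\<close> across \<open>s a2\<close> turns it into
  \<open>i (\<mu> a2 k1)\<close>, and \<open>kpart (s a1 \<otimes> s a2)\<close> is the factor set
  of the section.\<close>

lemma coordinates_mult:
  assumes "a1 \<in> carrier A" "a2 \<in> carrier A" "k1 \<in> carrier K" "k2 \<in> carrier K"
  shows "(s a1 \<otimes>\<^bsub>H\<^esub> i k1) \<otimes>\<^bsub>H\<^esub> (s a2 \<otimes>\<^bsub>H\<^esub> i k2) =
    s (a1 \<otimes>\<^bsub>A\<^esub> a2) \<otimes>\<^bsub>H\<^esub> i (kpart (s a1 \<otimes>\<^bsub>H\<^esub> s a2) \<otimes>\<^bsub>K\<^esub> \<mu> a2 k1 \<otimes>\<^bsub>K\<^esub> k2)"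
proof -
  have "(s a1 \<otimes>\<^bsub>H\<^esub> i k1) \<otimes>\<^bsub>H\<^esub> (s a2 \<otimes>\<^bsub>H\<^esub> i k2) = s a1 \<otimes>\<^bsub>H\<^esub> (i k1 \<otimes>\<^bsub>H\<^esub> s a2) \<otimes>\<^bsub>H\<^esub> i k2"
    using assms by (simp add: H.m_assoc)
  also have "\<dots> = (s a1 \<otimes>\<^bsub>H\<^esub> s a2) \<otimes>\<^bsub>H\<^esub> i (\<mu> a2 k1) \<otimes>\<^bsub>H\<^esub> i k2"
    using assms by (simp add: conjugate \<mu>_closed H.m_assoc)
  also have "s a1 \<otimes>\<^bsub>H\<^esub> s a2 = s (a1 \<otimes>\<^bsub>A\<^esub> a2) \<otimes>\<^bsub>H\<^esub> i (kpart (s a1 \<otimes>\<^bsub>H\<^esub> s a2))"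
    using assms kpart_spec(2)[of "s a1 \<otimes>\<^bsub>H\<^esub> s a2"] by simp
  finally show ?thesis
    using assms by (simp add: i_mult \<mu>_closed kpart_spec H.m_assoc)
qed

end

text \<open>A map factors through its kernel relation and becomes injective there;
  \<open>the_elem\<close> reads off the common value on a class without choosing a
  representative.\<close>

lemma bij_betw_quotient_image:
  assumes "r = {(x, y). x \<in> X \<and> y \<in> X \<and> P x = P y}"
  shows "bij_betw (\<lambda>c. the_elem (P ` c)) (X // r) (P ` X)"
proof -
  have the_P: "the_elem (P ` (r `` {x})) = P x" if "x \<in> X" for x
  proof -
    have "P ` (r `` {x}) = {P x}"
      using that by (auto simp: assms)
    then show ?thesis by simp
  qed
  show ?thesis
    unfolding bij_betw_def
  proof
    show "inj_on (\<lambda>c. the_elem (P ` c)) (X // r)"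
      unfolding quotient_def using the_P by (auto simp: inj_on_def assms)
    have "(\<lambda>c. the_elem (P ` c)) ` (X // r) = (\<lambda>x. the_elem (P ` (r `` {x}))) ` X"
      unfolding quotient_def by blast
    also have "\<dots> = P ` X"
      using the_P by (rule image_cong[OF refl])
    finally show "(\<lambda>c. the_elem (P ` c)) ` (X // r) = P ` X" .
  qed
qed

section \<open>Coordinates obtained from sections\<close>

context rrb_module_data
begin

text \<open>The sections that witness the associated action give the coordinates. The cochain
  records the fibre coordinates of products of section values, of \<open>\<phi>\<close> applied to
  them, and of their images under \<open>R\<close>.\<close>

lemma presentation_of_extension:
  assumes ext: "((H, G, \<phi>, R), i1, i2, \<pi>1, \<pi>2)
                  \<in> extensions_with_action (A, B, \<beta>, T) (K, L, \<alpha>, S) (\<nu>, \<mu>, \<sigma>, f)"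
  shows "\<exists>\<tau>1 \<tau>2 \<rho> \<chi> u v. cocycle_presentation A B \<beta> T K L \<alpha> S \<nu> \<mu> \<sigma> f H G \<phi> R i1 i2 \<pi>1 \<pi>2 \<tau>1 \<tau>2 \<rho> \<chi> u v"
proof -
  have rrb_H: "rrb_group (H, G, \<phi>, R)"
    and emb: "rrb_embedding (K, L, \<alpha>, S) (H, G, \<phi>, R) i1 i2"
    and epi: "rrb_epimorphism (H, G, \<phi>, R) (A, B, \<beta>, T) \<pi>1 \<pi>2"
    and ker: "i1 ` carrier K = kernel H A \<pi>1" "i2 ` carrier L = kernel G B \<pi>2"
    and act: "has_associated_action (A, B, \<beta>, T) (K, L, \<alpha>, S)
                ((H, G, \<phi>, R), i1, i2, \<pi>1, \<pi>2) (\<nu>, \<mu>, \<sigma>, f)"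
    using ext unfolding extensions_with_action_def by simp_all
  from act obtain sH sG where
    sec: "normalized_section H A \<pi>1 sH" "normalized_section G B \<pi>2 sG"
    and i1_\<nu>: "\<And>b k. b \<in> carrier B \<Longrightarrow> k \<in> carrier K \<Longrightarrow> i1 (\<nu> b k) = \<phi> (sG b) (i1 k)"
    and i1_\<mu>: "\<And>a k. a \<in> carrier A \<Longrightarrow> k \<in> carrier K \<Longrightarrow>
                 i1 (\<mu> a k) = inv\<^bsub>H\<^esub> (sH a) \<otimes>\<^bsub>H\<^esub> i1 k \<otimes>\<^bsub>H\<^esub> sH a"
    and i2_\<sigma>: "\<And>b l. b \<in> carrier B \<Longrightarrow> l \<in> carrier L \<Longrightarrow>
                 i2 (\<sigma> b l) = inv\<^bsub>G\<^esub> (sG b) \<otimes>\<^bsub>G\<^esub> i2 l \<otimes>\<^bsub>G\<^esub> sG b"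
    and i1_f: "\<And>l a. l \<in> carrier L \<Longrightarrow> a \<in> carrier A \<Longrightarrow>
                 i1 (f l a) = inv\<^bsub>H\<^esub> (sH a) \<otimes>\<^bsub>H\<^esub> \<phi> (i2 l) (sH a)"
    by auto
  interpret act: automorphic_action G H \<phi>
    using rrb_H by (simp add: automorphic_action_def automorphic_action_axioms_def)
  have i2S: "\<And>k. k \<in> carrier K \<Longrightarrow> i2 (S k) = R (i1 k)"
    and i1_\<alpha>: "\<And>l k. l \<in> carrier L \<Longrightarrow> k \<in> carrier K \<Longrightarrow> i1 (\<alpha> l k) = \<phi> (i2 l) (i1 k)"
    and i_hom: "i1 \<in> hom K H" "i2 \<in> hom L G"
    and i_inj: "inj_on i1 (carrier K)" "inj_on i2 (carrier L)"
    using emb by auto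
  have \<pi>2R: "\<And>h. h \<in> carrier H \<Longrightarrow> \<pi>2 (R h) = T (\<pi>1 h)"
    and \<pi>1\<phi>: "\<And>g h. g \<in> carrier G \<Longrightarrow> h \<in> carrier H \<Longrightarrow> \<pi>1 (\<phi> g h) = \<beta> (\<pi>2 g) (\<pi>1 h)"
    and \<pi>_hom: "\<pi>1 \<in> hom H A" "\<pi>2 \<in> hom G B"
    using epi by auto
  have R_closed [simp]: "\<And>h. h \<in> carrier H \<Longrightarrow> R h \<in> carrier G"
    and R_mult: "\<And>h h'. h \<in> carrier H \<Longrightarrow> h' \<in> carrier H \<Longrightarrow>
                   R (h \<otimes>\<^bsub>H\<^esub> \<phi> (R h) h') = R h \<otimes>\<^bsub>G\<^esub> R h'"
    using rrb_H by auto
  interpret EH: normalized_group_extension K H A i1 \<pi>1 sH \<mu>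
    using i_hom i_inj \<pi>_hom ker sec i1_\<mu> by unfold_locales simp_all
  interpret EG: normalized_group_extension L G B i2 \<pi>2 sG \<sigma>
    using i_hom i_inj \<pi>_hom ker sec i2_\<sigma> by unfold_locales simp_all
  have R_one: "R \<one>\<^bsub>H\<^esub> = \<one>\<^bsub>G\<^esub>"
    using R_mult[of "\<one>\<^bsub>H\<^esub>" "\<one>\<^bsub>H\<^esub>"] by (simp add: act.G.r_cancel_one')
  define \<tau>1 where "\<tau>1 = (\<lambda>(a1, a2)\<in>carrier A \<times> carrier A. EH.kpart (sH a1 \<otimes>\<^bsub>H\<^esub> sH a2))"
  define \<tau>2 where "\<tau>2 = (\<lambda>(b1, b2)\<in>carrier B \<times> carrier B. EG.kpart (sG b1 \<otimes>\<^bsub>G\<^esub> sG b2))"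
  define \<rho> where "\<rho> = (\<lambda>(a, b)\<in>carrier A \<times> carrier B. EH.kpart (\<phi> (sG b) (sH a)))"
  define \<chi> where "\<chi> = (\<lambda>a\<in>carrier A. EG.kpart (R (sH a)))"
  have \<phi>_sH: "\<phi> (sG b) (sH a) = sH (\<beta> b a) \<otimes>\<^bsub>H\<^esub> i1 (\<rho> (a, b))"
    if "a \<in> carrier A" "b \<in> carrier B" for a b
    using that EH.kpart_spec(2)[of "\<phi> (sG b) (sH a)"] by (simp add: \<rho>_def \<pi>1\<phi>)
  have R_sH: "R (sH a) = sG (T a) \<otimes>\<^bsub>G\<^esub> i2 (\<chi> a)" if "a \<in> carrier A" for a
    using that EG.kpart_spec(2)[of "R (sH a)"] by (simp add: \<chi>_def \<pi>2R)
  \<comment> \<open>Triviality of \<open>\<alpha>\<close>, carried over by the embedding.\<close>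
  have \<phi>_i: "\<phi> (i2 l) (i1 k) = i1 k" if "l \<in> carrier L" "k \<in> carrier K" for l k
    using that by (simp flip: i1_\<alpha>)
  have \<phi>_i2: "\<phi> (i2 l) (sH a) = sH a \<otimes>\<^bsub>H\<^esub> i1 (f l a)" if "l \<in> carrier L" "a \<in> carrier A" for l a
    using that by (simp add: i1_f flip: act.H.m_assoc)
  have cochain: "(\<tau>1, \<tau>2, \<rho>, \<chi>) \<in> carrier (C2_RRB (A, B, \<beta>, T) (K, L, \<alpha>, S))"
    unfolding C2_carrier_iff cochains1_carrier_iff cochains2_carrier_iff
    by (simp add: \<tau>1_def \<tau>2_def \<rho>_def \<chi>_def EH.kpart_spec EG.kpart_spec R_one)
      (use EH.kpart_s[of "\<one>\<^bsub>A\<^esub>"] EG.kpart_s[of "\<one>\<^bsub>B\<^esub>"] in simp)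
  have cl: "\<And>a b. a \<in> carrier A \<Longrightarrow> b \<in> carrier B \<Longrightarrow> \<rho> (a, b) \<in> carrier K"
    "\<And>a. a \<in> carrier A \<Longrightarrow> \<chi> a \<in> carrier L"
    by (simp_all add: \<rho>_def \<chi>_def EH.kpart_spec EG.kpart_spec)
  have "cocycle_presentation A B \<beta> T K L \<alpha> S \<nu> \<mu> \<sigma> f H G \<phi> R i1 i2 \<pi>1 \<pi>2 \<tau>1 \<tau>2 \<rho> \<chi>
      (\<lambda>a k. sH a \<otimes>\<^bsub>H\<^esub> i1 k) (\<lambda>b l. sG b \<otimes>\<^bsub>G\<^esub> i2 l)"
  proof (intro cocycle_presentation.intro rrb_module_data_axioms cocycle_presentation_axioms.intro
      cochain EH.coordinates_bij EG.coordinates_bij)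
    fix a k b l assume a: "a \<in> carrier A" "k \<in> carrier K" "b \<in> carrier B" "l \<in> carrier L"
    \<comment> \<open>First \<open>i2 l\<close> acts, contributing \<open>f l a\<close> and fixing
      \<open>i1 k\<close>; then \<open>sG b\<close> acts.\<close>
    have "\<phi> (sG b \<otimes>\<^bsub>G\<^esub> i2 l) (sH a \<otimes>\<^bsub>H\<^esub> i1 k) = \<phi> (sG b) (sH a \<otimes>\<^bsub>H\<^esub> i1 (f l a) \<otimes>\<^bsub>H\<^esub> i1 k)"
      using a by (simp add: act.act_comp \<phi>_i \<phi>_i2)
    also have "\<dots> = sH (\<beta> b a) \<otimes>\<^bsub>H\<^esub> i1 (\<rho> (a, b)) \<otimes>\<^bsub>H\<^esub> i1 (\<nu> b (f l a \<otimes>\<^bsub>K\<^esub> k))"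
      using a by (simp add: \<phi>_sH i1_\<nu> EH.i_mult act.H.m_assoc cl del: nu.act_mult)
    finally show "\<phi> (sG b \<otimes>\<^bsub>G\<^esub> i2 l) (sH a \<otimes>\<^bsub>H\<^esub> i1 k)
        = sH (\<beta> b a) \<otimes>\<^bsub>H\<^esub> i1 (\<rho> (a, b) \<otimes>\<^bsub>K\<^esub> \<nu> b (f l a \<otimes>\<^bsub>K\<^esub> k))"
      using a cl by (simp add: EH.i_mult act.H.m_assoc)
  next
    fix a k assume a: "a \<in> carrier A" "k \<in> carrier K"
    \<comment> \<open>With this \<open>k'\<close>, \<open>s\<^sub>H a \<cdot> k\<close> is \<open>s\<^sub>H a \<cdot> \<phi> (R (s\<^sub>H a)) k'\<close>, a product on which \<open>R\<close> is known.\<close>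
    define k' where "k' = \<nu>inv (T a) k"
    have k': "k' \<in> carrier K" "\<nu> (T a) k' = k"
      using a by (simp_all add: k'_def)
    \<comment> \<open>The factor \<open>i2 (\<chi> a)\<close> of \<open>R (sH a)\<close> fixes the
      image of \<open>K\<close>, and the factor \<open>sG (T a)\<close> acts on it by
      \<open>\<nu> (T a)\<close>.\<close>
    have "\<phi> (R (sH a)) (i1 k') = i1 k"
      using a k' cl by (simp add: R_sH act.act_comp \<phi>_i flip: i1_\<nu>)
    then have "R (sH a \<otimes>\<^bsub>H\<^esub> i1 k) = R (sH a) \<otimes>\<^bsub>G\<^esub> R (i1 k')"
      using a k' R_mult[of "sH a" "i1 k'"] by simp
    then show "R (sH a \<otimes>\<^bsub>H\<^esub> i1 k) = sG (T a) \<otimes>\<^bsub>G\<^esub> i2 (\<chi> a \<otimes>\<^bsub>L\<^esub> S (\<nu>inv (T a) k))"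
      using a k' cl by (simp add: R_sH EG.i_mult act.G.m_assoc flip: i2S k'_def)
  next
    show "\<phi> g \<in> extensional (carrier H)" if "g \<in> carrier G" for g
      using act.in_Aut[OF that] by (simp add: AutoGroup_carrier_iff)
  qed (simp_all add: EH.i_one EG.i_one EH.coordinates_mult EG.coordinates_mult \<tau>1_def \<tau>2_def)
  then show ?thesis
    by blast
qed

text \<open>Collecting all presenting cochains avoids a choice of sections, and for an extension
  with the given action the resulting set is itself an element of the quotient.\<close>

definition presented_by where
  "presented_by E = {z. case E of ((H, G, \<phi>, R), i1, i2, \<pi>1, \<pi>2) \<Rightarrow> case z of (\<tau>1, \<tau>2, \<rho>, \<chi>) \<Rightarrow>
     \<exists>u v. cocycle_presentation A B \<beta> T K L \<alpha> S \<nu> \<mu> \<sigma> f H G \<phi> R i1 i2 \<pi>1 \<pi>2 \<tau>1 \<tau>2 \<rho> \<chi> u v}"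

lemma presented_by_iff:
  "(\<tau>1, \<tau>2, \<rho>, \<chi>) \<in> presented_by ((H, G, \<phi>, R), i1, i2, \<pi>1, \<pi>2) \<longleftrightarrow>
     (\<exists>u v. cocycle_presentation A B \<beta> T K L \<alpha> S \<nu> \<mu> \<sigma> f H G \<phi> R i1 i2 \<pi>1 \<pi>2 \<tau>1 \<tau>2 \<rho> \<chi> u v)"
  by (simp add: presented_by_def)

section \<open>Presenting cochains as cohomology classes\<close>

abbreviation "cocycles \<equiv> Z2_RRB (A, B, \<beta>, T) (K, L, \<alpha>, S) (\<nu>, \<mu>, \<sigma>, f)"
abbreviation "coboundaries \<equiv> B2_RRB (A, B, \<beta>, T) (K, L, \<alpha>, S) (\<nu>, \<mu>, \<sigma>, f)"
abbreviation "cochains \<equiv> C2_RRB (A, B, \<beta>, T) (K, L, \<alpha>, S)"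

lemma presented_by_nonempty:
  assumes "E \<in> extensions_with_action (A, B, \<beta>, T) (K, L, \<alpha>, S) (\<nu>, \<mu>, \<sigma>, f)"
  shows "presented_by E \<noteq> {}"
proof -
  obtain H G \<phi> R i1 i2 \<pi>1 \<pi>2 where E_eq: "E = ((H, G, \<phi>, R), i1, i2, \<pi>1, \<pi>2)"
    by (metis prod.exhaust)
  from presentation_of_extension[OF assms[unfolded E_eq]] show ?thesis
    unfolding E_eq by (metis presented_by_iff empty_iff)
qed

text \<open>One inclusion compares two systems of coordinates, the other translates the given one by
  a 1-cochain. Membership in the cocycles comes from the axioms satisfied by the extension.\<close>

lemma presented_by_eq_coset:
  assumes ext: "E \<in> extensions_with_action (A, B, \<beta>, T) (K, L, \<alpha>, S) (\<nu>, \<mu>, \<sigma>, f)"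
    and z: "z \<in> presented_by E"
  shows "z \<in> cocycles" "presented_by E = coboundaries #>\<^bsub>cochains\<lparr>carrier := cocycles\<rparr>\<^esub> z"
proof -
  obtain H G \<phi> R i1 i2 \<pi>1 \<pi>2 where E_eq: "E = ((H, G, \<phi>, R), i1, i2, \<pi>1, \<pi>2)"
    by (metis prod.exhaust)
  obtain \<tau>1 \<tau>2 \<rho> \<chi> where z_eq: "z = (\<tau>1, \<tau>2, \<rho>, \<chi>)"
    by (metis prod_cases4)
  have rrb_H: "rrb_group (H, G, \<phi>, R)"
    using ext unfolding E_eq extensions_with_action_def by simp
  obtain u v where
    "cocycle_presentation A B \<beta> T K L \<alpha> S \<nu> \<mu> \<sigma> f H G \<phi> R i1 i2 \<pi>1 \<pi>2 \<tau>1 \<tau>2 \<rho> \<chi> u v"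
    using z unfolding E_eq z_eq presented_by_iff by blast
  then interpret cocycle_presentation A B \<beta> T K L \<alpha> S \<nu> \<mu> \<sigma> f H G \<phi> R i1 i2 \<pi>1 \<pi>2 \<tau>1 \<tau>2 \<rho> \<chi> u v .
  show "z \<in> cocycles"
    unfolding z_eq Z2_iff using cochain cocycle_identities_if_rrb_group[OF rrb_H] by blast
  \<comment> \<open>Changing the carrier does not change the product, so the coset is computed with
    the product of cochains.\<close>
  have coset: "coboundaries #>\<^bsub>cochains\<lparr>carrier := cocycles\<rparr>\<^esub> z = (\<lambda>b. b \<otimes>\<^bsub>cochains\<^esub> z) ` coboundaries"
    unfolding r_coset_def by (auto simp del: C2_RRB.simps)
  have zC: "z \<in> carrier cochains"
    using cochain unfolding z_eq .
  show "presented_by E = coboundaries #>\<^bsub>cochains\<lparr>carrier := cocycles\<rparr>\<^esub> z"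
    unfolding coset
  proof (intro subset_antisym subsetI)
    fix z' assume z': "z' \<in> presented_by E"
    obtain \<tau>1' \<tau>2' \<rho>' \<chi>' where z'_eq: "z' = (\<tau>1', \<tau>2', \<rho>', \<chi>')"
      by (metis prod_cases4)
    obtain u' v' where P':
      "cocycle_presentation A B \<beta> T K L \<alpha> S \<nu> \<mu> \<sigma> f H G \<phi> R i1 i2 \<pi>1 \<pi>2 \<tau>1' \<tau>2' \<rho>' \<chi>' u' v'"
      using z' unfolding E_eq z'_eq presented_by_iff by blast
    have z'C: "z' \<in> carrier cochains"
      using cocycle_presentation.cochain[OF P'] unfolding z'_eq .
    obtain \<theta>1 \<theta>2 where \<theta>: "(\<theta>1, \<theta>2) \<in> carrier (C1_RRB (A, B, \<beta>, T) (K, L, \<alpha>, S))"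
      "cohomologous_by \<theta>1 \<theta>2 z z'"
      using cocycles_of_presentations_cohomologous[OF P'] unfolding z_eq z'_eq by blast
    then show "z' \<in> (\<lambda>b. b \<otimes>\<^bsub>cochains\<^esub> z) ` coboundaries"
      using coboundary_mult_eq_iff[OF zC z'C \<theta>(1)] unfolding B2_RRB_def by blast
  next
    fix z' assume "z' \<in> (\<lambda>b. b \<otimes>\<^bsub>cochains\<^esub> z) ` coboundaries"
    then obtain b where b: "b \<in> coboundaries" "z' = b \<otimes>\<^bsub>cochains\<^esub> z" by blast
    then obtain \<theta>1 \<theta>2 where \<theta>: "(\<theta>1, \<theta>2) \<in> carrier (C1_RRB (A, B, \<beta>, T) (K, L, \<alpha>, S))"
      "b = partial1_RRB (A, B, \<beta>, T) (K, L, \<alpha>, S) (\<nu>, \<mu>, \<sigma>, f) (\<theta>1, \<theta>2)"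
      unfolding B2_RRB_def by auto
    have z'C: "z' \<in> carrier cochains"
      unfolding b(2) by (rule coboundary_mult_closed[OF zC b(1)])
    obtain \<tau>1' \<tau>2' \<rho>' \<chi>' where z'_eq: "z' = (\<tau>1', \<tau>2', \<rho>', \<chi>')"
      by (metis prod_cases4)
    have "cohomologous_by \<theta>1 \<theta>2 z z'"
      using coboundary_mult_eq_iff[OF zC z'C \<theta>(1)] b(2) \<theta>(2) by blast
    then show "z' \<in> presented_by E"
      unfolding E_eq z'_eq presented_by_iff
      using presentation_shift[OF z'C[unfolded z'_eq] \<theta>(1)] unfolding z_eq z'_eq by blast
  qed
qed

text \<open>The surjectivity half: the size conditions provide injections along which a model is
  built, and the cocycle identities make it an extension.\<close>

lemma extension_of_cocycle:
  assumes z: "z \<in> cocycles"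
    and large: "carrier A \<times> carrier K \<lesssim> (UNIV :: 'h set)" "carrier B \<times> carrier L \<lesssim> (UNIV :: 'g set)"
  shows "\<exists>E :: ('h, 'g, 'a, 'b, 'k, 'l) rrb_ext.
    E \<in> extensions_with_action (A, B, \<beta>, T) (K, L, \<alpha>, S) (\<nu>, \<mu>, \<sigma>, f) \<and> z \<in> presented_by E"
proof -
  obtain \<tau>1 \<tau>2 \<rho> \<chi> where z_eq: "z = (\<tau>1, \<tau>2, \<rho>, \<chi>)"
    by (metis prod_cases4)
  have cochain: "(\<tau>1, \<tau>2, \<rho>, \<chi>) \<in> carrier cochains" and ids: "cocycle_identities \<tau>1 \<tau>2 \<rho> \<chi>"
    using z unfolding z_eq Z2_iff by blast+
  obtain U :: "'a \<times> 'k \<Rightarrow> 'h" and V :: "'b \<times> 'l \<Rightarrow> 'g"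
    where "inj_on U (carrier A \<times> carrier K)" "inj_on V (carrier B \<times> carrier L)"
    using large unfolding lepoll_def by blast
  from presentation_exists[OF cochain this]
  obtain H :: "'h monoid" and G :: "'g monoid" and \<phi> R i1 i2 \<pi>1 \<pi>2 where P:
    "cocycle_presentation A B \<beta> T K L \<alpha> S \<nu> \<mu> \<sigma> f H G \<phi> R i1 i2 \<pi>1 \<pi>2 \<tau>1 \<tau>2 \<rho> \<chi>
      (\<lambda>a k. U (a, k)) (\<lambda>b l. V (b, l))"
    by blast
  then interpret cocycle_presentation A B \<beta> T K L \<alpha> S \<nu> \<mu> \<sigma> f H G \<phi> R i1 i2 \<pi>1 \<pi>2 \<tau>1 \<tau>2 \<rho> \<chi>
      "\<lambda>a k. U (a, k)" "\<lambda>b l. V (b, l)" .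
  show ?thesis
    using in_extensions_with_action[OF rrb_group_if_cocycle_identities[OF ids]] P
    unfolding z_eq by (metis presented_by_iff)
qed

text \<open>An equivalence carries over one presentation, after which both sets are the coset of the
  same cochain; conversely, a common cochain gives matching coordinates.\<close>

lemma ext_equivalent_iff:
  fixes E E' :: "('h, 'g, 'a, 'b, 'k, 'l) rrb_ext"
  assumes ext: "E \<in> extensions_with_action (A, B, \<beta>, T) (K, L, \<alpha>, S) (\<nu>, \<mu>, \<sigma>, f)"
    and ext': "E' \<in> extensions_with_action (A, B, \<beta>, T) (K, L, \<alpha>, S) (\<nu>, \<mu>, \<sigma>, f)"
  shows "ext_equivalent (A, B, \<beta>, T) (K, L, \<alpha>, S) E E' \<longleftrightarrow> presented_by E = presented_by E'"
proof -
  obtain H G \<phi> R i1 i2 \<pi>1 \<pi>2 where E_eq: "E = ((H, G, \<phi>, R), i1, i2, \<pi>1, \<pi>2)"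
    by (metis prod.exhaust)
  obtain H' G' \<phi>' R' i1' i2' \<pi>1' \<pi>2' where E'_eq: "E' = ((H', G', \<phi>', R'), i1', i2', \<pi>1', \<pi>2')"
    by (metis prod.exhaust)
  have rrb_H: "rrb_group (H, G, \<phi>, R)" and rrb_H': "rrb_group (H', G', \<phi>', R')"
    using ext ext' unfolding E_eq E'_eq extensions_with_action_def by simp_all
  obtain z where z: "z \<in> presented_by E"
    using presented_by_nonempty[OF ext] by blast
  obtain \<tau>1 \<tau>2 \<rho> \<chi> where z_eq: "z = (\<tau>1, \<tau>2, \<rho>, \<chi>)"
    by (metis prod_cases4)
  obtain u v where
    "cocycle_presentation A B \<beta> T K L \<alpha> S \<nu> \<mu> \<sigma> f H G \<phi> R i1 i2 \<pi>1 \<pi>2 \<tau>1 \<tau>2 \<rho> \<chi> u v"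
    using z unfolding E_eq z_eq presented_by_iff by blast
  then interpret cocycle_presentation A B \<beta> T K L \<alpha> S \<nu> \<mu> \<sigma> f H G \<phi> R i1 i2 \<pi>1 \<pi>2 \<tau>1 \<tau>2 \<rho> \<chi> u v .
  show ?thesis
  proof
    assume "ext_equivalent (A, B, \<beta>, T) (K, L, \<alpha>, S) E E'"
    then obtain \<eta> \<zeta> where iso: "rrb_iso (H, G, \<phi>, R) (H', G', \<phi>', R') \<eta> \<zeta>"
      and i: "\<And>k. k \<in> carrier K \<Longrightarrow> \<eta> (i1 k) = i1' k" "\<And>l. l \<in> carrier L \<Longrightarrow> \<zeta> (i2 l) = i2' l"
      and \<pi>: "\<And>h. h \<in> carrier H \<Longrightarrow> \<pi>1' (\<eta> h) = \<pi>1 h" "\<And>g. g \<in> carrier G \<Longrightarrow> \<pi>2' (\<zeta> g) = \<pi>2 g"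
      unfolding E_eq E'_eq ext_equivalent.simps by blast
    have "z \<in> presented_by E'"
      unfolding E'_eq z_eq presented_by_iff
      using presentation_transport[OF rrb_H rrb_H' iso i \<pi>] by blast
    then show "presented_by E = presented_by E'"
      using presented_by_eq_coset(2)[OF ext z] presented_by_eq_coset(2)[OF ext'] by simp
  next
    assume "presented_by E = presented_by E'"
    then have "z \<in> presented_by E'"
      using z by simp
    then obtain u' v' where
      "cocycle_presentation A B \<beta> T K L \<alpha> S \<nu> \<mu> \<sigma> f H' G' \<phi>' R' i1' i2' \<pi>1' \<pi>2' \<tau>1 \<tau>2 \<rho> \<chi> u' v'"
      unfolding E'_eq z_eq presented_by_iff by blast
    then show "ext_equivalent (A, B, \<beta>, T) (K, L, \<alpha>, S) E E'"
      unfolding E_eq E'_eq by (rule equivalent_if_same_cocycle)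
  qed
qed

section \<open>The bijection with the second cohomology\<close>

lemma carrier_H2:
  "carrier (H2_RRB (A, B, \<beta>, T) (K, L, \<alpha>, S) (\<nu>, \<mu>, \<sigma>, f))
     = (\<lambda>z. coboundaries #>\<^bsub>cochains\<lparr>carrier := cocycles\<rparr>\<^esub> z) ` cocycles"
  unfolding H2_RRB_def FactGroup_def RCOSETS_def by auto

text \<open>Equivalence of extensions is the kernel relation of \<open>presented_by\<close>, and the
  image of \<open>presented_by\<close> is the set of all cosets of coboundaries in the
  cocycles.\<close>

lemma bij_betw_Ext_H2:
  assumes "carrier A \<times> carrier K \<lesssim> (UNIV :: 'h set)" "carrier B \<times> carrier L \<lesssim> (UNIV :: 'g set)"
  shows "bij_betw (\<lambda>c. the_elem (presented_by ` c))
     (Ext_RRB (A, B, \<beta>, T) (K, L, \<alpha>, S) (\<nu>, \<mu>, \<sigma>, f) :: ('h, 'g, 'a, 'b, 'k, 'l) rrb_ext set set)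
     (carrier (H2_RRB (A, B, \<beta>, T) (K, L, \<alpha>, S) (\<nu>, \<mu>, \<sigma>, f)))"
proof -
  let ?X = "extensions_with_action (A, B, \<beta>, T) (K, L, \<alpha>, S) (\<nu>, \<mu>, \<sigma>, f)
              :: ('h, 'g, 'a, 'b, 'k, 'l) rrb_ext set"
  have "presented_by ` ?X = (\<lambda>z. coboundaries #>\<^bsub>cochains\<lparr>carrier := cocycles\<rparr>\<^esub> z) ` cocycles"
  proof (intro subset_antisym image_subsetI)
    fix E assume ext: "E \<in> ?X"
    then obtain z where "z \<in> presented_by E"
      using presented_by_nonempty by blast
    then show "presented_by E \<in> (\<lambda>z. coboundaries #>\<^bsub>cochains\<lparr>carrier := cocycles\<rparr>\<^esub> z) ` cocycles"
      using presented_by_eq_coset[OF ext] by blast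
  next
    fix z assume "z \<in> cocycles"
    then show "coboundaries #>\<^bsub>cochains\<lparr>carrier := cocycles\<rparr>\<^esub> z \<in> presented_by ` ?X"
      using extension_of_cocycle[OF _ assms] presented_by_eq_coset(2) by blast
  qed
  moreover have "{(E, E'). E \<in> ?X \<and> E' \<in> ?X \<and> ext_equivalent (A, B, \<beta>, T) (K, L, \<alpha>, S) E E'}
      = {(E, E'). E \<in> ?X \<and> E' \<in> ?X \<and> presented_by E = presented_by E'}"
    using ext_equivalent_iff by blast
  ultimately show ?thesis
    unfolding Ext_RRB_def carrier_H2 using bij_betw_quotient_image[OF refl, where P = presented_by and X = ?X] by simp
qed

end

theorem theorem3p18:
  fixes A :: "'a monoid" and B :: "'b monoid" and \<beta> :: "'b \<Rightarrow> 'a \<Rightarrow> 'a" and T :: "'a \<Rightarrow> 'b"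
    and K :: "'k monoid" and L :: "'l monoid" and \<alpha> :: "'l \<Rightarrow> 'k \<Rightarrow> 'k" and S :: "'k \<Rightarrow> 'l"
    and \<nu> :: "'b \<Rightarrow> 'k \<Rightarrow> 'k" and \<mu> :: "'a \<Rightarrow> 'k \<Rightarrow> 'k" and \<sigma> :: "'b \<Rightarrow> 'l \<Rightarrow> 'l"
    and f :: "'l \<Rightarrow> 'a \<Rightarrow> 'k"
  assumes "rrb_group (A, B, \<beta>, T)"
    and "trivial_rrb (K, L, \<alpha>, S)" and "comm_group K" and "comm_group L"
    and "rrb_module (A, B, \<beta>, T) (K, L, \<alpha>, S) (\<nu>, \<mu>, \<sigma>, f)"
    and H2_well_defined: "B2_RRB (A, B, \<beta>, T) (K, L, \<alpha>, S) (\<nu>, \<mu>, \<sigma>, f)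
                            \<subseteq> Z2_RRB (A, B, \<beta>, T) (K, L, \<alpha>, S) (\<nu>, \<mu>, \<sigma>, f)"
    and H_type_large: "carrier A \<times> carrier K \<lesssim> (UNIV :: 'h set)"
    and G_type_large: "carrier B \<times> carrier L \<lesssim> (UNIV :: 'g set)"
  shows "\<exists>F. bij_betw F
           (Ext_RRB (A, B, \<beta>, T) (K, L, \<alpha>, S) (\<nu>, \<mu>, \<sigma>, f)
              :: ('h, 'g, 'a, 'b, 'k, 'l) rrb_ext set set)
           (carrier (H2_RRB (A, B, \<beta>, T) (K, L, \<alpha>, S) (\<nu>, \<mu>, \<sigma>, f)))"
proof -
  interpret rrb_module_data A B \<beta> T K L \<alpha> S \<nu> \<mu> \<sigma> f
    using assms(1-6) by (rule rrb_module_data.intro)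
  show ?thesis
    by (rule exI, rule bij_betw_Ext_H2[OF H_type_large G_type_large])
qed

end
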